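(* Let $(\varphi,(\lambda_i,Q_i)_{i\in\{1,\dots,\ell\}})$ be PDMP characteristics on $\mathsf M$ and $\mu_0\in\mathcal P(\mathsf M)$. Let $(X_t)_{t\ge 0}$, with embedded chain $(X'_k,S_k,I_k)_{k\in\mathbb N}$, be defined by Construction A, and let $(Y_t)_{t\ge 0}$, with embedded chain $(Y'_k,\tilde S_k,\tilde I_k)_{k\in\mathbb N}$, be defined by Construction B, both from these characteristics and initial distribution $\mu_0$ (Constructions A and B are described in the context). Then the two Markov chains $(X'_k,S_k,I_k)_{k\in\mathbb N}$ and $(Y'_k,\tilde S_k,\tilde I_k)_{k\in\mathbb N}$ have the same distribution on $\big((\mathsf M\cup\{\infty\})\times(\mathbb R_+\cup\{+\infty\})\times\{1,\dots,\ell\}\big)^{\mathbb N}$. Therefore $(X_t)_{t\ge0}$ and $(Y_t)_{t\ge0}$ have the same distribution on $D(\mathbb R_+,\mathsf M\cup\{\infty\})$.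
   Context: $\mathsf M$ is a smooth closed Riemannian submanifold of $\mathbb R^N$ with Borel $\sigma$-field $\mathcal B(\mathsf M)$; $\infty\notin\mathsf M$ is a cemetery point; $\mathcal P(\mathsf M)$ is the set of probability measures on $\mathsf M$; $\inf\emptyset=+\infty$; $\mathbb N=\{0,1,2,\dots\}$, $\mathbb N^*=\mathbb N\setminus\{0\}$. $D(\mathbb R_+,\mathsf M\cup\{\infty\})$ is the space of càdlàg functions with the Skorokhod topology. A differential flow on $\mathsf M$ is a measurable map $\varphi:(t,h,x)\mapsto\varphi_{t,t+h}(x)$ from $\mathbb R_+\times\mathbb R_+\times\mathsf M$ to $\mathsf M$ with $\varphi_{t,t}=\mathrm{Id}$, $\varphi_{t+h_1,t+h_1+h_2}\circ\varphi_{t,t+h_1}=\varphi_{t,t+h_1+h_2}$, such that $h\mapsto\varphi_{t,t+h}(x)$ is continuously differentiable for all $(t,x)$ and $\varphi_{t,t+h}$ is a $C^1$-diffeomorphism of $\mathsf M$ for all $t,h\ge0$. A jump rate is a measurable function $\lambda:\mathbb R_+\times\mathsf M\to\mathbb R_+$ bounded on every compact subset of $\mathbb R_+\times\mathsf M$. An (inhomogeneous) Markov kernel is a map $Q:\mathbb R_+\times\mathsf M\times\mathcal B(\mathsf M)\to[0,1]$ with $(t,x)\mapsto Q(t,x,A)$ measurable for all $A$ and $Q(t,x,\cdot)\in\mathcal P(\mathsf M)$ for all $(t,x)$. PDMP characteristics $(\varphi,(\lambda_i,Q_i)_{i\in\{1,\dots,\ell\}})$, $\ell\in\mathbb N^*$,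 consist of a differential flow, jump rates $\lambda_i$ and Markov kernels $Q_i$. For each $i$ fix a representation $G_i$ of $Q_i$: a measurable map $G_i:\mathbb R_+\times\mathsf M\times[0,1]\to\mathsf M$ with $Q_i(t,x,A)=\mathbb P(G_i(t,x,U)\in A)$ for $U$ uniform on $[0,1]$. Construction A. Let $W_0\sim\mu_0$ and, independently, let $((E_{j,k})_{j\in\{1,\dots,\ell\}},U_k)_{k\in\mathbb N^*}$ be i.i.d. in $k$, with $U_k$ uniform on $[0,1]$, $E_{j,k}$ exponential with parameter $1$, all independent. Set $S_0=0$, $X_0'=W_0=X_0$, $I_0=1$. Given $(X'_k,S_k)$ with $X'_k\in\mathsf M$, $S_k<\infty$, set $S_{j,k+1}=\inf\{t\ge S_k: E_{j,k+1}<\int_{S_k}^t\lambda_j(s,\varphi_{S_k,s}(X_k'))\,ds\}$ and $S_{k+1}=\min_jS_{j,k+1}$. If $S_{k+1}=+\infty$, set $S_m=+\infty$, $X'_m=\infty$, $I_m=1$ for all $m>k$ and $X_t=\varphi_{S_k,t}(X_k')$ for all $t\ge S_k$. If $S_{k+1}<+\infty$, set $I_{k+1}=\min\{j:S_{j,k+1}=S_{k+1}\}$, $X'_{k+1}=G_{I_{k+1}}(S_{k+1},\varphi_{S_k,S_{k+1}}(X'_k),U_{k+1})$, $X_t=\varphi_{S_k,t}(X'_k)$ for $t\in(S_k,S_{k+1})$ and $X_{S_{k+1}}=X'_{k+1}$. For $t\ge\sup_kS_k$, set $X_t=\infty$. Construction B. Let $W_0\sim\mu_0$ and, independently, let $(E_{j,k},U_{j,k})_{j\in\{1,\dots,\ell\},k\in\mathbb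 N^*}$ be i.i.d. with $U_{j,k}$ uniform on $[0,1]$ and $E_{j,k}$ exponential with parameter $1$ independent of $U_{j,k}$. Set $\tilde S_0=0$, $Y_0'=W_0=Y_0$, $\tilde I_0=1$, $\bar N_0=1$, and $\tilde H_{j,1}=E_{j,1}$, $\tilde N_{j,1}=1$ for all $j$. Given the objects up to step $k$ with $\tilde S_k<\infty$, set $\tilde S_{j,k+1}=\inf\{t>\tilde S_k:\tilde H_{j,k+1}<\int_{\tilde S_k}^t\lambda_j(s,\varphi_{\tilde S_k,s}(Y'_k))\,ds\}$ and $\tilde S_{k+1}=\min_j\tilde S_{j,k+1}$. If $\tilde S_{k+1}=+\infty$, set $\tilde S_m=+\infty$, $Y_m'=\infty$, $\tilde I_m=1$ for all $m>k$ and $Y_t=\varphi_{\tilde S_k,t}(Y'_k)$ for $t\ge\tilde S_k$. If $\tilde S_{k+1}<+\infty$, set $\tilde I_{k+1}=\min\{j:\tilde S_{j,k+1}=\tilde S_{k+1}\}$, $\bar N_{k+1}=\tilde N_{\tilde I_{k+1},k+2}=\tilde N_{\tilde I_{k+1},k+1}+1$, $Y'_{k+1}=G_{\tilde I_{k+1}}(\tilde S_{k+1},\varphi_{\tilde S_k,\tilde S_{k+1}}(Y'_k),U_{\tilde I_{k+1},\bar N_{k+1}})$, $\tilde H_{\tilde I_{k+1},k+2}=E_{\tilde I_{k+1},\bar N_{k+1}}$, and for $j\ne\tilde I_{k+1}$, $\tilde H_{j,k+2}=\tilde H_{j,k+1}-\int_{\tilde S_k}^{\tilde S_{k+1}}\lambda_j(s,\varphi_{\tilde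 S_k,s}(Y'_k))\,ds$, $\tilde N_{j,k+2}=\tilde N_{j,k+1}$; moreover $Y_t=\varphi_{\tilde S_k,t}(Y_k')$ for $t\in(\tilde S_k,\tilde S_{k+1})$ and $Y_{\tilde S_{k+1}}=Y'_{k+1}$. For $t\ge\sup_k\tilde S_k$, set $Y_t=\infty$.
   Formalization: Paths may fail to be càdlàg at the explosion time under these assumptions, so the law on D is rendered as: X and Y give equal probability to every Skorokhod-Borel subset of D, and a.s. each is càdlàg or has no left limit at a finite positive explosion time sup S_k. *)

theory Defs
  imports "HOL-Probability.Probability"
begin

section \<open>Embedded submanifolds of a Euclidean space\<close>

primrec Ck_on :: "nat \<Rightarrow> ('a::euclidean_space \<Rightarrow> 'b::euclidean_space) \<Rightarrow> 'a set \<Rightarrow> bool" where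
  "Ck_on 0 f U \<longleftrightarrow> continuous_on U f"
| "Ck_on (Suc k) f U \<longleftrightarrow>
     (\<exists>f'. (\<forall>x\<in>U. (f has_derivative f' x) (at x)) \<and> (\<forall>v. Ck_on k (\<lambda>x. f' x v) U))"

definition smooth_on :: "('a::euclidean_space \<Rightarrow> 'b::euclidean_space) \<Rightarrow> 'a set \<Rightarrow> bool" where
  "smooth_on f U \<longleftrightarrow> (\<forall>k. Ck_on k f U)"

text \<open>The model space is one linear subspace \<open>V\<close> for all charts, so the dimension is constant.
  A Riemannian submanifold carries the induced metric, hence no further data.\<close>

definition smooth_submanifold :: "'a::euclidean_space set \<Rightarrow> bool" where
  "smooth_submanifold M \<longleftrightarrow>
     (\<exists>V :: 'a set. subspace V \<and>
       (\<forall>p\<in>M. \<exists>U W \<Phi> \<Psi>. open U \<and> p \<in> U \<and> open W \<and>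
          smooth_on \<Phi> U \<and> smooth_on \<Psi> W \<and> \<Phi> ` U = W \<and> (\<forall>x\<in>U. \<Psi> (\<Phi> x) = x) \<and>
          \<Phi> ` (U \<inter> M) = W \<inter> V))"

text \<open>A map on an embedded submanifold is \<open>C\<^sup>1\<close> iff it extends locally to a \<open>C\<^sup>1\<close> map on an
  open subset of the ambient space.\<close>

definition C1_on_manifold :: "'a::euclidean_space set \<Rightarrow> ('a \<Rightarrow> 'a) \<Rightarrow> bool" where
  "C1_on_manifold M f \<longleftrightarrow>
     (\<forall>p\<in>M. \<exists>U g. open U \<and> p \<in> U \<and> Ck_on 1 g U \<and> (\<forall>x\<in>U \<inter> M. g x = f x))"

definition C1_diffeomorphism :: "'a::euclidean_space set \<Rightarrow> ('a \<Rightarrow> 'a) \<Rightarrow> bool" where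
  "C1_diffeomorphism M f \<longleftrightarrow>
     bij_betw f M M \<and> C1_on_manifold M f \<and> C1_on_manifold M (the_inv_into M f)"

text \<open>The library's \<open>C1_differentiable_on\<close> uses two-sided derivatives; here the derivative at
  \<open>0\<close> is one-sided.\<close>

definition C1_curve :: "(real \<Rightarrow> 'a::euclidean_space) \<Rightarrow> bool" where
  "C1_curve c \<longleftrightarrow>
     (\<exists>v. continuous_on {0..} v \<and>
       (\<forall>h\<ge>0. (c has_vector_derivative v h) (at h within {0..})))"


section \<open>PDMP characteristics\<close>

definition time_space :: "real measure" where
  "time_space = restrict_space borel {0..}"

definition manifold_borel :: "'a::euclidean_space set \<Rightarrow> 'a measure" where
  "manifold_borel M = restrict_space borel M"

text \<open>Lebesgue measure on \<open>[0,1]\<close> has total mass one.\<close>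

definition unif01 :: "real measure" where
  "unif01 = restrict_space lborel {0..1}"

text \<open>\<open>\<phi> s t x\<close> stands for \<open>\<phi>\<^sub>s\<^sub>,\<^sub>t(x)\<close>; only the values for \<open>0 \<le> s \<le> t\<close> and \<open>x \<in> M\<close> matter.\<close>

definition differential_flow ::
    "'a::euclidean_space set \<Rightarrow> (real \<Rightarrow> real \<Rightarrow> 'a \<Rightarrow> 'a) \<Rightarrow> bool" where
  "differential_flow M \<phi> \<longleftrightarrow>
     (\<lambda>(t, h, x). \<phi> t (t + h) x)
       \<in> time_space \<Otimes>\<^sub>M time_space \<Otimes>\<^sub>M manifold_borel M \<rightarrow>\<^sub>M manifold_borel M \<and>
     (\<forall>t\<ge>0. \<forall>x\<in>M. \<phi> t t x = x) \<and>
     (\<forall>t\<ge>0. \<forall>h1\<ge>0. \<forall>h2\<ge>0. \<forall>x\<in>M.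
        \<phi> (t + h1) (t + h1 + h2) (\<phi> t (t + h1) x) = \<phi> t (t + h1 + h2) x) \<and>
     (\<forall>t\<ge>0. \<forall>x\<in>M. C1_curve (\<lambda>h. \<phi> t (t + h) x)) \<and>
     (\<forall>t\<ge>0. \<forall>h\<ge>0. C1_diffeomorphism M (\<phi> t (t + h)))"

definition jump_rate :: "'a::euclidean_space set \<Rightarrow> (real \<Rightarrow> 'a \<Rightarrow> real) \<Rightarrow> bool" where
  "jump_rate M r \<longleftrightarrow>
     (\<lambda>(t, x). r t x) \<in> borel_measurable (time_space \<Otimes>\<^sub>M manifold_borel M) \<and>
     (\<forall>t\<ge>0. \<forall>x\<in>M. 0 \<le> r t x) \<and>
     (\<forall>K. compact K \<and> K \<subseteq> {0..} \<times> M \<longrightarrow> (\<exists>B. \<forall>(t, x)\<in>K. r t x \<le> B))"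

definition markov_kernel :: "'a::euclidean_space set \<Rightarrow> (real \<Rightarrow> 'a \<Rightarrow> 'a measure) \<Rightarrow> bool" where
  "markov_kernel M Q \<longleftrightarrow>
     (\<forall>t\<ge>0. \<forall>x\<in>M. prob_space (Q t x) \<and> sets (Q t x) = sets (manifold_borel M)) \<and>
     (\<forall>A\<in>sets (manifold_borel M).
        (\<lambda>(t, x). measure (Q t x) A) \<in> borel_measurable (time_space \<Otimes>\<^sub>M manifold_borel M))"

definition pdmp_characteristics ::
    "'a::euclidean_space set \<Rightarrow> nat \<Rightarrow> (real \<Rightarrow> real \<Rightarrow> 'a \<Rightarrow> 'a) \<Rightarrow>
     (nat \<Rightarrow> real \<Rightarrow> 'a \<Rightarrow> real) \<Rightarrow> (nat \<Rightarrow> real \<Rightarrow> 'a \<Rightarrow> 'a measure) \<Rightarrow> bool" where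
  "pdmp_characteristics M l \<phi> rate Q \<longleftrightarrow>
     1 \<le> l \<and> differential_flow M \<phi> \<and>
     (\<forall>i\<in>{1..l}. jump_rate M (rate i) \<and> markov_kernel M (Q i))"

definition kernel_representation ::
    "'a::euclidean_space set \<Rightarrow> (real \<Rightarrow> 'a \<Rightarrow> 'a measure) \<Rightarrow> (real \<Rightarrow> 'a \<Rightarrow> real \<Rightarrow> 'a) \<Rightarrow> bool"
  where
  "kernel_representation M Q G \<longleftrightarrow>
     (\<lambda>(t, x, u). G t x u) \<in> time_space \<Otimes>\<^sub>M manifold_borel M \<Otimes>\<^sub>M unif01 \<rightarrow>\<^sub>M manifold_borel M \<and>
     (\<forall>t\<ge>0. \<forall>x\<in>M. \<forall>A\<in>sets (manifold_borel M).
        measure (Q t x) A = measure unif01 {u \<in> space unif01. G t x u \<in> A})"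


section \<open>The two constructions, for given values of the driving variables\<close>

text \<open>\<open>None\<close> is the cemetery point, and a time is an extended nonnegative real, so that
  \<open>Inf {}\<close> is infinite.  The integral below is finite for the arguments that occur: the integrand
  is bounded on bounded time intervals.\<close>

definition cumulative_rate ::
    "(real \<Rightarrow> real \<Rightarrow> 'a \<Rightarrow> 'a) \<Rightarrow> (real \<Rightarrow> 'a \<Rightarrow> real) \<Rightarrow> real \<Rightarrow> real \<Rightarrow> 'a \<Rightarrow> real" where
  "cumulative_rate \<phi> r s t x = (LINT q:{s..t}|lborel. r q (\<phi> s q x))"

definition jump_time_A ::
    "(real \<Rightarrow> real \<Rightarrow> 'a \<Rightarrow> 'a) \<Rightarrow> (real \<Rightarrow> 'a \<Rightarrow> real) \<Rightarrow> real \<Rightarrow> 'a \<Rightarrow> real \<Rightarrow> ennreal" where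
  "jump_time_A \<phi> r s x e = Inf {ennreal t | t. s \<le> t \<and> e < cumulative_rate \<phi> r s t x}"

definition jump_time_B ::
    "(real \<Rightarrow> real \<Rightarrow> 'a \<Rightarrow> 'a) \<Rightarrow> (real \<Rightarrow> 'a \<Rightarrow> real) \<Rightarrow> real \<Rightarrow> 'a \<Rightarrow> real \<Rightarrow> ennreal" where
  "jump_time_B \<phi> r s x e = Inf {ennreal t | t. s < t \<and> e < cumulative_rate \<phi> r s t x}"

definition first_time :: "nat \<Rightarrow> (nat \<Rightarrow> ennreal) \<Rightarrow> ennreal" where
  "first_time l T = Min (T ` {1..l})"

definition first_index :: "nat \<Rightarrow> (nat \<Rightarrow> ennreal) \<Rightarrow> nat" where
  "first_index l T = Min {j \<in> {1..l}. T j = first_time l T}"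

text \<open>\<open>chain_A \<dots> w e u k\<close> is \<open>(X'\<^sub>k, S\<^sub>k, I\<^sub>k)\<close> for \<open>W\<^sub>0 = w\<close>, \<open>E\<^sub>j\<^sub>,\<^sub>k = e j k\<close>, \<open>U\<^sub>k = u k\<close>.\<close>

primrec chain_A ::
    "nat \<Rightarrow> (real \<Rightarrow> real \<Rightarrow> 'a \<Rightarrow> 'a) \<Rightarrow> (nat \<Rightarrow> real \<Rightarrow> 'a \<Rightarrow> real) \<Rightarrow>
     (nat \<Rightarrow> real \<Rightarrow> 'a \<Rightarrow> real \<Rightarrow> 'a) \<Rightarrow>
     'a \<Rightarrow> (nat \<Rightarrow> nat \<Rightarrow> real) \<Rightarrow> (nat \<Rightarrow> real) \<Rightarrow> nat \<Rightarrow> 'a option \<times> ennreal \<times> nat" where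
  "chain_A l \<phi> rate G w e u 0 = (Some w, 0, 1)"
| "chain_A l \<phi> rate G w e u (Suc k) =
     (case chain_A l \<phi> rate G w e u k of
        (None, S, i) \<Rightarrow> (None, \<infinity>, 1)
      | (Some x, S, i) \<Rightarrow>
          (let s = enn2real S;
               T = (\<lambda>j. jump_time_A \<phi> (rate j) s x (e j (Suc k)));
               S' = first_time l T;
               s' = enn2real S';
               i' = first_index l T
           in if S' = \<infinity> then (None, \<infinity>, 1)
              else (Some (G i' s' (\<phi> s s' x) (u (Suc k))), S', i')))"

text \<open>The last two components of \<open>state_B \<dots> k\<close> are the remaining clocks \<open>j \<mapsto> H\<^sub>j\<^sub>,\<^sub>k\<^sub>+\<^sub>1\<close> and the
  counters \<open>j \<mapsto> N\<^sub>j\<^sub>,\<^sub>k\<^sub>+\<^sub>1\<close> of Construction B; after infinity they are irrelevant.\<close>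

primrec state_B ::
    "nat \<Rightarrow> (real \<Rightarrow> real \<Rightarrow> 'a \<Rightarrow> 'a) \<Rightarrow> (nat \<Rightarrow> real \<Rightarrow> 'a \<Rightarrow> real) \<Rightarrow>
     (nat \<Rightarrow> real \<Rightarrow> 'a \<Rightarrow> real \<Rightarrow> 'a) \<Rightarrow>
     'a \<Rightarrow> (nat \<Rightarrow> nat \<Rightarrow> real) \<Rightarrow> (nat \<Rightarrow> nat \<Rightarrow> real) \<Rightarrow> nat \<Rightarrow>
     'a option \<times> ennreal \<times> nat \<times> (nat \<Rightarrow> real) \<times> (nat \<Rightarrow> nat)" where
  "state_B l \<phi> rate G w e u 0 = (Some w, 0, 1, (\<lambda>j. e j 1), (\<lambda>j. 1))"
| "state_B l \<phi> rate G w e u (Suc k) =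
     (case state_B l \<phi> rate G w e u k of
        (None, S, i, H, N) \<Rightarrow> (None, \<infinity>, 1, H, N)
      | (Some y, S, i, H, N) \<Rightarrow>
          (let s = enn2real S;
               T = (\<lambda>j. jump_time_B \<phi> (rate j) s y (H j));
               S' = first_time l T;
               s' = enn2real S';
               i' = first_index l T;
               n = N i' + 1
           in if S' = \<infinity> then (None, \<infinity>, 1, H, N)
              else (Some (G i' s' (\<phi> s s' y) (u i' n)), S', i',
                    (\<lambda>j. if j = i' then e i' n else H j - cumulative_rate \<phi> (rate j) s s' y),
                    N(i' := n))))"

definition chain_B ::
    "nat \<Rightarrow> (real \<Rightarrow> real \<Rightarrow> 'a \<Rightarrow> 'a) \<Rightarrow> (nat \<Rightarrow> real \<Rightarrow> 'a \<Rightarrow> real) \<Rightarrow>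
     (nat \<Rightarrow> real \<Rightarrow> 'a \<Rightarrow> real \<Rightarrow> 'a) \<Rightarrow>
     'a \<Rightarrow> (nat \<Rightarrow> nat \<Rightarrow> real) \<Rightarrow> (nat \<Rightarrow> nat \<Rightarrow> real) \<Rightarrow> nat \<Rightarrow> 'a option \<times> ennreal \<times> nat" where
  "chain_B l \<phi> rate G w e u k =
     (case state_B l \<phi> rate G w e u k of (y, S, i, H, N) \<Rightarrow> (y, S, i))"

text \<open>Below the supremum of the jump times, the greatest \<open>k\<close> with \<open>S\<^sub>k \<le> t\<close> satisfies
  \<open>S\<^sub>k \<le> t < S\<^sub>k\<^sub>+\<^sub>1\<close>; the value at \<open>t = S\<^sub>k\<close> is \<open>X'\<^sub>k\<close> because \<open>\<phi>\<^sub>t\<^sub>,\<^sub>t\<close> is the identity.\<close>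

definition pdmp_path ::
    "(real \<Rightarrow> real \<Rightarrow> 'a \<Rightarrow> 'a) \<Rightarrow> (nat \<Rightarrow> 'a option \<times> ennreal \<times> nat) \<Rightarrow> real \<Rightarrow> 'a option" where
  "pdmp_path \<phi> c =
     (let x = (\<lambda>k. fst (c k)); S = (\<lambda>k. fst (snd (c k)))
      in (\<lambda>t\<in>{0..}.
            if (SUP k. S k) \<le> ennreal t then None
            else let k = (GREATEST k. S k \<le> ennreal t)
                 in map_option (\<phi> (enn2real (S k)) t) (x k)))"


section \<open>The driving random variables\<close>

text \<open>\<open>indep_var\<close> for random variables of different types.\<close>

definition independent_rv ::
    "'w measure \<Rightarrow> 'b measure \<Rightarrow> ('w \<Rightarrow> 'b) \<Rightarrow> 'c measure \<Rightarrow> ('w \<Rightarrow> 'c) \<Rightarrow> bool" where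
  "independent_rv P K V L Z \<longleftrightarrow>
     V \<in> P \<rightarrow>\<^sub>M K \<and> Z \<in> P \<rightarrow>\<^sub>M L \<and>
     prob_space.indep_set P {V -` A \<inter> space P |A. A \<in> sets K} {Z -` A \<inter> space P |A. A \<in> sets L}"

definition driving_A ::
    "'w measure \<Rightarrow> 'a::euclidean_space set \<Rightarrow> 'a measure \<Rightarrow> nat \<Rightarrow>
     ('w \<Rightarrow> 'a) \<Rightarrow> (nat \<Rightarrow> nat \<Rightarrow> 'w \<Rightarrow> real) \<Rightarrow> (nat \<Rightarrow> 'w \<Rightarrow> real) \<Rightarrow> bool" where
  "driving_A P M \<mu>\<^sub>0 l W E U \<longleftrightarrow>
     (let J = ({1..l} \<times> {1..}) <+> {1..};
          Z = case_sum (\<lambda>(j, k). E j k) U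
      in prob_space P \<and>
         W \<in> P \<rightarrow>\<^sub>M manifold_borel M \<and> distr P (manifold_borel M) W = \<mu>\<^sub>0 \<and>
         (\<forall>j\<in>{1..l}. \<forall>k\<ge>1. distributed P lborel (E j k) (exponential_density 1)) \<and>
         (\<forall>k\<ge>1. U k \<in> P \<rightarrow>\<^sub>M unif01 \<and> distr P unif01 (U k) = unif01) \<and>
         prob_space.indep_vars P (\<lambda>_. borel) Z J \<and>
         independent_rv P (manifold_borel M) W
           (\<Pi>\<^sub>M z\<in>J. borel) (\<lambda>\<omega>. \<lambda>z\<in>J. Z z \<omega>))"

definition driving_B ::
    "'w measure \<Rightarrow> 'a::euclidean_space set \<Rightarrow> 'a measure \<Rightarrow> nat \<Rightarrow>
     ('w \<Rightarrow> 'a) \<Rightarrow> (nat \<Rightarrow> nat \<Rightarrow> 'w \<Rightarrow> real) \<Rightarrow> (nat \<Rightarrow> nat \<Rightarrow> 'w \<Rightarrow> real) \<Rightarrow> bool" where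
  "driving_B P M \<mu>\<^sub>0 l W E U \<longleftrightarrow>
     (let J = ({1..l} \<times> {1..}) <+> ({1..l} \<times> {1..});
          Z = case_sum (\<lambda>(j, k). E j k) (\<lambda>(j, k). U j k)
      in prob_space P \<and>
         W \<in> P \<rightarrow>\<^sub>M manifold_borel M \<and> distr P (manifold_borel M) W = \<mu>\<^sub>0 \<and>
         (\<forall>j\<in>{1..l}. \<forall>k\<ge>1. distributed P lborel (E j k) (exponential_density 1)) \<and>
         (\<forall>j\<in>{1..l}. \<forall>k\<ge>1. U j k \<in> P \<rightarrow>\<^sub>M unif01 \<and> distr P unif01 (U j k) = unif01) \<and>
         prob_space.indep_vars P (\<lambda>_. borel) Z J \<and>
         independent_rv P (manifold_borel M) W
           (\<Pi>\<^sub>M z\<in>J. borel) (\<lambda>\<omega>. \<lambda>z\<in>J. Z z \<omega>))"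


section \<open>The state space with cemetery and the Skorokhod space\<close>

definition borel_of_topology :: "'a topology \<Rightarrow> 'a measure" where
  "borel_of_topology \<tau> = sigma (topspace \<tau>) {U. openin \<tau> U}"

definition with_cemetery :: "'a set \<Rightarrow> 'a option set" where
  "with_cemetery M = insert None (Some ` M)"

text \<open>A metric on \<open>M \<union> {\<infinity>}\<close> for which \<open>M\<close>, with its own topology, is an open subspace.  Among the
  topologies obtained in this way are the one with \<open>\<infinity>\<close> isolated and, for closed \<open>M\<close>, the one-point
  compactification.\<close>

definition cemetery_metric :: "'a::euclidean_space set \<Rightarrow> ('a option \<Rightarrow> 'a option \<Rightarrow> real) \<Rightarrow> bool"
  where
  "cemetery_metric M d \<longleftrightarrow>
     Metric_space (with_cemetery M) d \<and>
     (\<forall>U. U \<subseteq> M \<longrightarrow>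
        (openin (Metric_space.mtopology (with_cemetery M) d) (Some ` U) \<longleftrightarrow>
         openin (top_of_set M) U))"

definition chain_space :: "'a topology \<Rightarrow> nat \<Rightarrow> (nat \<Rightarrow> 'a \<times> ennreal \<times> nat) measure" where
  "chain_space \<tau> l = (\<Pi>\<^sub>M k\<in>UNIV. borel_of_topology \<tau> \<Otimes>\<^sub>M borel \<Otimes>\<^sub>M count_space {1..l})"

text \<open>Functions on \<open>[0,\<infinity>)\<close> are represented extensionally.\<close>

definition cadlag :: "'a topology \<Rightarrow> (real \<Rightarrow> 'a) set" where
  "cadlag \<tau> = {f \<in> {0..} \<rightarrow>\<^sub>E topspace \<tau>.
     (\<forall>t\<ge>0. limitin \<tau> f (f t) (at_right t)) \<and> (\<forall>t>0. \<exists>a. limitin \<tau> f a (at_left t))}"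

text \<open>Increasing bijections of \<open>[0,\<infinity>)\<close> are automatically homeomorphisms.\<close>

definition time_changes :: "(real \<Rightarrow> real) set" where
  "time_changes = {g. bij_betw g {0..} {0..} \<and> strict_mono_on {0..} g}"

text \<open>The neighbourhoods encode Skorokhod's J1 convergence on \<open>[0,\<infinity>)\<close>: \<open>f\<^sub>n\<close> tends to \<open>f\<close> iff for
  every \<open>T\<close> there are time changes \<open>g\<^sub>n\<close> such that \<open>g\<^sub>n t - t\<close> and \<open>d (f (g\<^sub>n t)) (f\<^sub>n t)\<close> tend to
  \<open>0\<close> uniformly on \<open>[0,T]\<close>.\<close>

definition skorokhod_nbhd ::
    "'a set \<Rightarrow> ('a \<Rightarrow> 'a \<Rightarrow> real) \<Rightarrow> (real \<Rightarrow> 'a) \<Rightarrow> real \<Rightarrow> real \<Rightarrow> (real \<Rightarrow> 'a) set" where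
  "skorokhod_nbhd S d f T \<epsilon> =
     {h \<in> cadlag (Metric_space.mtopology S d).
        \<exists>g\<in>time_changes. \<forall>t\<in>{0..T}. \<bar>g t - t\<bar> < \<epsilon> \<and> d (f (g t)) (h t) < \<epsilon>}"

definition skorokhod_topology ::
    "'a set \<Rightarrow> ('a \<Rightarrow> 'a \<Rightarrow> real) \<Rightarrow> (real \<Rightarrow> 'a) topology" where
  "skorokhod_topology S d = topology (\<lambda>A. A \<subseteq> cadlag (Metric_space.mtopology S d) \<and>
     (\<forall>f\<in>A. \<exists>T>0. \<exists>\<epsilon>>0. skorokhod_nbhd S d f T \<epsilon> \<subseteq> A))"

lemma openin_skorokhod_topology:
  "openin (skorokhod_topology S d) A \<longleftrightarrow> A \<subseteq> cadlag (Metric_space.mtopology S d) \<and>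
     (\<forall>f\<in>A. \<exists>T>0. \<exists>\<epsilon>>0. skorokhod_nbhd S d f T \<epsilon> \<subseteq> A)"
proof -
  let ?D = "cadlag (Metric_space.mtopology S d)"
  let ?P = "\<lambda>A. A \<subseteq> ?D \<and> (\<forall>f\<in>A. \<exists>T>0. \<exists>\<epsilon>>0. skorokhod_nbhd S d f T \<epsilon> \<subseteq> A)"
  have mono: "skorokhod_nbhd S d f T \<epsilon> \<subseteq> skorokhod_nbhd S d f T' \<epsilon>'"
    if "T' \<le> T" "\<epsilon> \<le> \<epsilon>'" for f T T' \<epsilon> \<epsilon>'
  proof
    fix h assume "h \<in> skorokhod_nbhd S d f T \<epsilon>"
    then obtain g where g: "h \<in> ?D" "g \<in> time_changes"
        "\<forall>t\<in>{0..T}. \<bar>g t - t\<bar> < \<epsilon> \<and> d (f (g t)) (h t) < \<epsilon>"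
      unfolding skorokhod_nbhd_def by blast
    have "\<bar>g t - t\<bar> < \<epsilon>' \<and> d (f (g t)) (h t) < \<epsilon>'" if t: "t \<in> {0..T'}" for t
    proof -
      have "t \<in> {0..T}" using t \<open>T' \<le> T\<close> by simp
      with g(3) have "\<bar>g t - t\<bar> < \<epsilon>" "d (f (g t)) (h t) < \<epsilon>" by blast+
      with \<open>\<epsilon> \<le> \<epsilon>'\<close> show ?thesis by linarith
    qed
    with g(1,2) show "h \<in> skorokhod_nbhd S d f T' \<epsilon>'"
      unfolding skorokhod_nbhd_def by blast
  qed
  have "?P (A \<inter> B)" if "?P A" "?P B" for A B
  proof (intro conjI ballI)
    show "A \<inter> B \<subseteq> ?D" using that by blast
  next
    fix f assume "f \<in> A \<inter> B"
    then obtain T1 e1 T2 e2 where *: "T1 > 0" "e1 > 0" "skorokhod_nbhd S d f T1 e1 \<subseteq> A"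
        "T2 > 0" "e2 > 0" "skorokhod_nbhd S d f T2 e2 \<subseteq> B"
      using \<open>?P A\<close> \<open>?P B\<close> by (metis IntE)
    have "skorokhod_nbhd S d f (max T1 T2) (min e1 e2) \<subseteq> A \<inter> B"
      using * mono[of T1 "max T1 T2" "min e1 e2" e1 f] mono[of T2 "max T1 T2" "min e1 e2" e2 f]
      by auto
    then show "\<exists>T>0. \<exists>\<epsilon>>0. skorokhod_nbhd S d f T \<epsilon> \<subseteq> A \<inter> B"
      using * by (intro exI[of _ "max T1 T2"] conjI exI[of _ "min e1 e2"]) auto
  qed
  moreover have "?P (\<Union>\<A>)" if "\<forall>A\<in>\<A>. ?P A" for \<A>
  proof (intro conjI ballI)
    show "\<Union>\<A> \<subseteq> ?D" using that by blast
  next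
    fix f assume "f \<in> \<Union>\<A>"
    then obtain A where "A \<in> \<A>" "f \<in> A" by blast
    then show "\<exists>T>0. \<exists>\<epsilon>>0. skorokhod_nbhd S d f T \<epsilon> \<subseteq> \<Union>\<A>"
      using that by (meson Union_upper subset_trans)
  qed
  ultimately have "istopology ?P"
    unfolding istopology_def by blast
  then show ?thesis
    unfolding skorokhod_topology_def by (simp add: topology_inverse')
qed

text \<open>The jump times accumulate at a positive finite time where the path has no left limit.  The
  assumptions on the characteristics do not exclude this: a flow that is not jointly continuous, or
  an isolated \<open>\<infinity>\<close>, allows it.\<close>

definition explodes_without_limit ::
    "'b topology \<Rightarrow> (nat \<Rightarrow> 'a option \<times> ennreal \<times> nat) \<Rightarrow> (real \<Rightarrow> 'b) \<Rightarrow> bool" where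
  "explodes_without_limit \<tau> c f \<longleftrightarrow>
     (\<exists>\<zeta>>0. (SUP k. fst (snd (c k))) = ennreal \<zeta> \<and> \<not> (\<exists>a. limitin \<tau> f a (at_left \<zeta>)))"

end

theory Submission
  imports Defs
begin

text \<open>Both chains are compared with the Markov chain whose step uses fresh exponential clocks.  For
  Construction B the induction carries the remaining clocks: given the history they are again independent
  standard exponential variables.  At a jump with index \<open>i\<close> at time \<open>t\<close> this follows from the
  memoryless property, since off a null set \<open>i\<close> is the first index iff the clock of every other index
  \<open>j\<close> exceeds its cumulative rate at \<open>t\<close>, and the clock of \<open>i\<close> is replaced by a table
  entry that the history has not used.  The path is a function of the chain, and an open set of the
  Skorokhod topology is a countable union of sets described by the values of the path at rational times.\<close>

section \<open>Resampling coordinates of a product measure\<close>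

definition resample :: "'k set \<Rightarrow> 'i set \<Rightarrow> ('i \<Rightarrow> 'k) \<Rightarrow> ('k \<Rightarrow> 'a) \<Rightarrow> ('i \<Rightarrow> 'a) \<Rightarrow> 'k \<Rightarrow> 'a" where
  "resample J I f \<omega> h = (\<lambda>z\<in>J. if z \<in> f ` I then h (the_inv_into I f z) else \<omega> z)"

lemma resample_same:
  assumes "inj_on f I" "f ` I \<subseteq> J" "i \<in> I"
  shows "resample J I f \<omega> h (f i) = h i"
  using assms by (auto simp: resample_def the_inv_into_f_f)

lemma resample_other: "z \<notin> f ` I \<Longrightarrow> z \<in> J \<Longrightarrow> resample J I f \<omega> h z = \<omega> z"
  by (simp add: resample_def)

lemma measurable_resample:
  assumes "inj_on f I" "f ` I \<subseteq> J"
  shows "(\<lambda>(\<omega>, h). resample J I f \<omega> h) \<in> PiM J \<nu> \<Otimes>\<^sub>M PiM I (\<lambda>i. \<nu> (f i)) \<rightarrow>\<^sub>M PiM J \<nu>"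
  unfolding resample_def split_beta
proof (rule measurable_restrict)
  fix z assume z: "z \<in> J"
  show "(\<lambda>x. if z \<in> f ` I then snd x (the_inv_into I f z) else fst x z)
      \<in> PiM J \<nu> \<Otimes>\<^sub>M PiM I (\<lambda>i. \<nu> (f i)) \<rightarrow>\<^sub>M \<nu> z"
  proof (cases "z \<in> f ` I")
    case True
    then obtain i where i: "i \<in> I" "z = f i" by auto
    have "(\<lambda>x. snd x i) \<in> PiM J \<nu> \<Otimes>\<^sub>M PiM I (\<lambda>i. \<nu> (f i)) \<rightarrow>\<^sub>M \<nu> (f i)"
      using i by measurable
    with i assms show ?thesis by (simp add: the_inv_into_f_f)
  next
    case False
    with z show ?thesis by simp
  qed
qed

lemma distr_resample:
  assumes \<nu>: "\<And>z. z \<in> J \<Longrightarrow> prob_space (\<nu> z)" and f: "inj_on f I" "f ` I \<subseteq> J"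
  shows "distr (PiM J \<nu> \<Otimes>\<^sub>M PiM I (\<lambda>i. \<nu> (f i))) (PiM J \<nu>) (\<lambda>(\<omega>, h). resample J I f \<omega> h) = PiM J \<nu>"
    (is "?D = _")
proof (rule measure_eqI_PiM_infinite[symmetric, OF refl])
  interpret J: prob_space "PiM J \<nu>" using \<nu> by (rule prob_space_PiM)
  interpret I: prob_space "PiM I (\<lambda>i. \<nu> (f i))" using \<nu> f by (intro prob_space_PiM) auto
  show "finite_measure (PiM J \<nu>)" by unfold_locales
  fix A K assume K: "finite K" "K \<subseteq> J" and A: "\<And>i. i \<in> K \<Longrightarrow> A i \<in> sets (\<nu> i)"
  let ?K2 = "{i \<in> I. f i \<in> K}"
  have fin: "finite ?K2"
    using K(1) f(1) by (rule finite_subset[rotated, OF finite_vimage_IntI[of K f I]]) auto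
  have *: "f ` ?K2 = K \<inter> f ` I" by auto
  have "PiM J \<nu> (prod_emb J \<nu> K (Pi\<^sub>E K A)) = (\<Prod>j\<in>K. \<nu> j (A j))"
    using \<nu> K A by (intro emeasure_PiM_emb) auto
  also have "\<dots> = (\<Prod>j\<in>K - f ` I. \<nu> j (A j)) * (\<Prod>j\<in>K \<inter> f ` I. \<nu> j (A j))"
    using K(1) by (subst prod.Int_Diff[of K _ "f ` I"]) (auto simp: mult.commute)
  also have "(\<Prod>j\<in>K \<inter> f ` I. \<nu> j (A j)) = (\<Prod>i\<in>?K2. \<nu> (f i) (A (f i)))"
    unfolding *[symmetric] using f(1) by (subst prod.reindex) (auto intro: inj_on_subset)
  also have "\<dots> = PiM I (\<lambda>i. \<nu> (f i)) (prod_emb I (\<lambda>i. \<nu> (f i)) ?K2 (\<Pi>\<^sub>E i\<in>?K2. A (f i)))"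
    using \<nu> f fin A by (intro emeasure_PiM_emb[symmetric]) auto
  also have "(\<Prod>j\<in>K - f ` I. \<nu> j (A j)) = PiM J \<nu> (prod_emb J \<nu> (K - f ` I) (Pi\<^sub>E (K - f ` I) A))"
    using \<nu> K A by (intro emeasure_PiM_emb[symmetric]) auto
  also have "\<dots> * PiM I (\<lambda>i. \<nu> (f i)) (prod_emb I (\<lambda>i. \<nu> (f i)) ?K2 (\<Pi>\<^sub>E i\<in>?K2. A (f i)))
      = (PiM J \<nu> \<Otimes>\<^sub>M PiM I (\<lambda>i. \<nu> (f i)))
         (prod_emb J \<nu> (K - f ` I) (Pi\<^sub>E (K - f ` I) A) \<times> prod_emb I (\<lambda>i. \<nu> (f i)) ?K2 (\<Pi>\<^sub>E i\<in>?K2. A (f i)))"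
    using K A fin by (intro I.emeasure_pair_measure_Times[symmetric] sets_PiM_I) auto
  also have "prod_emb J \<nu> (K - f ` I) (Pi\<^sub>E (K - f ` I) A) \<times> prod_emb I (\<lambda>i. \<nu> (f i)) ?K2 (\<Pi>\<^sub>E i\<in>?K2. A (f i))
     = (\<lambda>(\<omega>, h). resample J I f \<omega> h) -` prod_emb J \<nu> K (Pi\<^sub>E K A) \<inter> space (PiM J \<nu> \<Otimes>\<^sub>M PiM I (\<lambda>i. \<nu> (f i)))"
    (is "?L = ?R")
  proof (intro set_eqI, unfold split_paired_all, intro iffI)
    fix \<omega> h assume p: "(\<omega>, h) \<in> ?L"
    then have \<omega>: "\<omega> \<in> prod_emb J \<nu> (K - f ` I) (Pi\<^sub>E (K - f ` I) A)"
      and h: "h \<in> prod_emb I (\<lambda>i. \<nu> (f i)) ?K2 (\<Pi>\<^sub>E i\<in>?K2. A (f i))" by auto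
    then have sp: "(\<omega>, h) \<in> space (PiM J \<nu> \<Otimes>\<^sub>M PiM I (\<lambda>i. \<nu> (f i)))"
      by (auto simp: prod_emb_def space_pair_measure space_PiM)
    with measurable_space[OF measurable_resample[OF f] sp]
    have "resample J I f \<omega> h \<in> space (PiM J \<nu>)" by simp
    moreover have "resample J I f \<omega> h z \<in> A z" if "z \<in> K" for z
    proof (cases "z \<in> f ` I")
      case True
      then obtain i where "i \<in> I" "z = f i" by auto
      with that h f show ?thesis by (auto simp: resample_same prod_emb_def PiE_iff)
    next
      case False
      with that \<omega> K show ?thesis by (auto simp: resample_other prod_emb_def PiE_iff)
    qed
    ultimately have "resample J I f \<omega> h \<in> prod_emb J \<nu> K (Pi\<^sub>E K A)"
      by (auto simp: prod_emb_def space_PiM)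
    with sp show "(\<omega>, h) \<in> ?R" by simp
  next
    fix \<omega> h assume "(\<omega>, h) \<in> ?R"
    then have sp: "(\<omega>, h) \<in> space (PiM J \<nu> \<Otimes>\<^sub>M PiM I (\<lambda>i. \<nu> (f i)))"
      and r: "resample J I f \<omega> h \<in> prod_emb J \<nu> K (Pi\<^sub>E K A)" by auto
    have rA: "resample J I f \<omega> h z \<in> A z" if "z \<in> K" for z
      using r that by (auto simp: prod_emb_def PiE_iff)
    have "\<omega> z \<in> A z" if "z \<in> K - f ` I" for z
      using rA[of z] that K by (auto simp: resample_other)
    moreover have "h i \<in> A (f i)" if "i \<in> ?K2" for i
      using rA[of "f i"] that f by (auto simp: resample_same)
    ultimately show "(\<omega>, h) \<in> ?L"
      using sp by (auto simp: prod_emb_def space_pair_measure space_PiM)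
  qed
  also have "(PiM J \<nu> \<Otimes>\<^sub>M PiM I (\<lambda>i. \<nu> (f i))) \<dots> = ?D (prod_emb J \<nu> K (Pi\<^sub>E K A))"
    using K A by (intro emeasure_distr[symmetric] measurable_resample f sets_PiM_I) auto
  finally show "PiM J \<nu> (prod_emb J \<nu> K (Pi\<^sub>E K A)) = ?D (prod_emb J \<nu> K (Pi\<^sub>E K A))" .
qed simp

lemma nn_integral_integrate_out:
  assumes \<nu>: "\<And>z. z \<in> J \<Longrightarrow> prob_space (\<nu> z)" and f: "inj_on f I" "f ` I \<subseteq> J"
    and F: "F \<in> borel_measurable (PiM J \<nu>)"
    and eq: "\<And>\<omega>. \<omega> \<in> space (PiM J \<nu>) \<Longrightarrow> F \<omega> = \<Phi> \<omega> (\<lambda>i\<in>I. \<omega> (f i))"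
    and indep: "\<And>\<omega> \<omega>' h. \<omega> \<in> space (PiM J \<nu>) \<Longrightarrow> \<omega>' \<in> space (PiM J \<nu>) \<Longrightarrow>
        (\<And>z. z \<in> J - f ` I \<Longrightarrow> \<omega> z = \<omega>' z) \<Longrightarrow> \<Phi> \<omega> h = \<Phi> \<omega>' h"
  shows "(\<integral>\<^sup>+\<omega>. F \<omega> \<partial>PiM J \<nu>) = (\<integral>\<^sup>+\<omega>. (\<integral>\<^sup>+h. \<Phi> \<omega> h \<partial>PiM I (\<lambda>i. \<nu> (f i))) \<partial>PiM J \<nu>)"
proof -
  interpret I: prob_space "PiM I (\<lambda>i. \<nu> (f i))" using \<nu> f by (intro prob_space_PiM) auto
  note r = measurable_resample[OF f, of \<nu>]
  have "(\<integral>\<^sup>+\<omega>. F \<omega> \<partial>PiM J \<nu>)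
      = (\<integral>\<^sup>+\<omega>. F \<omega> \<partial>distr (PiM J \<nu> \<Otimes>\<^sub>M PiM I (\<lambda>i. \<nu> (f i))) (PiM J \<nu>) (\<lambda>(\<omega>, h). resample J I f \<omega> h))"
    by (subst distr_resample[OF \<nu> f]) auto
  also have "\<dots> = (\<integral>\<^sup>+p. F (resample J I f (fst p) (snd p)) \<partial>(PiM J \<nu> \<Otimes>\<^sub>M PiM I (\<lambda>i. \<nu> (f i))))"
    using r F by (subst nn_integral_distr) (auto simp: split_beta)
  also have "\<dots> = (\<integral>\<^sup>+\<omega>. (\<integral>\<^sup>+h. F (resample J I f \<omega> h) \<partial>PiM I (\<lambda>i. \<nu> (f i))) \<partial>PiM J \<nu>)"
    using measurable_compose[OF r F] by (subst I.nn_integral_fst[symmetric]) (auto simp: split_beta)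
  also have "\<dots> = (\<integral>\<^sup>+\<omega>. (\<integral>\<^sup>+h. \<Phi> \<omega> h \<partial>PiM I (\<lambda>i. \<nu> (f i))) \<partial>PiM J \<nu>)"
  proof (intro nn_integral_cong)
    fix \<omega> h assume \<omega>: "\<omega> \<in> space (PiM J \<nu>)" and h: "h \<in> space (PiM I (\<lambda>i. \<nu> (f i)))"
    have sp: "resample J I f \<omega> h \<in> space (PiM J \<nu>)"
      using measurable_space[OF r, of "(\<omega>, h)"] \<omega> h by (simp add: space_pair_measure)
    have "(\<lambda>i\<in>I. resample J I f \<omega> h (f i)) = h"
      using h f by (intro ext) (auto simp: resample_same space_PiM PiE_iff extensional_def)
    then have "F (resample J I f \<omega> h) = \<Phi> (resample J I f \<omega> h) h" using eq[OF sp] by simp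
    also have "\<dots> = \<Phi> \<omega> h"
      using sp \<omega> by (rule indep) (auto simp: resample_other)
    finally show "F (resample J I f \<omega> h) = \<Phi> \<omega> h" .
  qed
  finally show ?thesis .
qed

lemma nn_integral_integrate_out_one:
  assumes \<nu>: "\<And>z. z \<in> J \<Longrightarrow> prob_space (\<nu> z)" and z: "z \<in> J"
    and F: "F \<in> borel_measurable (PiM J \<nu>)"
    and eq: "\<And>\<omega>. \<omega> \<in> space (PiM J \<nu>) \<Longrightarrow> F \<omega> = \<Phi> \<omega> (\<omega> z)"
    and indep: "\<And>\<omega> \<omega>' h. \<omega> \<in> space (PiM J \<nu>) \<Longrightarrow> \<omega>' \<in> space (PiM J \<nu>) \<Longrightarrow>
        (\<And>y. y \<in> J - {z} \<Longrightarrow> \<omega> y = \<omega>' y) \<Longrightarrow> \<Phi> \<omega> h = \<Phi> \<omega>' h"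
    and \<Phi>: "\<And>\<omega>. \<omega> \<in> space (PiM J \<nu>) \<Longrightarrow> \<Phi> \<omega> \<in> borel_measurable (\<nu> z)"
  shows "(\<integral>\<^sup>+\<omega>. F \<omega> \<partial>PiM J \<nu>) = (\<integral>\<^sup>+\<omega>. (\<integral>\<^sup>+h. \<Phi> \<omega> h \<partial>\<nu> z) \<partial>PiM J \<nu>)"
proof -
  have "(\<integral>\<^sup>+\<omega>. F \<omega> \<partial>PiM J \<nu>) = (\<integral>\<^sup>+\<omega>. (\<integral>\<^sup>+h. \<Phi> \<omega> (h ()) \<partial>PiM {()} (\<lambda>i. \<nu> z)) \<partial>PiM J \<nu>)"
    using z by (intro nn_integral_integrate_out[where f="\<lambda>_. z"] assms) (auto simp: eq)
  also have "\<dots> = (\<integral>\<^sup>+\<omega>. (\<integral>\<^sup>+h. \<Phi> \<omega> h \<partial>\<nu> z) \<partial>PiM J \<nu>)"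
  proof (intro nn_integral_cong)
    fix \<omega> assume "\<omega> \<in> space (PiM J \<nu>)"
    then have m: "\<Phi> \<omega> \<in> borel_measurable (\<nu> z)" by (rule \<Phi>)
    have "(\<integral>\<^sup>+h. \<Phi> \<omega> h \<partial>\<nu> z) = (\<integral>\<^sup>+h. \<Phi> \<omega> h \<partial>distr (PiM {()} (\<lambda>i. \<nu> z)) (\<nu> z) (\<lambda>h. h ()))"
      using \<nu>[OF z] by (subst distr_PiM_component) auto
    also have "\<dots> = (\<integral>\<^sup>+h. \<Phi> \<omega> (h ()) \<partial>PiM {()} (\<lambda>i. \<nu> z))"
      using m by (subst nn_integral_distr) auto
    finally show "(\<integral>\<^sup>+h. \<Phi> \<omega> (h ()) \<partial>PiM {()} (\<lambda>i. \<nu> z)) = (\<integral>\<^sup>+h. \<Phi> \<omega> h \<partial>\<nu> z)" by simp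
  qed
  finally show ?thesis .
qed

section \<open>Competing exponential clocks\<close>

lemma first_time_le: "j \<in> {1..l} \<Longrightarrow> first_time l T \<le> T j"
  by (simp add: first_time_def)

lemma first_time_mem:
  assumes "1 \<le> l" shows "\<exists>j\<in>{1..l}. T j = first_time l T"
proof -
  have "Min (T ` {1..l}) \<in> T ` {1..l}" using assms by (intro Min_in) auto
  then show ?thesis unfolding first_time_def by force
qed

lemma first_index_mem:
  assumes "1 \<le> l" shows "first_index l T \<in> {1..l}" "T (first_index l T) = first_time l T"
proof -
  have "Min {j \<in> {1..l}. T j = first_time l T} \<in> {j \<in> {1..l}. T j = first_time l T}"
    using first_time_mem[OF assms, of T] by (intro Min_in) auto
  then show "first_index l T \<in> {1..l}" "T (first_index l T) = first_time l T"
    unfolding first_index_def by auto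
qed

lemma first_index_eq_iff:
  assumes "1 \<le> l" "i \<in> {1..l}"
  shows "first_index l T = i \<longleftrightarrow> T i = first_time l T \<and> (\<forall>j\<in>{1..l}. j < i \<longrightarrow> T j \<noteq> first_time l T)"
proof
  assume "first_index l T = i"
  moreover have "first_index l T \<le> j" if "j \<in> {1..l}" "T j = first_time l T" for j
    using that unfolding first_index_def by (intro Min_le) auto
  ultimately show "T i = first_time l T \<and> (\<forall>j\<in>{1..l}. j < i \<longrightarrow> T j \<noteq> first_time l T)"
    using first_index_mem[OF assms(1), of T] by fastforce
next
  assume *: "T i = first_time l T \<and> (\<forall>j\<in>{1..l}. j < i \<longrightarrow> T j \<noteq> first_time l T)"
  show "first_index l T = i"
    unfolding first_index_def
  proof (rule Min_eqI)
    show "i \<le> j" if "j \<in> {j \<in> {1..l}. T j = first_time l T}" for j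
    proof (rule ccontr)
      assume "\<not> i \<le> j"
      with * that show False by force
    qed
  qed (use * assms in auto)
qed

lemma first_index_unique:
  assumes "1 \<le> l" "i \<in> {1..l}" "\<And>j. j \<in> {1..l} - {i} \<Longrightarrow> T i < T j"
  shows "first_index l T = i" "first_time l T = T i"
proof -
  have "first_index l T = i"
    using first_index_mem[OF assms(1), of T] first_time_le[OF assms(2), of T] assms(3)[of "first_index l T"]
    by force
  then show "first_index l T = i" "first_time l T = T i"
    using first_index_mem[OF assms(1), of T] by auto
qed

lemma first_cong:
  assumes "\<And>j. j \<in> {1..l} \<Longrightarrow> T j = T' j"
  shows "first_time l T = first_time l T'" "first_index l T = first_index l T'"
proof -
  have "T ` {1..l} = T' ` {1..l}" using assms by (intro image_cong) auto
  then show *: "first_time l T = first_time l T'" by (simp add: first_time_def)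
  have "{j \<in> {1..l}. T j = first_time l T} = {j \<in> {1..l}. T' j = first_time l T'}"
    using assms by (auto simp: *)
  then show "first_index l T = first_index l T'" by (simp add: first_index_def)
qed

lemma measurable_first_time:
  assumes "1 \<le> l" "\<And>j. j \<in> {1..l} \<Longrightarrow> f j \<in> borel_measurable N"
  shows "(\<lambda>\<omega>. first_time l (\<lambda>j. f j \<omega>)) \<in> borel_measurable N"
proof -
  have "(\<lambda>\<omega>. first_time l (\<lambda>j. f j \<omega>)) = (\<lambda>\<omega>. INF j\<in>{1..l}. f j \<omega>)"
    using assms(1) by (auto simp: first_time_def Min_Inf)
  with assms(2) show ?thesis by (auto intro!: borel_measurable_INF)
qed

lemma measurable_first_index:
  assumes l: "1 \<le> l" and f: "\<And>j. j \<in> {1..l} \<Longrightarrow> f j \<in> borel_measurable N"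
  shows "(\<lambda>\<omega>. first_index l (\<lambda>j. f j \<omega>)) \<in> N \<rightarrow>\<^sub>M count_space {1..l}"
proof -
  define S where "S = (\<lambda>\<omega>. first_time l (\<lambda>j. f j \<omega>))"
  define \<iota> where "\<iota> = (\<lambda>\<omega>. first_index l (\<lambda>j. f j \<omega>))"
  have [measurable]: "S \<in> borel_measurable N"
    unfolding S_def using assms by (rule measurable_first_time)
  have eq: "\<iota> \<omega> = i \<longleftrightarrow> f i \<omega> = S \<omega> \<and> (\<forall>j\<in>{1..l}. j < i \<longrightarrow> f j \<omega> \<noteq> S \<omega>)"
    if "i \<in> {1..l}" for i \<omega>
    unfolding \<iota>_def S_def using that by (rule first_index_eq_iff[OF l])
  have "\<iota> -` {i} \<inter> space N \<in> sets N" if i: "i \<in> {1..l}" for i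
  proof -
    have [measurable]: "f i \<in> borel_measurable N" using f i by auto
    have "{\<omega> \<in> space N. j < i \<longrightarrow> f j \<omega> \<noteq> S \<omega>} \<in> sets N" if "j \<in> {1..l}" for j
    proof -
      have [measurable]: "f j \<in> borel_measurable N" using f that by auto
      show ?thesis by measurable
    qed
    then have "{\<omega> \<in> space N. \<forall>j\<in>{1..l}. j < i \<longrightarrow> f j \<omega> \<noteq> S \<omega>} \<in> sets N"
      by (rule sets.sets_Collect_finite_All) auto
    moreover have "{\<omega> \<in> space N. f i \<omega> = S \<omega>} \<in> sets N" by measurable
    ultimately have "{\<omega> \<in> space N. f i \<omega> = S \<omega> \<and> (\<forall>j\<in>{1..l}. j < i \<longrightarrow> f j \<omega> \<noteq> S \<omega>)} \<in> sets N"
      by (intro sets.sets_Collect_conj)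
    also have "{\<omega> \<in> space N. f i \<omega> = S \<omega> \<and> (\<forall>j\<in>{1..l}. j < i \<longrightarrow> f j \<omega> \<noteq> S \<omega>)} = \<iota> -` {i} \<inter> space N"
      using eq[OF i] by auto
    finally show ?thesis .
  qed
  moreover have "\<iota> \<in> space N \<rightarrow> {1..l}"
    unfolding \<iota>_def by (intro funcsetI first_index_mem(1) l)
  ultimately have "\<iota> \<in> N \<rightarrow>\<^sub>M count_space {1..l}"
    using measurable_count_space_eq2[of "{1..l}" \<iota> N] by blast
  then show ?thesis unfolding \<iota>_def .
qed

definition exp_law :: "real measure" where
  "exp_law = density lborel (\<lambda>x. ennreal (exponential_density 1 x))"

lemma sets_exp_law [simp, measurable_cong]: "sets exp_law = sets borel"
  by (simp add: exp_law_def)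

lemma space_exp_law [simp]: "space exp_law = UNIV"
  by (simp add: exp_law_def)

lemma prob_space_exp_law: "prob_space exp_law"
  unfolding exp_law_def by (rule prob_space_exponential_density) simp

lemma AE_exp_law_pos: "AE x in exp_law. 0 < x"
  unfolding exp_law_def
  using AE_lborel_singleton[of 0]
  by (subst AE_density) (auto simp: exponential_density_def)

lemma AE_exp_law_neq: "AE x in exp_law. x \<noteq> c"
  unfolding exp_law_def
  using AE_lborel_singleton[of c]
  by (subst AE_density) auto

lemma exp_law_memoryless:
  assumes [measurable]: "\<psi> \<in> borel_measurable borel" and c: "0 \<le> c"
  shows "(\<integral>\<^sup>+h. (if c < h then \<psi> (h - c) else 0) \<partial>exp_law) = ennreal (exp (- c)) * (\<integral>\<^sup>+h. \<psi> h \<partial>exp_law)"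
proof -
  have "(\<integral>\<^sup>+h. (if c < h then \<psi> (h - c) else 0) \<partial>exp_law)
      = (\<integral>\<^sup>+h. ennreal (exponential_density 1 h) * (if c < h then \<psi> (h - c) else 0) \<partial>lborel)"
    unfolding exp_law_def by (subst nn_integral_density) auto
  also have "\<dots> = (\<integral>\<^sup>+h. ennreal (exponential_density 1 (c + 1 * h)) * (if c < c + 1 * h then \<psi> (c + 1 * h - c) else 0) \<partial>lborel)"
    by (subst nn_integral_real_affine[where c=1 and t=c]) auto
  also have "\<dots> = (\<integral>\<^sup>+h. ennreal (exp (- c)) * (ennreal (exponential_density 1 h) * \<psi> h) \<partial>lborel)"
  proof (intro nn_integral_cong_AE, use AE_lborel_singleton[of 0] in eventually_elim)
    fix h :: real assume "h \<noteq> 0"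
    then consider "h < 0" | "0 < h" by linarith
    moreover have "exp (- c - h) = exp (- c) * exp (- h)" by (simp add: exp_add[symmetric])
    ultimately show "ennreal (exponential_density 1 (c + 1 * h)) * (if c < c + 1 * h then \<psi> (c + 1 * h - c) else 0)
        = ennreal (exp (- c)) * (ennreal (exponential_density 1 h) * \<psi> h)"
      using c by cases (simp_all add: exponential_density_def ennreal_mult mult.assoc)
  qed
  also have "\<dots> = ennreal (exp (- c)) * (\<integral>\<^sup>+h. \<psi> h \<partial>exp_law)"
    unfolding exp_law_def by (subst nn_integral_cmult, simp, subst nn_integral_density) auto
  finally show ?thesis .
qed

lemma PiM_exp_law_memoryless:
  fixes D :: "'i set"
  assumes "finite D" "\<And>j. j \<in> D \<Longrightarrow> 0 \<le> c j" "F \<in> borel_measurable (PiM D (\<lambda>_. exp_law))"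
  shows "(\<integral>\<^sup>+x. (if \<forall>j\<in>D. c j < x j then F (\<lambda>j\<in>D. x j - c j) else 0) \<partial>PiM D (\<lambda>_. exp_law))
       = (\<Prod>j\<in>D. ennreal (exp (- c j))) * (\<integral>\<^sup>+x. F x \<partial>PiM D (\<lambda>_. exp_law))"
  using assms
proof (induction D arbitrary: F rule: finite_induct)
  case empty
  interpret prob_space "PiM {} (\<lambda>_. exp_law)" by (intro prob_space_PiM) auto
  have "(\<integral>\<^sup>+x. F x \<partial>PiM {} (\<lambda>_. exp_law)) = (\<integral>\<^sup>+x. F (\<lambda>j\<in>{}. x j - c j) \<partial>PiM {} (\<lambda>_. exp_law))"
    by (intro nn_integral_cong arg_cong[of _ _ F]) (auto simp: space_PiM)
  then show ?case by simp
next
  case (insert i D)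
  interpret E: prob_space exp_law by (rule prob_space_exp_law)
  interpret P: product_sigma_finite "\<lambda>_::'i. exp_law"
    by (simp add: product_sigma_finite_def E.sigma_finite_measure_axioms)
  note [measurable] = insert.prems(2) \<open>finite D\<close>
  let ?g = "\<lambda>x. if \<forall>j\<in>insert i D. c j < x j then F (\<lambda>j\<in>insert i D. x j - c j) else 0"
  have g: "?g \<in> borel_measurable (PiM (insert i D) (\<lambda>_. exp_law))"
  proof -
    have "(\<lambda>x. \<lambda>j\<in>insert i D. x j - c j) \<in> PiM (insert i D) (\<lambda>_. exp_law) \<rightarrow>\<^sub>M PiM (insert i D) (\<lambda>_. exp_law)"
      by (rule measurable_restrict) measurable
    moreover have "Measurable.pred (PiM (insert i D) (\<lambda>_. exp_law)) (\<lambda>x. \<forall>j\<in>insert i D. c j < x j)"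
      using insert.hyps by (intro pred_intros_finite) auto
    ultimately show ?thesis using insert.prems(2) by measurable
  qed
  have up: "(\<lambda>j\<in>insert i D. (x(i := y)) j - c j) = (\<lambda>j\<in>D. x j - c j)(i := y - c i)" for x y
    using insert.hyps by (auto simp: fun_eq_iff)
  have all: "(\<forall>j\<in>insert i D. c j < (x(i := y)) j) \<longleftrightarrow> c i < y \<and> (\<forall>j\<in>D. c j < x j)" for x :: "'i \<Rightarrow> real" and y
    using insert.hyps by auto
  let ?G = "\<lambda>x. \<integral>\<^sup>+y. F (x(i := y)) \<partial>exp_law"
  have G: "?G \<in> borel_measurable (PiM D (\<lambda>_. exp_law))"
    by measurable
  have "(\<integral>\<^sup>+x. ?g x \<partial>PiM (insert i D) (\<lambda>_. exp_law))
      = (\<integral>\<^sup>+x. (\<integral>\<^sup>+y. ?g (x(i := y)) \<partial>exp_law) \<partial>PiM D (\<lambda>_. exp_law))"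
    using insert.hyps g by (intro P.product_nn_integral_insert)
  also have "\<dots> = (\<integral>\<^sup>+x. ennreal (exp (- c i)) * (if \<forall>j\<in>D. c j < x j then ?G (\<lambda>j\<in>D. x j - c j) else 0) \<partial>PiM D (\<lambda>_. exp_law))"
  proof (intro nn_integral_cong)
    fix x assume x: "x \<in> space (PiM D (\<lambda>_. exp_law))"
    show "(\<integral>\<^sup>+y. ?g (x(i := y)) \<partial>exp_law)
        = ennreal (exp (- c i)) * (if \<forall>j\<in>D. c j < x j then ?G (\<lambda>j\<in>D. x j - c j) else 0)"
    proof (cases "\<forall>j\<in>D. c j < x j")
      case True
      have sp: "(\<lambda>j\<in>D. x j - c j) \<in> space (PiM D (\<lambda>_. exp_law))" by (auto simp: space_PiM)
      have m: "(\<lambda>y. F ((\<lambda>j\<in>D. x j - c j)(i := y))) \<in> borel_measurable borel"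
        using measurable_compose[OF measurable_Pair1'[OF sp] measurable_compose[OF measurable_add_dim[where i=i and I=D and M="\<lambda>_. exp_law"] insert.prems(2)]]
        by (simp add: measurable_cong_sets[OF sets_exp_law refl])
      show ?thesis
        unfolding up all using True exp_law_memoryless[OF m, of "c i"] insert.prems(1)[of i] by simp
    next
      case False
      then have g0: "?g (x(i := y)) = 0" for y unfolding all by auto
      show ?thesis unfolding g0 if_not_P[OF False] by simp
    qed
  qed
  also have "\<dots> = ennreal (exp (- c i)) * (\<integral>\<^sup>+x. (if \<forall>j\<in>D. c j < x j then ?G (\<lambda>j\<in>D. x j - c j) else 0) \<partial>PiM D (\<lambda>_. exp_law))"
  proof (rule nn_integral_cmult)
    have "(\<lambda>x. \<lambda>j\<in>D. x j - c j) \<in> PiM D (\<lambda>_. exp_law) \<rightarrow>\<^sub>M PiM D (\<lambda>_. exp_law)"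
      by (rule measurable_restrict) measurable
    then have [measurable]: "(\<lambda>x. ?G (\<lambda>j\<in>D. x j - c j)) \<in> borel_measurable (PiM D (\<lambda>_. exp_law))"
      using G by (rule measurable_compose)
    have [measurable]: "Measurable.pred (PiM D (\<lambda>_. exp_law)) (\<lambda>x. \<forall>j\<in>D. c j < x j)"
      using insert.hyps by (intro pred_intros_finite) auto
    show "(\<lambda>x. if \<forall>j\<in>D. c j < x j then ?G (\<lambda>j\<in>D. x j - c j) else 0) \<in> borel_measurable (PiM D (\<lambda>_. exp_law))"
      by measurable
  qed
  also have "\<dots> = ennreal (exp (- c i)) * ((\<Prod>j\<in>D. ennreal (exp (- c j))) * (\<integral>\<^sup>+x. ?G x \<partial>PiM D (\<lambda>_. exp_law)))"
    using insert.prems(1) by (subst insert.IH[OF _ G]) auto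
  also have "(\<integral>\<^sup>+x. ?G x \<partial>PiM D (\<lambda>_. exp_law)) = (\<integral>\<^sup>+x. F x \<partial>PiM (insert i D) (\<lambda>_. exp_law))"
    using insert.hyps insert.prems(2) by (intro P.product_nn_integral_insert[symmetric])
  finally show ?case using insert.hyps by (simp add: mult.assoc)
qed

lemma competing_clocks:
  fixes l :: nat and T :: "nat \<Rightarrow> real \<Rightarrow> ennreal" and \<Lambda> :: "nat \<Rightarrow> real \<Rightarrow> real"
    and \<Psi> :: "ennreal \<Rightarrow> nat \<Rightarrow> (nat \<Rightarrow> real) \<Rightarrow> ennreal"
  defines "P \<equiv> PiM {1..l} (\<lambda>_. exp_law)"
    and "S \<equiv> \<lambda>h. first_time l (\<lambda>j. T j (h j))"
    and "\<iota> \<equiv> \<lambda>h. first_index l (\<lambda>j. T j (h j))"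
  assumes l: "1 \<le> l" and s: "0 \<le> s"
    and T: "\<And>j. j \<in> {1..l} \<Longrightarrow> T j \<in> borel_measurable borel"
    and \<Lambda>: "\<And>j. j \<in> {1..l} \<Longrightarrow> \<Lambda> j \<in> borel_measurable borel"
    and \<Lambda>_nonneg: "\<And>j t. j \<in> {1..l} \<Longrightarrow> s \<le> t \<Longrightarrow> 0 \<le> \<Lambda> j t"
    and T_ge: "\<And>j h. j \<in> {1..l} \<Longrightarrow> ennreal s \<le> T j h"
    and T_gt: "\<And>j t h. j \<in> {1..l} \<Longrightarrow> s \<le> t \<Longrightarrow> \<Lambda> j t < h \<Longrightarrow> ennreal t < T j h"
    and T_lt: "\<And>j t h. j \<in> {1..l} \<Longrightarrow> s \<le> t \<Longrightarrow> 0 < h \<Longrightarrow> h < \<Lambda> j t \<Longrightarrow> T j h < ennreal t"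
    and \<Psi>: "(\<lambda>(t, i, K). \<Psi> t i K) \<in> borel_measurable (borel \<Otimes>\<^sub>M count_space {1..l} \<Otimes>\<^sub>M P)"
    and \<Psi>_inf: "\<And>i K K'. i \<in> {1..l} \<Longrightarrow> K \<in> space P \<Longrightarrow> K' \<in> space P \<Longrightarrow> \<Psi> \<infinity> i K = \<Psi> \<infinity> i K'"
  shows "(\<integral>\<^sup>+h. (\<integral>\<^sup>+e. \<Psi> (S h) (\<iota> h) (\<lambda>j\<in>{1..l}. if j = \<iota> h then e else h j - \<Lambda> j (enn2real (S h))) \<partial>exp_law) \<partial>P)
       = (\<integral>\<^sup>+h. (\<integral>\<^sup>+K. \<Psi> (S h) (\<iota> h) K \<partial>P) \<partial>P)"
proof -
  interpret E: prob_space exp_law by (rule prob_space_exp_law)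
  interpret Q: product_sigma_finite "\<lambda>_::nat. exp_law"
    by (simp add: product_sigma_finite_def E.sigma_finite_measure_axioms)
  interpret P: prob_space P unfolding P_def by (intro prob_space_PiM prob_space_exp_law)
  have Tj: "(\<lambda>h. T j (h j)) \<in> borel_measurable P" if "j \<in> {1..l}" for j
    using T[OF that] that unfolding P_def by measurable
  have S_meas [measurable]: "S \<in> borel_measurable P"
    unfolding S_def by (rule measurable_first_time[OF l Tj])
  have \<iota>_meas [measurable]: "\<iota> \<in> P \<rightarrow>\<^sub>M count_space {1..l}"
    unfolding \<iota>_def by (rule measurable_first_index[OF l Tj])
  define upd where "upd = (\<lambda>h e. \<lambda>j\<in>{1..l}. if j = \<iota> h then e else h j - \<Lambda> j (enn2real (S h)))"
  have upd_meas: "(\<lambda>(h, e). upd h e) \<in> P \<Otimes>\<^sub>M exp_law \<rightarrow>\<^sub>M P"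
    unfolding upd_def split_beta P_def
  proof (rule measurable_restrict)
    fix j assume j: "j \<in> {1..l}"
    have [measurable]: "\<Lambda> j \<in> borel_measurable borel" using \<Lambda> j by auto
    have [measurable]: "(\<lambda>h. h j) \<in> borel_measurable P"
      unfolding P_def using j by measurable
    have "(\<lambda>x. if j = \<iota> (fst x) then snd x else fst x j - \<Lambda> j (enn2real (S (fst x)))) \<in> P \<Otimes>\<^sub>M exp_law \<rightarrow>\<^sub>M exp_law"
      by measurable
    then show "(\<lambda>x. if j = \<iota> (fst x) then snd x else fst x j - \<Lambda> j (enn2real (S (fst x))))
        \<in> PiM {1..l} (\<lambda>_. exp_law) \<Otimes>\<^sub>M exp_law \<rightarrow>\<^sub>M exp_law"
      unfolding P_def .
  qed
  note [measurable] = \<Psi>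
  have \<Psi>_comp: "(\<lambda>x. \<Psi> (f x) (g x) (k x)) \<in> borel_measurable N"
    if "f \<in> borel_measurable N" "g \<in> N \<rightarrow>\<^sub>M count_space {1..l}" "k \<in> N \<rightarrow>\<^sub>M P" for f g k and N :: "'z measure"
    using measurable_compose[OF measurable_Pair[OF that(1) measurable_Pair[OF that(2,3)]] \<Psi>] by simp
  define F where "F = (\<lambda>h. \<integral>\<^sup>+e. \<Psi> (S h) (\<iota> h) (upd h e) \<partial>exp_law)"
  define F' where "F' = (\<lambda>h. \<integral>\<^sup>+K. \<Psi> (S h) (\<iota> h) K \<partial>P)"
  have F_meas [measurable]: "F \<in> borel_measurable P"
    unfolding F_def using upd_meas[unfolded split_beta] measurable_compose[OF measurable_fst S_meas] measurable_compose[OF measurable_fst \<iota>_meas]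
    by (intro E.borel_measurable_nn_integral[unfolded split_beta] \<Psi>_comp) (auto simp only: split_beta)
  have F'_meas [measurable]: "F' \<in> borel_measurable P"
    unfolding F'_def using measurable_compose[OF measurable_fst S_meas] measurable_compose[OF measurable_fst \<iota>_meas]
    by (intro P.borel_measurable_nn_integral[unfolded split_beta] \<Psi>_comp measurable_snd) (auto simp only: split_beta)
  have \<iota>_in: "\<iota> h \<in> {1..l}" and T_\<iota>: "T (\<iota> h) (h (\<iota> h)) = S h" for h
    unfolding \<iota>_def S_def
    using first_index_mem[OF l, where T="\<lambda>j. T j (h j)"] by simp_all
  have S_ge: "ennreal s \<le> S h" for h
    using T_ge[OF \<iota>_in, of h] T_\<iota>[of h] by metis
  have F_inf: "F h = F' h" if h: "h \<in> space P" and "S h = \<infinity>" for h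
  proof -
    have up: "upd h e \<in> space P" for e
      using measurable_space[OF upd_meas, of "(h, e)"] h by (simp add: space_pair_measure)
    have "F h = (\<integral>\<^sup>+e. \<Psi> \<infinity> (\<iota> h) h \<partial>exp_law)"
      unfolding F_def that(2) by (intro nn_integral_cong \<Psi>_inf \<iota>_in h up)
    also have "\<dots> = (\<integral>\<^sup>+K. \<Psi> \<infinity> (\<iota> h) h \<partial>P)"
      using E.emeasure_space_1 P.emeasure_space_1 by simp
    also have "\<dots> = F' h"
      unfolding F'_def that(2) by (intro nn_integral_cong \<Psi>_inf \<iota>_in h)
    finally show ?thesis .
  qed
  have split: "(\<integral>\<^sup>+h. f h \<partial>P) = (\<Sum>i\<in>{1..l}. \<integral>\<^sup>+h. (if \<iota> h = i then f h else 0) \<partial>P)"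
    if [measurable]: "f \<in> borel_measurable P" for f
  proof -
    have "(\<integral>\<^sup>+h. f h \<partial>P) = (\<integral>\<^sup>+h. (\<Sum>i\<in>{1..l}. if \<iota> h = i then f h else 0) \<partial>P)"
      using \<iota>_in by (intro nn_integral_cong) simp
    also have "\<dots> = (\<Sum>i\<in>{1..l}. \<integral>\<^sup>+h. (if \<iota> h = i then f h else 0) \<partial>P)"
      by (intro nn_integral_sum) simp
    finally show ?thesis .
  qed
  have "(\<integral>\<^sup>+h. (if \<iota> h = i then F h else 0) \<partial>P) = (\<integral>\<^sup>+h. (if \<iota> h = i then F' h else 0) \<partial>P)"
    if i: "i \<in> {1..l}" for i
  proof -
    define D where "D = {1..l} - {i}"
    have D: "finite D" "i \<notin> D" "{1..l} = insert i D" using i by (auto simp: D_def)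
    have P_eq: "P = PiM (insert i D) (\<lambda>_. exp_law)" unfolding P_def D(3) ..
    have rev: "(\<integral>\<^sup>+h. f h \<partial>P) = (\<integral>\<^sup>+y. (\<integral>\<^sup>+x. f (x(i := y)) \<partial>PiM D (\<lambda>_. exp_law)) \<partial>exp_law)"
      if "f \<in> borel_measurable P" for f
      using that unfolding P_eq by (intro Q.product_nn_integral_insert_rev D)
    have ins: "x(i := y) \<in> space P" if "x \<in> space (PiM D (\<lambda>_. exp_law))" for x y
      using that D unfolding P_eq by (auto simp: space_PiM PiE_iff extensional_def)
    have "(\<integral>\<^sup>+x. (if \<iota> (x(i := y)) = i then F (x(i := y)) else 0) \<partial>PiM D (\<lambda>_. exp_law))
        = (\<integral>\<^sup>+x. (if \<iota> (x(i := y)) = i then F' (x(i := y)) else 0) \<partial>PiM D (\<lambda>_. exp_law))" for y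
    proof (cases "T i y = \<infinity>")
      case True
      show ?thesis
      proof (intro nn_integral_cong if_cong refl)
        fix x assume "x \<in> space (PiM D (\<lambda>_. exp_law))" and "\<iota> (x(i := y)) = i"
        then show "F (x(i := y)) = F' (x(i := y))"
          using True T_\<iota>[of "x(i := y)"] by (intro F_inf ins) auto
      qed
    next
      case False
      define t where "t = enn2real (T i y)"
      have t: "T i y = ennreal t" using False by (simp add: t_def ennreal_enn2real_if)
      have "ennreal s \<le> ennreal t" using T_ge[OF i, of y] t by simp
      then have st: "s \<le> t" using s by (simp add: ennreal_le_iff2) (auto simp: t_def)
      have t0: "enn2real (T i y) = t" by (simp add: t_def)
      define C where "C = (\<Prod>j\<in>D. ennreal (exp (- \<Lambda> j t)))"
      have AE1: "AE x in PiM D (\<lambda>_. exp_law). x j > 0 \<and> x j \<noteq> \<Lambda> j t" if "j \<in> D" for j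
        using AE_exp_law_pos AE_exp_law_neq[of "\<Lambda> j t"] that
        by (intro AE_PiM_component[where P="\<lambda>x. x > 0 \<and> x \<noteq> \<Lambda> j t"] prob_space_exp_law) auto
      then have AE: "AE x in PiM D (\<lambda>_. exp_law). \<forall>j\<in>D. x j > 0 \<and> x j \<noteq> \<Lambda> j t"
        using D(1) by (intro AE_finite_allI) auto
      have iff: "\<iota> (x(i := y)) = i \<longleftrightarrow> (\<forall>j\<in>D. \<Lambda> j t < x j)"
        and S_eq: "(\<forall>j\<in>D. \<Lambda> j t < x j) \<Longrightarrow> S (x(i := y)) = T i y"
        if x: "\<forall>j\<in>D. x j > 0 \<and> x j \<noteq> \<Lambda> j t" for x
      proof -
        have *: "\<iota> (x(i := y)) = i \<and> S (x(i := y)) = T i y" if "\<forall>j\<in>D. \<Lambda> j t < x j"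
        proof -
          have "T i ((x(i := y)) i) < T j ((x(i := y)) j)" if "j \<in> {1..l} - {i}" for j
            using that \<open>\<forall>j\<in>D. \<Lambda> j t < x j\<close> T_gt[of j t "x j"] st t by (auto simp: D_def)
          from first_index_unique[where T="\<lambda>j. T j ((x(i := y)) j)", OF l i this] show ?thesis
            unfolding \<iota>_def S_def by simp
        qed
        moreover have "\<Lambda> j t < x j" if "\<iota> (x(i := y)) = i" and j: "j \<in> D" for j
        proof (rule ccontr)
          assume "\<not> \<Lambda> j t < x j"
          with x j have "x j < \<Lambda> j t" "0 < x j" by force+
          then have "T j (x j) < ennreal t" using j st by (intro T_lt) (auto simp: D_def)
          moreover have "S (x(i := y)) \<le> T j ((x(i := y)) j)"
            unfolding S_def using j by (intro first_time_le) (auto simp: D_def)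
          moreover have "S (x(i := y)) = ennreal t"
            using T_\<iota>[of "x(i := y)"] that(1) t by simp
          moreover have "j \<noteq> i" using j D(2) by auto
          ultimately show False by simp
        qed
        ultimately show "\<iota> (x(i := y)) = i \<longleftrightarrow> (\<forall>j\<in>D. \<Lambda> j t < x j)" by blast
        from * show "(\<forall>j\<in>D. \<Lambda> j t < x j) \<Longrightarrow> S (x(i := y)) = T i y" by blast
      qed
      have \<Lambda>0: "0 \<le> \<Lambda> j t" if "j \<in> D" for j using that st by (intro \<Lambda>_nonneg) (auto simp: D_def)
      define f where "f = (\<lambda>x. \<integral>\<^sup>+e. \<Psi> (T i y) i (x(i := e)) \<partial>exp_law)"
      have add [measurable]: "(\<lambda>(x, e). x(i := e)) \<in> PiM D (\<lambda>_. exp_law) \<Otimes>\<^sub>M exp_law \<rightarrow>\<^sub>M P"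
        unfolding P_eq by (rule measurable_add_dim)
      have f_meas: "f \<in> borel_measurable (PiM D (\<lambda>_. exp_law))"
        unfolding f_def using add i
        by (intro E.borel_measurable_nn_integral[unfolded split_beta] \<Psi>_comp) (auto simp: split_beta)
      have \<Psi>i_meas: "\<Psi> (T i y) i \<in> borel_measurable P"
        using i by (intro \<Psi>_comp) auto
      have total: "(\<integral>\<^sup>+x. f x \<partial>PiM D (\<lambda>_. exp_law)) = (\<integral>\<^sup>+K. \<Psi> (T i y) i K \<partial>P)"
        using \<Psi>i_meas unfolding f_def P_eq by (intro Q.product_nn_integral_insert[symmetric] D)
      interpret PD: prob_space "PiM D (\<lambda>_. exp_law)" by (intro prob_space_PiM prob_space_exp_law)
      have "(\<integral>\<^sup>+x. (if \<iota> (x(i := y)) = i then F (x(i := y)) else 0) \<partial>PiM D (\<lambda>_. exp_law))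
          = (\<integral>\<^sup>+x. (if \<forall>j\<in>D. \<Lambda> j t < x j then f (\<lambda>j\<in>D. x j - \<Lambda> j t) else 0) \<partial>PiM D (\<lambda>_. exp_law))"
      proof (intro nn_integral_cong_AE, use AE in eventually_elim)
        fix x assume x: "\<forall>j\<in>D. x j > 0 \<and> x j \<noteq> \<Lambda> j t"
        have "F (x(i := y)) = f (\<lambda>j\<in>D. x j - \<Lambda> j t)" if all: "\<forall>j\<in>D. \<Lambda> j t < x j"
        proof -
          have "upd (x(i := y)) e = (\<lambda>j\<in>D. x j - \<Lambda> j t)(i := e)" for e
            unfolding upd_def using D iff[OF x] S_eq[OF x all] all t0 by (auto simp: fun_eq_iff)
          then show ?thesis
            unfolding F_def f_def using iff[OF x] S_eq[OF x all] all by simp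
        qed
        then show "(if \<iota> (x(i := y)) = i then F (x(i := y)) else 0)
            = (if \<forall>j\<in>D. \<Lambda> j t < x j then f (\<lambda>j\<in>D. x j - \<Lambda> j t) else 0)"
          using iff[OF x] by simp
      qed
      also have "\<dots> = C * (\<integral>\<^sup>+K. \<Psi> (T i y) i K \<partial>P)"
        unfolding C_def total[symmetric] by (rule PiM_exp_law_memoryless[OF D(1) \<Lambda>0 f_meas])
      also have "\<dots> = (\<integral>\<^sup>+x. (if \<forall>j\<in>D. \<Lambda> j t < x j then (\<integral>\<^sup>+K. \<Psi> (T i y) i K \<partial>P) else 0) \<partial>PiM D (\<lambda>_. exp_law))"
        unfolding C_def
        using PiM_exp_law_memoryless[where D=D and c="\<lambda>j. \<Lambda> j t" and F="\<lambda>_. \<integral>\<^sup>+K. \<Psi> (T i y) i K \<partial>P"]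
          D(1) \<Lambda>0 PD.emeasure_space_1 by simp
      also have "\<dots> = (\<integral>\<^sup>+x. (if \<iota> (x(i := y)) = i then F' (x(i := y)) else 0) \<partial>PiM D (\<lambda>_. exp_law))"
      proof (intro nn_integral_cong_AE, use AE in eventually_elim)
        fix x assume x: "\<forall>j\<in>D. x j > 0 \<and> x j \<noteq> \<Lambda> j t"
        show "(if \<forall>j\<in>D. \<Lambda> j t < x j then (\<integral>\<^sup>+K. \<Psi> (T i y) i K \<partial>P) else 0)
           = (if \<iota> (x(i := y)) = i then F' (x(i := y)) else 0)"
          using iff[OF x] S_eq[OF x] by (auto simp: F'_def)
      qed
      finally show ?thesis .
    qed
    then show ?thesis
      by (subst (1 2) rev) auto
  qed
  then have "(\<integral>\<^sup>+h. F h \<partial>P) = (\<integral>\<^sup>+h. F' h \<partial>P)"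
    unfolding split[OF F_meas] split[OF F'_meas] by (rule sum.cong[OF refl])
  then show ?thesis unfolding F_def F'_def upd_def .
qed

section \<open>Measurability of the flow and of the jump times\<close>

lemma space_time_space [simp]: "space time_space = {0..}"
  by (simp add: time_space_def space_restrict_space)

lemma space_manifold_borel [simp]: "space (manifold_borel M) = M"
  by (simp add: manifold_borel_def space_restrict_space)

lemma measurable_time_space: "f \<in> borel_measurable N \<Longrightarrow> (\<And>\<omega>. \<omega> \<in> space N \<Longrightarrow> 0 \<le> f \<omega>) \<Longrightarrow> f \<in> N \<rightarrow>\<^sub>M time_space"
  unfolding time_space_def by (rule measurable_restrict_space2) auto

lemma with_cemetery_iff: "y \<in> with_cemetery M \<longleftrightarrow> y = None \<or> y \<in> Some ` M"
  by (auto simp: with_cemetery_def)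

locale pdmp_setting =
  fixes M :: "'a::euclidean_space set" and l :: nat
    and \<phi> :: "real \<Rightarrow> real \<Rightarrow> 'a \<Rightarrow> 'a" and rate :: "nat \<Rightarrow> real \<Rightarrow> 'a \<Rightarrow> real"
    and G :: "nat \<Rightarrow> real \<Rightarrow> 'a \<Rightarrow> real \<Rightarrow> 'a"
    and d :: "'a option \<Rightarrow> 'a option \<Rightarrow> real"
  assumes closed: "closed M" and nonempty: "M \<noteq> {}"
    and l: "1 \<le> l"
    and flow: "differential_flow M \<phi>"
    and rate: "\<And>j. j \<in> {1..l} \<Longrightarrow> jump_rate M (rate j)"
    and G: "\<And>j. j \<in> {1..l} \<Longrightarrow> (\<lambda>(t, x, u). G j t x u)
        \<in> time_space \<Otimes>\<^sub>M manifold_borel M \<Otimes>\<^sub>M borel \<rightarrow>\<^sub>M manifold_borel M"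
    and cemetery: "cemetery_metric M d"
begin

abbreviation "\<tau> \<equiv> Metric_space.mtopology (with_cemetery M) d"

lemma measurable_flow:
  assumes "f \<in> borel_measurable N" "g \<in> borel_measurable N" "x \<in> N \<rightarrow>\<^sub>M manifold_borel M"
    and "\<And>\<omega>. \<omega> \<in> space N \<Longrightarrow> 0 \<le> f \<omega>" "\<And>\<omega>. \<omega> \<in> space N \<Longrightarrow> f \<omega> \<le> g \<omega>"
  shows "(\<lambda>\<omega>. \<phi> (f \<omega>) (g \<omega>) (x \<omega>)) \<in> N \<rightarrow>\<^sub>M manifold_borel M"
proof -
  have "f \<in> N \<rightarrow>\<^sub>M time_space" "(\<lambda>\<omega>. g \<omega> - f \<omega>) \<in> N \<rightarrow>\<^sub>M time_space"
    using assms by (auto intro!: measurable_time_space)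
  then have "(\<lambda>\<omega>. (f \<omega>, g \<omega> - f \<omega>, x \<omega>)) \<in> N \<rightarrow>\<^sub>M time_space \<Otimes>\<^sub>M time_space \<Otimes>\<^sub>M manifold_borel M"
    using assms(3) by measurable
  from measurable_compose[OF this, of "\<lambda>(t, h, x). \<phi> t (t + h) x"] flow
  show ?thesis by (simp add: differential_flow_def)
qed

lemma measurable_rate:
  assumes "j \<in> {1..l}" "f \<in> borel_measurable N" "x \<in> N \<rightarrow>\<^sub>M manifold_borel M"
    and "\<And>\<omega>. \<omega> \<in> space N \<Longrightarrow> 0 \<le> f \<omega>"
  shows "(\<lambda>\<omega>. rate j (f \<omega>) (x \<omega>)) \<in> borel_measurable N"
proof -
  have "(\<lambda>\<omega>. (f \<omega>, x \<omega>)) \<in> N \<rightarrow>\<^sub>M time_space \<Otimes>\<^sub>M manifold_borel M"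
    using assms by (auto intro!: measurable_time_space measurable_Pair)
  from measurable_compose[OF this, of "\<lambda>(t, x). rate j t x"] rate[OF assms(1)]
  show ?thesis by (simp add: jump_rate_def)
qed

lemma measurable_G:
  assumes i: "i \<in> N \<rightarrow>\<^sub>M count_space {1..l}" and "f \<in> borel_measurable N" "x \<in> N \<rightarrow>\<^sub>M manifold_borel M"
    "u \<in> borel_measurable N" and "\<And>\<omega>. \<omega> \<in> space N \<Longrightarrow> 0 \<le> f \<omega>"
  shows "(\<lambda>\<omega>. G (i \<omega>) (f \<omega>) (x \<omega>) (u \<omega>)) \<in> N \<rightarrow>\<^sub>M manifold_borel M"
proof (rule measurable_compose_countable'[OF _ i])
  fix j assume j: "j \<in> {1..l}"
  have "(\<lambda>\<omega>. (f \<omega>, x \<omega>, u \<omega>)) \<in> N \<rightarrow>\<^sub>M time_space \<Otimes>\<^sub>M manifold_borel M \<Otimes>\<^sub>M borel"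
    using assms by (auto intro!: measurable_time_space measurable_Pair)
  from measurable_compose[OF this G[OF j]]
  show "(\<lambda>\<omega>. G j (f \<omega>) (x \<omega>) (u \<omega>)) \<in> N \<rightarrow>\<^sub>M manifold_borel M" by simp
qed auto

lemma flow_in: "0 \<le> s \<Longrightarrow> s \<le> t \<Longrightarrow> x \<in> M \<Longrightarrow> \<phi> s t x \<in> M"
  using flow measurable_space[of "\<lambda>(t, h, x). \<phi> t (t + h) x" _ _ "(s, t - s, x)"]
  by (fastforce simp: differential_flow_def space_pair_measure)

lemma continuous_on_flow:
  assumes "0 \<le> s" "x \<in> M" shows "continuous_on {s..} (\<lambda>t. \<phi> s t x)"
proof -
  have "C1_curve (\<lambda>h. \<phi> s (s + h) x)" using flow assms by (simp add: differential_flow_def)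
  then have "continuous_on {0..} (\<lambda>h. \<phi> s (s + h) x)"
    unfolding C1_curve_def by (metis atLeast_iff continuous_on_vector_derivative)
  then have "continuous_on {s..} ((\<lambda>h. \<phi> s (s + h) x) \<circ> (\<lambda>t. t - s))"
    by (intro continuous_on_compose continuous_intros) (auto elim: continuous_on_subset)
  then show ?thesis by (simp add: o_def)
qed

lemma measurable_cumulative_rate:
  assumes j: "j \<in> {1..l}" and s: "s \<in> borel_measurable N" and t: "t \<in> borel_measurable N"
    and x: "x \<in> N \<rightarrow>\<^sub>M manifold_borel M" and s0: "\<And>\<omega>. \<omega> \<in> space N \<Longrightarrow> 0 \<le> s \<omega>"
  shows "(\<lambda>\<omega>. cumulative_rate \<phi> (rate j) (s \<omega>) (t \<omega>) (x \<omega>)) \<in> borel_measurable N"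
proof -
  note [measurable] = s t x
  define q where "q = (\<lambda>p. max (s (fst p)) (snd p :: real))"
  have [measurable]: "q \<in> borel_measurable (N \<Otimes>\<^sub>M lborel)" unfolding q_def by measurable
  have 1: "(\<lambda>p. \<phi> (s (fst p)) (q p) (x (fst p))) \<in> N \<Otimes>\<^sub>M lborel \<rightarrow>\<^sub>M manifold_borel M"
    by (rule measurable_flow) (auto simp: q_def space_pair_measure intro: s0)
  have 2 [measurable]: "(\<lambda>p. rate j (q p) (\<phi> (s (fst p)) (q p) (x (fst p)))) \<in> borel_measurable (N \<Otimes>\<^sub>M lborel)"
    by (rule measurable_rate[OF j _ 1]) (auto simp: q_def space_pair_measure simp: le_max_iff_disj intro: s0)
  have "(\<lambda>\<omega>. LINT p|lborel. (if s \<omega> \<le> p \<and> p \<le> t \<omega> then rate j (q (\<omega>, p)) (\<phi> (s (fst (\<omega>, p))) (q (\<omega>, p)) (x (fst (\<omega>, p)))) else 0))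
      \<in> borel_measurable N"
    by (intro lborel.borel_measurable_lebesgue_integral) (use 2 in \<open>simp add: split_beta; measurable\<close>)
  also have "?this \<longleftrightarrow> ?thesis"
    unfolding cumulative_rate_def set_lebesgue_integral_def
    by (intro measurable_cong Bochner_Integration.integral_cong) (auto simp: q_def indicator_def max_def)
  finally show ?thesis .
qed

lemma set_integrable_rate:
  assumes j: "j \<in> {1..l}" and s: "0 \<le> s" and x: "x \<in> M"
  shows "set_integrable lborel {s..t} (\<lambda>q. rate j q (\<phi> s q x))"
proof -
  let ?c = "\<lambda>q. (q, \<phi> s q x)"
  have "compact (?c ` {s..t})"
    by (intro compact_continuous_image continuous_intros continuous_on_subset[OF continuous_on_flow[OF s x]]) auto
  moreover have "?c ` {s..t} \<subseteq> {0..} \<times> M" using s x flow_in by auto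
  ultimately have "\<exists>B. \<forall>(q, y)\<in>?c ` {s..t}. rate j q y \<le> B"
    using rate[OF j, unfolded jump_rate_def, THEN conjunct2, THEN conjunct2, THEN spec] by blast
  then obtain B where B: "\<And>q. q \<in> {s..t} \<Longrightarrow> rate j q (\<phi> s q x) \<le> B"
    by fastforce
  have nonneg: "0 \<le> rate j q (\<phi> s q x)" if "s \<le> q" for q
    using rate[OF j] s x that flow_in by (simp add: jump_rate_def)
  have 1: "(\<lambda>q. \<phi> s (max s q) x) \<in> lborel \<rightarrow>\<^sub>M manifold_borel M"
    by (rule measurable_flow) (use s x in auto)
  have 2: "(\<lambda>q. rate j (max s q) (\<phi> s (max s q) x)) \<in> borel_measurable lborel"
    by (rule measurable_rate[OF j _ 1]) (use s in auto)
  have "integrable lborel (\<lambda>q. indicator {s..t} q *\<^sub>R rate j (max s q) (\<phi> s (max s q) x))"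
    using B nonneg by (intro integrableI_bounded_set_indicator[where B=B] 2)
      (auto simp: max_def abs_of_nonneg emeasure_lborel_Icc_eq)
  also have "(\<lambda>q. indicator {s..t} q *\<^sub>R rate j (max s q) (\<phi> s (max s q) x))
      = (\<lambda>q. indicator {s..t} q *\<^sub>R rate j q (\<phi> s q x))"
    by (auto simp: indicator_def max_def)
  finally show ?thesis unfolding set_integrable_def .
qed

context
  fixes j :: nat and s :: real and x :: "'a" assumes j: "j \<in> {1..l}" and s: "0 \<le> s" and x: "x \<in> M"
begin

abbreviation (input) "\<Lambda> t \<equiv> cumulative_rate \<phi> (rate j) s t x"

lemma cumulative_rate_eq_integral: "\<Lambda> t = integral {s..t} (\<lambda>q. rate j q (\<phi> s q x))"
  unfolding cumulative_rate_def by (rule set_borel_integral_eq_integral(2)[OF set_integrable_rate[OF j s x]])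

lemma integrable_rate: "(\<lambda>q. rate j q (\<phi> s q x)) integrable_on {s..t}"
  by (rule set_borel_integral_eq_integral(1)[OF set_integrable_rate[OF j s x]])

lemma cumulative_rate_mono: "t \<le> t' \<Longrightarrow> \<Lambda> t \<le> \<Lambda> t'"
  unfolding cumulative_rate_eq_integral using rate[OF j] s x flow_in
  by (intro integral_subset_le integrable_rate) (auto simp: jump_rate_def)

lemma cumulative_rate_self: "\<Lambda> s = 0"
  unfolding cumulative_rate_eq_integral by simp

lemma cumulative_rate_nonneg: "s \<le> t \<Longrightarrow> 0 \<le> \<Lambda> t"
  using cumulative_rate_mono[of s t] cumulative_rate_self by simp

lemma continuous_on_cumulative_rate: "continuous_on {s..t} (\<lambda>t. \<Lambda> t)"
  unfolding cumulative_rate_eq_integral by (rule indefinite_integral_continuous_1[OF integrable_rate])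

lemma jump_time_A_ge: "ennreal s \<le> jump_time_A \<phi> (rate j) s x h"
  unfolding jump_time_A_def using s by (intro Inf_greatest) (auto intro!: ennreal_leI)

lemma jump_time_B_ge: "ennreal s \<le> jump_time_B \<phi> (rate j) s x h"
  unfolding jump_time_B_def using s by (intro Inf_greatest) (auto intro!: ennreal_leI)

lemma jump_time_B_gt:
  assumes t: "s \<le> t" and h: "\<Lambda> t < h"
  shows "ennreal t < jump_time_B \<phi> (rate j) s x h"
proof -
  have "continuous_on {s..t + 1} (\<lambda>t. \<Lambda> t)" by (rule continuous_on_cumulative_rate)
  then have "\<forall>\<^sub>F u in at t within {s..t + 1}. \<Lambda> u < h"
    using t h by (auto simp: continuous_on_def intro: order_tendstoD)
  then obtain e where e: "e > 0" "\<And>u. u \<in> {s..t + 1} \<Longrightarrow> u \<noteq> t \<Longrightarrow> dist u t < e \<Longrightarrow> \<Lambda> u < h"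
    unfolding eventually_at by blast
  define t' where "t' = t + min 1 (e / 2)"
  have t': "t < t'" "\<Lambda> t' < h"
    using e(1) t by (auto simp: t'_def dist_real_def min_def intro!: e(2))
  have "ennreal t' \<le> jump_time_B \<phi> (rate j) s x h"
    unfolding jump_time_B_def
  proof (intro Inf_greatest, clarify)
    fix u assume "s < u" "h < \<Lambda> u"
    then have "t' \<le> u" using t' cumulative_rate_mono[of u t'] by linarith
    then show "ennreal t' \<le> ennreal u" by (rule ennreal_leI)
  qed
  moreover have "ennreal t < ennreal t'" using t'(1) s t by (simp add: ennreal_lessI)
  ultimately show ?thesis by simp
qed

lemma jump_time_B_lt:
  assumes h: "0 \<le> h" "h < \<Lambda> t" and "s \<le> t"
  shows "jump_time_B \<phi> (rate j) s x h < ennreal t"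
proof -
  have t: "s < t" using assms cumulative_rate_self by (cases "s = t") auto
  have "continuous_on {s..t} (\<lambda>t. \<Lambda> t)" by (rule continuous_on_cumulative_rate)
  then have "\<forall>\<^sub>F u in at t within {s..t}. h < \<Lambda> u"
    using t h by (auto simp: continuous_on_def intro: order_tendstoD)
  then obtain e where e: "e > 0" "\<And>u. u \<in> {s..t} \<Longrightarrow> u \<noteq> t \<Longrightarrow> dist u t < e \<Longrightarrow> h < \<Lambda> u"
    unfolding eventually_at by blast
  define t' where "t' = t - min (t - s) e / 2"
  have t': "s < t'" "t' < t" "h < \<Lambda> t'"
    using e(1) t by (auto simp: t'_def dist_real_def min_def field_simps intro!: e(2))
  then have "jump_time_B \<phi> (rate j) s x h \<le> ennreal t'"
    unfolding jump_time_B_def by (intro Inf_lower) auto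
  also have "\<dots> < ennreal t" using t' s by (simp add: ennreal_lessI)
  finally show ?thesis .
qed

lemma jump_time_A_eq:
  "jump_time_A \<phi> (rate j) s x h = (if h < 0 then ennreal s else jump_time_B \<phi> (rate j) s x h)"
proof (cases "h < 0")
  case True
  then have "jump_time_A \<phi> (rate j) s x h \<le> ennreal s"
    unfolding jump_time_A_def using cumulative_rate_self by (intro Inf_lower) auto
  with jump_time_A_ge[of h] True show ?thesis by auto
next
  case False
  then have "{ennreal t | t. s \<le> t \<and> h < \<Lambda> t} = {ennreal t | t. s < t \<and> h < \<Lambda> t}"
    using cumulative_rate_self by (force simp: order_le_less)
  with False show ?thesis by (simp add: jump_time_A_def jump_time_B_def)
qed

lemma jump_time_B_less_iff:
  "jump_time_B \<phi> (rate j) s x h < y \<longleftrightarrow> (\<exists>q\<in>\<rat>. s < q \<and> h < \<Lambda> q \<and> ennreal q < y)"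
proof
  assume "jump_time_B \<phi> (rate j) s x h < y"
  then obtain t where t: "s < t" "h < \<Lambda> t" "ennreal t < y"
    unfolding jump_time_B_def by (auto simp: Inf_less_iff)
  obtain t' where t': "ennreal t < ennreal t'" "ennreal t' < y" "t < t'"
  proof -
    obtain z where z: "ennreal t < z" "z < y" using t(3) dense by blast
    show ?thesis
    proof (rule that[of "enn2real z"])
      have "z < \<infinity>" using z(2) by (rule order_less_le_trans) simp
      then have "ennreal (enn2real z) = z" by (simp add: ennreal_enn2real_if)
      with z s t(1) show "ennreal t < ennreal (enn2real z)" "ennreal (enn2real z) < y" "t < enn2real z"
        using ennreal_less_iff[of t "enn2real z"] by auto
    qed
  qed
  obtain q where q: "q \<in> \<rat>" "t < q" "q < t'" using Rats_dense_in_real[OF t'(3)] by auto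
  then have "h < \<Lambda> q" using cumulative_rate_mono[of t q] t(2) by simp
  moreover have "ennreal q < y" using q(3) t'(2) by (meson ennreal_leI less_imp_le order_le_less_trans)
  ultimately show "\<exists>q\<in>\<rat>. s < q \<and> h < \<Lambda> q \<and> ennreal q < y"
    using q t(1) by (intro bexI[of _ q]) auto
next
  assume "\<exists>q\<in>\<rat>. s < q \<and> h < \<Lambda> q \<and> ennreal q < y"
  then show "jump_time_B \<phi> (rate j) s x h < y"
    unfolding jump_time_B_def by (auto simp: Inf_less_iff)
qed

end

lemma measurable_jump_time_B:
  assumes j: "j \<in> {1..l}" and s: "s \<in> borel_measurable N" and h: "h \<in> borel_measurable N"
    and x: "x \<in> N \<rightarrow>\<^sub>M manifold_borel M" and s0: "\<And>\<omega>. \<omega> \<in> space N \<Longrightarrow> 0 \<le> s \<omega>"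
  shows "(\<lambda>\<omega>. jump_time_B \<phi> (rate j) (s \<omega>) (x \<omega>) (h \<omega>)) \<in> borel_measurable N"
proof (rule borel_measurableI_less)
  fix y :: ennreal
  note [measurable] = s h
  have "{\<omega> \<in> space N. jump_time_B \<phi> (rate j) (s \<omega>) (x \<omega>) (h \<omega>) < y}
      = {\<omega> \<in> space N. \<exists>q\<in>\<rat>. s \<omega> < q \<and> h \<omega> < cumulative_rate \<phi> (rate j) (s \<omega>) q (x \<omega>) \<and> ennreal q < y}"
    using measurable_space[OF x] s0 jump_time_B_less_iff[OF j] by auto
  also have "\<dots> \<in> sets N"
  proof (rule sets.sets_Collect_countable_Ex')
    fix q :: real
    have [measurable]: "(\<lambda>\<omega>. cumulative_rate \<phi> (rate j) (s \<omega>) q (x \<omega>)) \<in> borel_measurable N"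
      by (rule measurable_cumulative_rate[OF j s _ x s0]) auto
    show "{\<omega> \<in> space N. s \<omega> < q \<and> h \<omega> < cumulative_rate \<phi> (rate j) (s \<omega>) q (x \<omega>) \<and> ennreal q < y} \<in> sets N"
      by measurable
  qed (rule countable_rat)
  finally show "{\<omega> \<in> space N. jump_time_B \<phi> (rate j) (s \<omega>) (x \<omega>) (h \<omega>) < y} \<in> sets N" .
qed

lemma measurable_jump_time_A:
  assumes j: "j \<in> {1..l}" and s: "s \<in> borel_measurable N" and h: "h \<in> borel_measurable N"
    and x: "x \<in> N \<rightarrow>\<^sub>M manifold_borel M" and s0: "\<And>\<omega>. \<omega> \<in> space N \<Longrightarrow> 0 \<le> s \<omega>"
  shows "(\<lambda>\<omega>. jump_time_A \<phi> (rate j) (s \<omega>) (x \<omega>) (h \<omega>)) \<in> borel_measurable N"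
proof -
  note [measurable] = s h measurable_jump_time_B[OF assms]
  have "(\<lambda>\<omega>. if h \<omega> < 0 then ennreal (s \<omega>) else jump_time_B \<phi> (rate j) (s \<omega>) (x \<omega>) (h \<omega>)) \<in> borel_measurable N"
    by measurable
  also have "?this \<longleftrightarrow> ?thesis"
    using measurable_space[OF x] s0 by (intro measurable_cong) (auto simp: jump_time_A_eq[OF j])
  finally show ?thesis .
qed

section \<open>The state space with cemetery\<close>

abbreviation "OM \<equiv> borel_of_topology \<tau>"

lemma metric: "Metric_space (with_cemetery M) d"
  using cemetery by (simp add: cemetery_metric_def)

lemma topspace_\<tau> [simp]: "topspace \<tau> = with_cemetery M"
  using metric by (simp add: Metric_space.topspace_mtopology)

lemma openin_\<tau>_subset: "openin \<tau> U \<Longrightarrow> U \<subseteq> with_cemetery M"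
  using openin_subset by fastforce

lemma openin_Some: "U \<subseteq> M \<Longrightarrow> openin \<tau> (Some ` U) \<longleftrightarrow> openin (top_of_set M) U"
  using cemetery by (simp add: cemetery_metric_def)

lemma space_OM [simp]: "space OM = with_cemetery M"
  by (simp add: borel_of_topology_def space_measure_of_conv)

lemma sets_OM_sigma: "sets OM = sigma_sets (with_cemetery M) {U. openin \<tau> U}"
  unfolding borel_of_topology_def topspace_\<tau>
  by (rule sets_measure_of) (use openin_\<tau>_subset in auto)

lemma openin_in_OM: "openin \<tau> U \<Longrightarrow> U \<in> sets OM"
  unfolding sets_OM_sigma by auto

lemma openin_vimage_Some:
  assumes "openin \<tau> U" shows "openin (top_of_set M) (Some -` U)"
proof -
  have "Some -` U \<subseteq> M" using openin_\<tau>_subset[OF assms] by (auto simp: with_cemetery_iff)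
  moreover have "U \<inter> Some ` M = Some ` (Some -` U)"
    using openin_\<tau>_subset[OF assms] by (auto simp: with_cemetery_iff)
  moreover have "openin \<tau> (U \<inter> Some ` M)"
    using assms openin_Some[of M] by (intro openin_Int) auto
  ultimately show ?thesis using openin_Some by metis
qed

lemma measurable_Some: "Some \<in> manifold_borel M \<rightarrow>\<^sub>M OM"
  unfolding borel_of_topology_def topspace_\<tau>
proof (rule measurable_measure_of)
  fix U assume "U \<in> {U. openin \<tau> U}"
  then have "openin (top_of_set M) (Some -` U)" using openin_vimage_Some by simp
  then obtain V where "open V" "Some -` U = M \<inter> V" unfolding openin_open by auto
  then show "Some -` U \<inter> space (manifold_borel M) \<in> sets (manifold_borel M)"
    by (auto simp: manifold_borel_def sets_restrict_space)
qed (use openin_\<tau>_subset in \<open>auto simp: with_cemetery_iff\<close>)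

lemma image_Some_in_OM:
  assumes "A \<in> sets (manifold_borel M)" shows "Some ` A \<in> sets OM"
proof -
  obtain C where C: "C \<in> sets borel" "A = M \<inter> C"
    using assms by (auto simp: manifold_borel_def sets_restrict_space)
  have M: "Some ` M \<in> sets OM" using openin_Some[of M] by (intro openin_in_OM) auto
  have "C \<in> sigma_sets UNIV {S. open S}" using C(1) by (simp add: borel_def)
  then have "Some ` (M \<inter> C) \<in> sets OM"
  proof induction
    case (Basic C)
    then show ?case using openin_Some[of "M \<inter> C"] by (intro openin_in_OM) auto
  next
    case (Compl C)
    have "Some ` (M \<inter> (UNIV - C)) = Some ` M - Some ` (M \<inter> C)" by auto
    with Compl M show ?case by auto
  next
    case (Union C)
    have "Some ` (M \<inter> (\<Union>i. C i)) = (\<Union>i. Some ` (M \<inter> C i))" by auto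
    with Union show ?case by auto
  qed simp
  with C show ?thesis by simp
qed

lemma None_in_OM: "{None} \<in> sets OM"
proof -
  have "Some ` M \<in> sets OM" using openin_Some[of M] by (intro openin_in_OM) auto
  moreover have "{None} = space OM - Some ` M" by (auto simp: with_cemetery_iff)
  ultimately show ?thesis by (metis sets.compl_sets)
qed

lemma measurable_case_OM:
  assumes f: "f \<in> N \<rightarrow>\<^sub>M OM" and k: "k \<in> N \<rightarrow>\<^sub>M K"
    and g: "(\<lambda>(\<omega>, x). g \<omega> x) \<in> N \<Otimes>\<^sub>M manifold_borel M \<rightarrow>\<^sub>M K"
  shows "(\<lambda>\<omega>. case f \<omega> of None \<Rightarrow> k \<omega> | Some x \<Rightarrow> g \<omega> x) \<in> N \<rightarrow>\<^sub>M K"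
proof -
  obtain w where w: "w \<in> M" using nonempty by auto
  have "case_option w (\<lambda>x. x) \<in> OM \<rightarrow>\<^sub>M manifold_borel M"
  proof (rule measurableI)
    fix y assume "y \<in> space OM"
    then show "case_option w (\<lambda>x. x) y \<in> space (manifold_borel M)" using w by (auto simp: with_cemetery_iff)
  next
    fix A assume A: "A \<in> sets (manifold_borel M)"
    then have "A \<subseteq> M" using sets.sets_into_space by force
    then have "case_option w (\<lambda>x. x) -` A \<inter> space OM = Some ` A \<union> (if w \<in> A then {None} else {})"
      by (auto simp: with_cemetery_iff split: option.splits if_splits)
    with sets.Un[OF image_Some_in_OM[OF A] None_in_OM] image_Some_in_OM[OF A] show "case_option w (\<lambda>x. x) -` A \<inter> space OM \<in> sets OM" by auto
  qed
  then have "(\<lambda>\<omega>. case_option w (\<lambda>x. x) (f \<omega>)) \<in> N \<rightarrow>\<^sub>M manifold_borel M"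
    using f by (rule measurable_compose[rotated])
  then have "(\<lambda>\<omega>. (\<omega>, case_option w (\<lambda>x. x) (f \<omega>))) \<in> N \<rightarrow>\<^sub>M N \<Otimes>\<^sub>M manifold_borel M"
    by measurable
  from measurable_compose[OF this g]
  have "(\<lambda>\<omega>. g \<omega> (case_option w (\<lambda>x. x) (f \<omega>))) \<in> N \<rightarrow>\<^sub>M K" by simp
  moreover have "{\<omega> \<in> space N. f \<omega> = None} \<in> sets N"
    using measurable_sets[OF f None_in_OM] by (simp add: vimage_def Int_def conj_commute)
  ultimately have "(\<lambda>\<omega>. if f \<omega> = None then k \<omega> else g \<omega> (case_option w (\<lambda>x. x) (f \<omega>))) \<in> N \<rightarrow>\<^sub>M K"
    using k by (intro measurable_If)
  also have "(\<lambda>\<omega>. if f \<omega> = None then k \<omega> else g \<omega> (case_option w (\<lambda>x. x) (f \<omega>)))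
      = (\<lambda>\<omega>. case f \<omega> of None \<Rightarrow> k \<omega> | Some x \<Rightarrow> g \<omega> x)"
    by (auto split: option.splits)
  finally show ?thesis .
qed

end

section \<open>The embedded chains as iterated measurable maps\<close>

context pdmp_setting
begin

definition SS :: "('a option \<times> ennreal \<times> nat) measure" where
  "SS = OM \<Otimes>\<^sub>M borel \<Otimes>\<^sub>M count_space {1..l}"

text \<open>The maximum keeps the arguments of the flow in order for all \<open>t\<close>, so that the map is measurable; jump
  times are at least \<open>s\<close>.\<close>

definition jump_state :: "real \<Rightarrow> 'a \<Rightarrow> ennreal \<Rightarrow> nat \<Rightarrow> real \<Rightarrow> 'a option \<times> ennreal \<times> nat" where
  "jump_state s x t i u = (if t = \<infinity> then (None, \<infinity>, 1)
     else (Some (G i (enn2real t) (\<phi> s (max s (enn2real t)) x) u), t, i))"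

definition next_state ::
    "((real \<Rightarrow> 'a \<Rightarrow> real) \<Rightarrow> real \<Rightarrow> 'a \<Rightarrow> real \<Rightarrow> ennreal) \<Rightarrow> 'a option \<times> ennreal \<times> nat \<Rightarrow>
      (nat \<Rightarrow> real) \<Rightarrow> real \<Rightarrow> 'a option \<times> ennreal \<times> nat" where
  "next_state J c h u = (case fst c of None \<Rightarrow> (None, \<infinity>, 1)
     | Some x \<Rightarrow> let s = enn2real (fst (snd c)); T = (\<lambda>j. J (rate j) s x (h j))
         in jump_state s x (first_time l T) (first_index l T) u)"

definition next_index :: "'a option \<times> ennreal \<times> nat \<Rightarrow> (nat \<Rightarrow> real) \<Rightarrow> nat" where
  "next_index c h = (case fst c of None \<Rightarrow> 1
     | Some x \<Rightarrow> first_index l (\<lambda>j. jump_time_B \<phi> (rate j) (enn2real (fst (snd c))) x (h j)))"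

definition next_clocks :: "'a option \<times> ennreal \<times> nat \<Rightarrow> (nat \<Rightarrow> real) \<Rightarrow> real \<Rightarrow> nat \<Rightarrow> real" where
  "next_clocks c h e = (\<lambda>j\<in>{1..l}. case fst c of None \<Rightarrow> h j
     | Some x \<Rightarrow> let s = enn2real (fst (snd c)) in
        if j = next_index c h then e
        else h j - cumulative_rate \<phi> (rate j) s
               (enn2real (first_time l (\<lambda>j. jump_time_B \<phi> (rate j) s x (h j)))) x)"

lemma space_SS: "c \<in> space SS \<longleftrightarrow> fst c \<in> with_cemetery M \<and> snd (snd c) \<in> {1..l}"
  by (cases c) (auto simp: SS_def space_pair_measure)

lemma measurable_SS:
  assumes "c \<in> N \<rightarrow>\<^sub>M SS"
  shows "(\<lambda>\<omega>. fst (c \<omega>)) \<in> N \<rightarrow>\<^sub>M OM" "(\<lambda>\<omega>. fst (snd (c \<omega>))) \<in> borel_measurable N"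
  using assms unfolding SS_def by measurable

lemma cemetery_state_measurable: "(\<lambda>_. (None, \<infinity>, 1)) \<in> N \<rightarrow>\<^sub>M SS"
  using l by (intro measurable_const) (simp add: space_SS with_cemetery_def)

lemma measurable_jump_state:
  assumes s: "s \<in> borel_measurable N" "\<And>\<omega>. \<omega> \<in> space N \<Longrightarrow> 0 \<le> s \<omega>" and x: "x \<in> N \<rightarrow>\<^sub>M manifold_borel M"
    and t: "t \<in> borel_measurable N" and i: "i \<in> N \<rightarrow>\<^sub>M count_space {1..l}" and u: "u \<in> borel_measurable N"
  shows "(\<lambda>\<omega>. jump_state (s \<omega>) (x \<omega>) (t \<omega>) (i \<omega>) (u \<omega>)) \<in> N \<rightarrow>\<^sub>M SS"
proof -
  note [measurable] = s(1) t
  have 1: "(\<lambda>\<omega>. \<phi> (s \<omega>) (max (s \<omega>) (enn2real (t \<omega>))) (x \<omega>)) \<in> N \<rightarrow>\<^sub>M manifold_borel M"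
    by (rule measurable_flow[OF s(1) _ x]) (use s(2) in auto)
  have 2: "(\<lambda>\<omega>. G (i \<omega>) (enn2real (t \<omega>)) (\<phi> (s \<omega>) (max (s \<omega>) (enn2real (t \<omega>))) (x \<omega>)) (u \<omega>)) \<in> N \<rightarrow>\<^sub>M manifold_borel M"
    by (rule measurable_G[OF i _ 1 u]) auto
  note [measurable] = measurable_compose[OF 2 measurable_Some] i
  have "(\<lambda>\<omega>. (Some (G (i \<omega>) (enn2real (t \<omega>)) (\<phi> (s \<omega>) (max (s \<omega>) (enn2real (t \<omega>))) (x \<omega>)) (u \<omega>)), t \<omega>, i \<omega>)) \<in> N \<rightarrow>\<^sub>M SS"
    unfolding SS_def by measurable
  moreover have "{\<omega> \<in> space N. t \<omega> = \<infinity>} \<in> sets N" by measurable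
  ultimately show ?thesis
    unfolding jump_state_def by (intro measurable_If cemetery_state_measurable)
qed

lemma measurable_next:
  assumes c: "c \<in> N \<rightarrow>\<^sub>M SS" and h: "\<And>j. j \<in> {1..l} \<Longrightarrow> (\<lambda>\<omega>. h \<omega> j) \<in> borel_measurable N"
  shows measurable_next_state: "u \<in> borel_measurable N \<Longrightarrow> J \<in> {jump_time_A \<phi>, jump_time_B \<phi>} \<Longrightarrow>
      (\<lambda>\<omega>. next_state J (c \<omega>) (h \<omega>) (u \<omega>)) \<in> N \<rightarrow>\<^sub>M SS"
    and measurable_next_index: "(\<lambda>\<omega>. next_index (c \<omega>) (h \<omega>)) \<in> N \<rightarrow>\<^sub>M count_space {1..l}"
    and measurable_next_clocks: "\<And>j. e \<in> borel_measurable N \<Longrightarrow> j \<in> {1..l} \<Longrightarrow>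
      (\<lambda>\<omega>. next_clocks (c \<omega>) (h \<omega>) (e \<omega>) j) \<in> borel_measurable N"
proof -
  let ?N = "N \<Otimes>\<^sub>M manifold_borel M"
  let ?s = "\<lambda>p. enn2real (fst (snd (c (fst p))))"
  note c1 = measurable_SS(1)[OF c] and c2[measurable] = measurable_SS(2)[OF c]
  have s: "?s \<in> borel_measurable ?N" by measurable
  have h': "(\<lambda>p. h (fst p) j) \<in> borel_measurable ?N" if "j \<in> {1..l}" for j
    using measurable_compose[OF measurable_fst h[OF that]] .
  have T: "(\<lambda>p. J (rate j) (?s p) (snd p) (h (fst p) j)) \<in> borel_measurable ?N"
    if "J \<in> {jump_time_A \<phi>, jump_time_B \<phi>}" "j \<in> {1..l}" for j J
    using that(1) measurable_jump_time_A[OF that(2) s h'[OF that(2)] measurable_snd]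
      measurable_jump_time_B[OF that(2) s h'[OF that(2)] measurable_snd] by auto
  have ft: "(\<lambda>p. first_time l (\<lambda>j. J (rate j) (?s p) (snd p) (h (fst p) j))) \<in> borel_measurable ?N"
    and fi: "(\<lambda>p. first_index l (\<lambda>j. J (rate j) (?s p) (snd p) (h (fst p) j))) \<in> ?N \<rightarrow>\<^sub>M count_space {1..l}"
    if "J \<in> {jump_time_A \<phi>, jump_time_B \<phi>}" for J
    using measurable_first_time[OF l T[OF that]] measurable_first_index[OF l T[OF that]] by simp_all
  show "(\<lambda>\<omega>. next_state J (c \<omega>) (h \<omega>) (u \<omega>)) \<in> N \<rightarrow>\<^sub>M SS"
    if u: "u \<in> borel_measurable N" and J: "J \<in> {jump_time_A \<phi>, jump_time_B \<phi>}"
    unfolding next_state_def Let_def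
  proof (rule measurable_case_OM[OF c1 cemetery_state_measurable], unfold split_beta)
    show "(\<lambda>p. jump_state (?s p) (snd p) (first_time l (\<lambda>j. J (rate j) (?s p) (snd p) (h (fst p) j)))
        (first_index l (\<lambda>j. J (rate j) (?s p) (snd p) (h (fst p) j))) (u (fst p))) \<in> ?N \<rightarrow>\<^sub>M SS"
      using u by (intro measurable_jump_state s ft[OF J] fi[OF J]) auto
  qed
  show ni: "(\<lambda>\<omega>. next_index (c \<omega>) (h \<omega>)) \<in> N \<rightarrow>\<^sub>M count_space {1..l}"
    unfolding next_index_def
    using l fi[of "jump_time_B \<phi>"] by (intro measurable_case_OM[OF c1]) (auto simp: split_beta)
  show "(\<lambda>\<omega>. next_clocks (c \<omega>) (h \<omega>) (e \<omega>) j) \<in> borel_measurable N"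
    if e: "e \<in> borel_measurable N" and j: "j \<in> {1..l}" for j
  proof -
    note [measurable] = e measurable_compose[OF measurable_fst ni] h'[OF j] ft[of "jump_time_B \<phi>", simplified]
    have [measurable]: "(\<lambda>p. cumulative_rate \<phi> (rate j) (?s p)
               (enn2real (first_time l (\<lambda>j. jump_time_B \<phi> (rate j) (?s p) (snd p) (h (fst p) j)))) (snd p)) \<in> borel_measurable ?N"
      by (rule measurable_cumulative_rate[OF j s _ measurable_snd]) measurable
    have "(\<lambda>p. if j = next_index (c (fst p)) (h (fst p)) then e (fst p)
        else h (fst p) j - cumulative_rate \<phi> (rate j) (?s p)
               (enn2real (first_time l (\<lambda>j. jump_time_B \<phi> (rate j) (?s p) (snd p) (h (fst p) j)))) (snd p)) \<in> borel_measurable ?N"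
      by measurable
    then show ?thesis
      unfolding next_clocks_def Let_def using j
      by (auto intro!: measurable_case_OM[OF c1 h] simp: split_beta)
  qed
qed

lemma next_index_mem: "next_index c h \<in> {1..l}"
  using l first_index_mem(1)[OF l] by (auto simp: next_index_def split: option.split)

lemma next_state_mem:
  assumes "c \<in> space SS" "J \<in> {jump_time_A \<phi>, jump_time_B \<phi>}"
  shows "next_state J c h u \<in> space SS"
  using measurable_space[OF measurable_next_state[of "\<lambda>_. c" "count_space UNIV" "\<lambda>_. h" "\<lambda>_. u" J], of "()"] assms
  by auto

lemma next_cong:
  assumes "\<And>j. j \<in> {1..l} \<Longrightarrow> h j = h' j"
  shows "next_state J c h u = next_state J c h' u" "next_index c h = next_index c h'"
    "next_clocks c h e = next_clocks c h' e"
proof -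
  have T: "first_time l (\<lambda>j. J (rate j) s x (h j)) = first_time l (\<lambda>j. J (rate j) s x (h' j))"
    and I: "first_index l (\<lambda>j. J (rate j) s x (h j)) = first_index l (\<lambda>j. J (rate j) s x (h' j))" for s x
    and J :: "(real \<Rightarrow> 'a \<Rightarrow> real) \<Rightarrow> real \<Rightarrow> 'a \<Rightarrow> real \<Rightarrow> ennreal"
    using assms by (auto intro!: first_cong)
  show "next_state J c h u = next_state J c h' u"
  proof (cases "fst c")
    case (Some x)
    show ?thesis
      unfolding next_state_def Let_def Some option.case
        T[of J "enn2real (fst (snd c))" x] I[of J "enn2real (fst (snd c))" x] ..
  qed (simp add: next_state_def)
  show ni: "next_index c h = next_index c h'"
  proof (cases "fst c")
    case (Some x)
    show ?thesis
      unfolding next_index_def Some option.case I[of "jump_time_B \<phi>" "enn2real (fst (snd c))" x] ..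
  qed (simp add: next_index_def)
  have "(case fst c of None \<Rightarrow> h j | Some x \<Rightarrow> if j = next_index c h then e
      else h j - cumulative_rate \<phi> (rate j) (enn2real (fst (snd c)))
               (enn2real (first_time l (\<lambda>j. jump_time_B \<phi> (rate j) (enn2real (fst (snd c))) x (h j)))) x)
     = (case fst c of None \<Rightarrow> h' j | Some x \<Rightarrow> if j = next_index c h' then e
      else h' j - cumulative_rate \<phi> (rate j) (enn2real (fst (snd c)))
               (enn2real (first_time l (\<lambda>j. jump_time_B \<phi> (rate j) (enn2real (fst (snd c))) x (h' j)))) x)"
    if "j \<in> {1..l}" for j
  proof (cases "fst c")
    case (Some x)
    show ?thesis
      unfolding Some option.case ni assms[OF that] T[of "jump_time_B \<phi>" "enn2real (fst (snd c))" x] ..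
  qed (simp add: assms[OF that])
  then show "next_clocks c h e = next_clocks c h' e"
    unfolding next_clocks_def Let_def by (rule restrict_ext)
qed

lemma first_time_jump_ge:
  assumes "0 \<le> s" "x \<in> M" "J \<in> {jump_time_A \<phi>, jump_time_B \<phi>}"
  shows "ennreal s \<le> first_time l (\<lambda>j. J (rate j) s x (h j))"
proof -
  obtain j where "j \<in> {1..l}" "J (rate j) s x (h j) = first_time l (\<lambda>j. J (rate j) s x (h j))"
    using first_time_mem[OF l, of "\<lambda>j. J (rate j) s x (h j)"] by auto
  with assms jump_time_A_ge[of j s x "h j"] jump_time_B_ge[of j s x "h j"] show ?thesis by auto
qed

lemma jump_state_eq:
  fixes h :: "nat \<Rightarrow> real"
  assumes "0 \<le> s" "x \<in> M" "J \<in> {jump_time_A \<phi>, jump_time_B \<phi>}"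
  defines "T \<equiv> first_time l (\<lambda>j. J (rate j) s x (h j))"
  shows "jump_state s x T i u = (if T = \<infinity> then (None, \<infinity>, 1) else (Some (G i (enn2real T) (\<phi> s (enn2real T) x) u), T, i))"
proof -
  have "s \<le> enn2real T" if "T \<noteq> \<infinity>"
    using first_time_jump_ge[OF assms(1-3), of h] that assms(1) unfolding T_def
    by (metis enn2real_ennreal enn2real_mono infinity_ennreal_def top.not_eq_extremum)
  then show ?thesis by (auto simp: jump_state_def max_def)
qed

abbreviation "chainA \<equiv> chain_A l \<phi> rate G"

lemma chain_A_mem_Suc:
  assumes "w \<in> M"
  shows "chainA w e u k \<in> space SS"
    and "chainA w e u (Suc k) = next_state (jump_time_A \<phi>) (chainA w e u k) (\<lambda>j. e j (Suc k)) (u (Suc k))"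
proof -
  have step: "chainA w e u (Suc k) = next_state (jump_time_A \<phi>) (chainA w e u k) (\<lambda>j. e j (Suc k)) (u (Suc k))"
    if "chainA w e u k \<in> space SS" for k
  proof (cases "chainA w e u k")
    case (fields y S i)
    show ?thesis
    proof (cases y)
      case None
      with fields show ?thesis by (simp add: next_state_def)
    next
      case (Some x)
      with fields that have "x \<in> M" by (auto simp: space_SS with_cemetery_iff)
      with fields Some show ?thesis
        by (simp add: next_state_def Let_def jump_state_eq[where J="jump_time_A \<phi>"])
    qed
  qed
  show mem: "chainA w e u k \<in> space SS" for k
  proof (induction k)
    case 0
    then show ?case using assms l by (simp add: space_SS with_cemetery_def)
  next
    case (Suc k)
    then show ?case using step[OF Suc] next_state_mem[of _ "jump_time_A \<phi>"] by simp
  qed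
  show "chainA w e u (Suc k) = next_state (jump_time_A \<phi>) (chainA w e u k) (\<lambda>j. e j (Suc k)) (u (Suc k))"
    by (rule step[OF mem])
qed

lemma measurable_chain_A:
  assumes W: "W \<in> N \<rightarrow>\<^sub>M manifold_borel M"
    and E: "\<And>j k. j \<in> {1..l} \<Longrightarrow> 1 \<le> k \<Longrightarrow> E j k \<in> borel_measurable N"
    and U: "\<And>k. 1 \<le> k \<Longrightarrow> U k \<in> borel_measurable N"
  shows "(\<lambda>\<omega>. chainA (W \<omega>) (\<lambda>j k. E j k \<omega>) (\<lambda>k. U k \<omega>) k) \<in> N \<rightarrow>\<^sub>M SS"
proof (induction k)
  case 0
  then show ?case
    using measurable_compose[OF W measurable_Some] l unfolding SS_def by simp
next
  case (Suc k)
  have "(\<lambda>\<omega>. next_state (jump_time_A \<phi>) (chainA (W \<omega>) (\<lambda>j k. E j k \<omega>) (\<lambda>k. U k \<omega>) k)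
      (\<lambda>j. E j (Suc k) \<omega>) (U (Suc k) \<omega>)) \<in> N \<rightarrow>\<^sub>M SS"
    using E U by (intro measurable_next_state Suc) auto
  also have "?this \<longleftrightarrow> ?case"
    using measurable_space[OF W] by (intro measurable_cong) (simp only: chain_A_mem_Suc(2) space_manifold_borel)
  finally show ?case .
qed

text \<open>Unlike \<open>state_B\<close>, this restricts the clocks to \<open>{1..l}\<close> and keeps updating the counters after
  infinity.\<close>

primrec stateB :: "'a \<Rightarrow> (nat \<Rightarrow> nat \<Rightarrow> real) \<Rightarrow> (nat \<Rightarrow> nat \<Rightarrow> real) \<Rightarrow> nat \<Rightarrow>
     ('a option \<times> ennreal \<times> nat) \<times> (nat \<Rightarrow> real) \<times> (nat \<Rightarrow> nat)" where
  "stateB w e u 0 = ((Some w, 0, 1), (\<lambda>j\<in>{1..l}. e j 1), (\<lambda>_. 1))"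
| "stateB w e u (Suc k) = (case stateB w e u k of (c, H, N) \<Rightarrow>
     let i = next_index c H; m = N i + 1
     in (next_state (jump_time_B \<phi>) c H (u i m), next_clocks c H (e i m), N(i := m)))"

lemma stateB_mem: "w \<in> M \<Longrightarrow> fst (stateB w e u k) \<in> space SS"
proof (induction k)
  case 0
  then show ?case using l by (simp add: space_SS with_cemetery_def)
next
  case (Suc k)
  then show ?case using next_state_mem[of _ "jump_time_B \<phi>"] by (auto simp: Let_def split: prod.split)
qed

lemma stateB_counter_ge: "1 \<le> snd (snd (stateB w e u k)) j"
  by (induction k) (auto simp: Let_def split: prod.split)

lemma stateB_counter_le: "snd (snd (stateB w e u k)) j \<le> Suc k"
  by (induction k arbitrary: j) (auto simp: Let_def le_SucI split: prod.split)

lemma chain_B_eq: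
  assumes "w \<in> M"
  shows "chain_B l \<phi> rate G w e u k = fst (stateB w e u k)"
proof -
  have "case state_B l \<phi> rate G w e u k of (y, S, i, H, N) \<Rightarrow>
     case stateB w e u k of (c, H', N') \<Rightarrow>
       c = (y, S, i) \<and> (y \<noteq> None \<longrightarrow> (\<forall>j\<in>{1..l}. H j = H' j) \<and> N = N')"
  proof (induction k)
    case 0
    then show ?case by simp
  next
    case (Suc k)
    obtain y S i H N where B: "state_B l \<phi> rate G w e u k = (y, S, i, H, N)" by (metis prod_cases5)
    obtain H' N' where b: "stateB w e u k = ((y, S, i), H', N')"
      and eq: "y \<noteq> None \<Longrightarrow> (\<forall>j\<in>{1..l}. H j = H' j) \<and> N = N'"
      using Suc B by (auto split: prod.splits)
    show ?case
    proof (cases y)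
      case None
      then show ?thesis using B b by (simp add: Let_def next_state_def)
    next
      case (Some x)
      then have x: "x \<in> M"
        using stateB_mem[OF assms, of e u k] b by (auto simp: space_SS with_cemetery_iff)
      have H: "H j = H' j" if "j \<in> {1..l}" for j using eq Some that by auto
      have N: "N = N'" using eq Some by auto
      define s where "s = enn2real S"
      define T where "T = (\<lambda>j. jump_time_B \<phi> (rate j) s x (H j))"
      have T': "first_time l (\<lambda>j. jump_time_B \<phi> (rate j) s x (H' j)) = first_time l T"
          "first_index l (\<lambda>j. jump_time_B \<phi> (rate j) s x (H' j)) = first_index l T"
        unfolding T_def using H by (auto intro!: first_cong)
      have s0: "0 \<le> s" by (simp add: s_def)
      have ni: "next_index (y, S, i) H' = first_index l T"
        by (simp add: next_index_def Some T'[unfolded s_def])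
      have ns: "next_state (jump_time_B \<phi>) (y, S, i) H' u' =
          (if first_time l T = \<infinity> then (None, \<infinity>, 1)
           else (Some (G (first_index l T) (enn2real (first_time l T)) (\<phi> s (enn2real (first_time l T)) x) u'),
             first_time l T, first_index l T))" for u'
      proof -
        have "next_state (jump_time_B \<phi>) (y, S, i) H' u' = jump_state s x (first_time l T) (first_index l T) u'"
          by (simp add: next_state_def Some Let_def T'[unfolded s_def]) (simp add: s_def)
        then show ?thesis
          unfolding T_def using jump_state_eq[OF s0 x, of "jump_time_B \<phi>" H] by simp
      qed
      have nc: "next_clocks (y, S, i) H' e' j = (if j = first_index l T then e'
           else H j - cumulative_rate \<phi> (rate j) s (enn2real (first_time l T)) x)" if "j \<in> {1..l}" for e' j
        unfolding next_clocks_def ni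
        unfolding Some fst_conv snd_conv option.case Let_def s_def[symmetric] T'
        using that H by simp
      show ?thesis
        using B b unfolding state_B.simps stateB.simps
        by (simp add: Some[symmetric] ni ns nc Let_def N) (simp add: Some Let_def s_def[symmetric] T_def[symmetric])
    qed
  qed
  then show ?thesis by (auto simp: chain_B_def split: prod.splits)
qed

lemma stateB_indep:
  assumes "\<And>j r. j \<in> {1..l} \<Longrightarrow> 1 \<le> r \<Longrightarrow> r \<le> snd (snd (stateB w e u n)) j \<Longrightarrow> e j r = e' j r \<and> u j r = u' j r"
  shows "k \<le> n \<Longrightarrow> stateB w e u k = stateB w e' u' k"
proof (induction k)
  case 0
  have "e j 1 = e' j 1" if "j \<in> {1..l}" for j
    using assms[of j 1] that stateB_counter_ge[of w e u n j] by auto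
  then show ?case by auto
next
  case (Suc k)
  have mono: "snd (snd (stateB w e u k)) j \<le> snd (snd (stateB w e u k')) j" if "k \<le> k'" for k k' j
    using that by (induction rule: dec_induct) (auto simp: Let_def split: prod.split)
  obtain c H N where b: "stateB w e u k = (c, H, N)" by (metis prod_cases3)
  let ?i = "next_index c H"
  have "N ?i + 1 \<le> snd (snd (stateB w e u n)) ?i"
    using mono[OF Suc.prems, of ?i] b by (simp add: Let_def)
  then have "e ?i (N ?i + 1) = e' ?i (N ?i + 1) \<and> u ?i (N ?i + 1) = u' ?i (N ?i + 1)"
    using next_index_mem[of c H] by (intro assms) auto
  moreover have "stateB w e' u' k = (c, H, N)" using Suc b by simp
  ultimately show ?case using b by (simp add: Let_def)
qed

lemma measurable_stateB:
  assumes W: "W \<in> N \<rightarrow>\<^sub>M manifold_borel M"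
    and E: "\<And>j k. j \<in> {1..l} \<Longrightarrow> 1 \<le> k \<Longrightarrow> E j k \<in> borel_measurable N"
    and U: "\<And>j k. j \<in> {1..l} \<Longrightarrow> 1 \<le> k \<Longrightarrow> U j k \<in> borel_measurable N"
  defines "B \<equiv> \<lambda>k \<omega>. stateB (W \<omega>) (\<lambda>j k. E j k \<omega>) (\<lambda>j k. U j k \<omega>) k"
  shows "(\<lambda>\<omega>. fst (B k \<omega>)) \<in> N \<rightarrow>\<^sub>M SS \<and>
    (\<forall>j\<in>{1..l}. (\<lambda>\<omega>. fst (snd (B k \<omega>)) j) \<in> borel_measurable N) \<and>
    (\<forall>j\<in>{1..l}. (\<lambda>\<omega>. snd (snd (B k \<omega>)) j) \<in> N \<rightarrow>\<^sub>M count_space {1..})"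
proof (induction k)
  case 0
  then show ?case
    using measurable_compose[OF W measurable_Some] l E unfolding SS_def B_def by simp
next
  case (Suc k)
  then have c: "(\<lambda>\<omega>. fst (B k \<omega>)) \<in> N \<rightarrow>\<^sub>M SS"
    and H: "\<And>j. j \<in> {1..l} \<Longrightarrow> (\<lambda>\<omega>. fst (snd (B k \<omega>)) j) \<in> borel_measurable N"
    and C: "\<And>j. j \<in> {1..l} \<Longrightarrow> (\<lambda>\<omega>. snd (snd (B k \<omega>)) j) \<in> N \<rightarrow>\<^sub>M count_space {1..}"
    by auto
  define i where "i = (\<lambda>\<omega>. next_index (fst (B k \<omega>)) (fst (snd (B k \<omega>))))"
  define m where "m = (\<lambda>\<omega>. snd (snd (B k \<omega>)) (i \<omega>) + 1)"
  have i: "i \<in> N \<rightarrow>\<^sub>M count_space {1..l}"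
    unfolding i_def by (rule measurable_next_index[OF c H])
  have "(\<lambda>\<omega>. snd (snd (B k \<omega>)) (i \<omega>)) \<in> N \<rightarrow>\<^sub>M count_space {1..}"
    by (rule measurable_compose_countable'[OF C i]) auto
  then have m: "m \<in> N \<rightarrow>\<^sub>M count_space {1..}"
    unfolding m_def by (rule measurable_compose) auto
  have pick: "(\<lambda>\<omega>. F (i \<omega>) (m \<omega>) \<omega>) \<in> borel_measurable N"
    if F: "\<And>j k. j \<in> {1..l} \<Longrightarrow> 1 \<le> k \<Longrightarrow> F j k \<in> borel_measurable N" for F :: "nat \<Rightarrow> nat \<Rightarrow> _ \<Rightarrow> real"
  proof (rule measurable_compose_countable'[OF _ i])
    show "(\<lambda>\<omega>. F j (m \<omega>) \<omega>) \<in> borel_measurable N" if "j \<in> {1..l}" for j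
      by (rule measurable_compose_countable'[OF _ m]) (use F that in auto)
  qed auto
  have B: "B (Suc k) \<omega> = (next_state (jump_time_B \<phi>) (fst (B k \<omega>)) (fst (snd (B k \<omega>))) (U (i \<omega>) (m \<omega>) \<omega>),
      next_clocks (fst (B k \<omega>)) (fst (snd (B k \<omega>))) (E (i \<omega>) (m \<omega>) \<omega>), (snd (snd (B k \<omega>)))(i \<omega> := m \<omega>))" for \<omega>
    unfolding B_def by (simp add: i_def m_def B_def Let_def split: prod.split)
  show ?case
  proof (intro conjI ballI)
    show "(\<lambda>\<omega>. fst (B (Suc k) \<omega>)) \<in> N \<rightarrow>\<^sub>M SS"
      unfolding B fst_conv by (rule measurable_next_state[OF c H pick[OF U]]) auto
    fix j assume j: "j \<in> {1..l}"
    show "(\<lambda>\<omega>. fst (snd (B (Suc k) \<omega>)) j) \<in> borel_measurable N"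
      unfolding B fst_conv snd_conv by (rule measurable_next_clocks[OF c H pick[OF E] j]) auto
    have "{\<omega> \<in> space N. j = i \<omega>} \<in> sets N"
    proof -
      have "{\<omega> \<in> space N. j = i \<omega>} = i -` {j} \<inter> space N" by auto
      then show ?thesis using measurable_sets[OF i, of "{j}"] j by simp
    qed
    then have "(\<lambda>\<omega>. if j = i \<omega> then m \<omega> else snd (snd (B k \<omega>)) j) \<in> N \<rightarrow>\<^sub>M count_space {1..}"
      using m C[OF j] by (intro measurable_If) auto
    then show "(\<lambda>\<omega>. snd (snd (B (Suc k) \<omega>)) j) \<in> N \<rightarrow>\<^sub>M count_space {1..}"
      unfolding B fst_conv snd_conv fun_upd_def .
  qed
qed

end

section \<open>The law of the embedded chains\<close>

definition unif_law :: "real measure" where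
  "unif_law = distr unif01 borel (\<lambda>u. u)"

lemma sets_unif_law [simp, measurable_cong]: "sets unif_law = sets borel"
  by (simp add: unif_law_def)

lemma space_unif_law [simp]: "space unif_law = UNIV"
  by (simp add: unif_law_def)

lemma measurable_unif01_borel: "(\<lambda>u. u) \<in> unif01 \<rightarrow>\<^sub>M borel"
  unfolding unif01_def by (rule measurable_restrict_space1) simp

lemma prob_space_unif_law: "prob_space unif_law"
proof -
  have "emeasure unif01 (space unif01) = 1"
    by (simp add: unif01_def space_restrict_space emeasure_restrict_space)
  then have "prob_space unif01" by (rule prob_spaceI)
  then show ?thesis unfolding unif_law_def by (rule prob_space.prob_space_distr[OF _ measurable_unif01_borel])
qed

abbreviation driving_law :: "'x + 'y \<Rightarrow> real measure" where
  "driving_law \<equiv> case_sum (\<lambda>_. exp_law) (\<lambda>_. unif_law)"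

lemma prob_space_driving_law: "prob_space (driving_law z)"
  by (cases z) (simp_all add: prob_space_exp_law prob_space_unif_law)

lemma sets_driving_law: "sets (driving_law z) = sets borel"
  by (cases z) simp_all

context pdmp_setting
begin

abbreviation "PE \<equiv> PiM {1..l} (\<lambda>_. exp_law)"

sublocale E: prob_space exp_law by (rule prob_space_exp_law)
sublocale V: prob_space unif_law by (rule prob_space_unif_law)
sublocale PE: prob_space PE by (intro prob_space_PiM prob_space_exp_law)

abbreviation "next_A \<equiv> next_state (jump_time_A \<phi>)"
abbreviation "next_B \<equiv> next_state (jump_time_B \<phi>)"

lemma measurable_PE_component: "h \<in> N \<rightarrow>\<^sub>M PE \<Longrightarrow> j \<in> {1..l} \<Longrightarrow> (\<lambda>\<omega>. h \<omega> j) \<in> borel_measurable N"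
  using measurable_compose[OF _ measurable_component_singleton[of j "{1..l}" "\<lambda>_. exp_law"], of h N]
  by (simp add: measurable_cong_sets[OF refl sets_exp_law])

lemma measurable_into_PE:
  assumes "\<And>j. j \<in> {1..l} \<Longrightarrow> (\<lambda>\<omega>. h \<omega> j) \<in> borel_measurable N"
    and "\<And>\<omega>. \<omega> \<in> space N \<Longrightarrow> h \<omega> \<in> extensional {1..l}"
  shows "h \<in> N \<rightarrow>\<^sub>M PE"
  using assms by (intro measurable_PiM_single') (auto simp: measurable_cong_sets[OF refl sets_exp_law] PiE_def)

lemma space_PE: "h \<in> space PE \<longleftrightarrow> h \<in> extensional {1..l}"
  by (auto simp: space_PiM PiE_def)

lemma next_clocks_mem: "next_clocks c h e \<in> space PE"
  unfolding space_PE next_clocks_def by (rule restrict_extensional)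

lemma measurable_next_state_PE:
  assumes "c \<in> N \<rightarrow>\<^sub>M SS" "h \<in> N \<rightarrow>\<^sub>M PE" "u \<in> borel_measurable N" "J \<in> {jump_time_A \<phi>, jump_time_B \<phi>}"
  shows "(\<lambda>\<omega>. next_state J (c \<omega>) (h \<omega>) (u \<omega>)) \<in> N \<rightarrow>\<^sub>M SS"
  by (rule measurable_next_state[OF assms(1) measurable_PE_component[OF assms(2)] assms(3,4)])

lemma measurable_next_clocks_PE:
  assumes "c \<in> N \<rightarrow>\<^sub>M SS" "h \<in> N \<rightarrow>\<^sub>M PE" "e \<in> borel_measurable N"
  shows "(\<lambda>\<omega>. next_clocks (c \<omega>) (h \<omega>) (e \<omega>)) \<in> N \<rightarrow>\<^sub>M PE"
proof (rule measurable_into_PE)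
  show "(\<lambda>\<omega>. next_clocks (c \<omega>) (h \<omega>) (e \<omega>) j) \<in> borel_measurable N" if "j \<in> {1..l}" for j
    by (rule measurable_next_clocks[OF assms(1) measurable_PE_component[OF assms(2)] assms(3) that])
  show "next_clocks (c \<omega>) (h \<omega>) (e \<omega>) \<in> extensional {1..l}" for \<omega>
    using next_clocks_mem unfolding space_PE .
qed

definition step_op :: "('a option \<times> ennreal \<times> nat \<Rightarrow> ennreal) \<Rightarrow> 'a option \<times> ennreal \<times> nat \<Rightarrow> ennreal" where
  "step_op g c = (\<integral>\<^sup>+h. (\<integral>\<^sup>+u. g (next_B c h u) \<partial>unif_law) \<partial>PE)"

primrec path_integral where
  "path_integral f w 0 g = f 0 (Some w, 0, 1) * g (Some w, 0, 1)"
| "path_integral f w (Suc n) g = path_integral f w n (step_op (\<lambda>c. f (Suc n) c * g c))"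

lemma measurable_step_inner:
  assumes "k \<in> borel_measurable SS" "c \<in> N \<rightarrow>\<^sub>M SS" "h \<in> N \<rightarrow>\<^sub>M PE" "J \<in> {jump_time_A \<phi>, jump_time_B \<phi>}"
  shows "(\<lambda>\<omega>. \<integral>\<^sup>+u. k (next_state J (c \<omega>) (h \<omega>) u) \<partial>unif_law) \<in> borel_measurable N"
proof (rule V.borel_measurable_nn_integral, unfold split_beta)
  show "(\<lambda>p. k (next_state J (c (fst p)) (h (fst p)) (snd p))) \<in> borel_measurable (N \<Otimes>\<^sub>M unif_law)"
    using assms
    by (intro measurable_compose[OF measurable_next_state_PE assms(1)])
       (auto intro: measurable_compose[OF measurable_fst] simp: measurable_cong_sets[OF refl sets_unif_law, symmetric])
qed

lemma measurable_step_op: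
  assumes k: "k \<in> borel_measurable SS" shows "step_op k \<in> borel_measurable SS"
  unfolding step_op_def
proof (rule PE.borel_measurable_nn_integral, unfold split_beta)
  show "(\<lambda>p. \<integral>\<^sup>+u. k (next_B (fst p) (snd p) u) \<partial>unif_law) \<in> borel_measurable (SS \<Otimes>\<^sub>M PE)"
    by (rule measurable_step_inner[OF k measurable_fst measurable_snd]) simp
qed

lemma step_op_cong: "(\<And>c. c \<in> space SS \<Longrightarrow> g c = g' c) \<Longrightarrow> c \<in> space SS \<Longrightarrow> step_op g c = step_op g' c"
  unfolding step_op_def by (intro nn_integral_cong) (simp add: next_state_mem del: split_paired_All)

lemma path_integral_cong:
  assumes "w \<in> M" "\<And>c. c \<in> space SS \<Longrightarrow> g c = g' c"
  shows "path_integral f w n g = path_integral f w n g'"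
  using assms(2)
proof (induction n arbitrary: g g')
  case 0
  have "(Some w, 0, 1) \<in> space SS" using assms(1) l by (simp add: space_SS with_cemetery_def)
  with 0 show ?case by simp
next
  case (Suc n)
  show ?case
    unfolding path_integral.simps by (intro Suc.IH step_op_cong) (simp_all add: Suc.prems)
qed

lemma step_op_A:
  assumes "c \<in> space SS" "k \<in> borel_measurable SS"
  shows "(\<integral>\<^sup>+h. (\<integral>\<^sup>+u. k (next_A c h u) \<partial>unif_law) \<partial>PE) = step_op k c"
proof -
  have AE: "AE h in PE. \<forall>j\<in>{1..l}. 0 < h j"
    by (intro AE_finite_allI AE_PiM_component[where P="\<lambda>x. 0 < x"] prob_space_exp_law AE_exp_law_pos) auto
  have "next_A c h u = next_B c h u" if h: "\<forall>j\<in>{1..l}. 0 < h j" for h u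
  proof (cases "fst c")
    case (Some x)
    with assms have x: "x \<in> M" by (auto simp: space_SS with_cemetery_iff)
    let ?s = "enn2real (fst (snd c))"
    have eq: "jump_time_A \<phi> (rate j) ?s x (h j) = jump_time_B \<phi> (rate j) ?s x (h j)" if "j \<in> {1..l}" for j
      using jump_time_A_eq[OF that _ x, of ?s "h j"] h that by fastforce
    have "first_time l (\<lambda>j. jump_time_A \<phi> (rate j) ?s x (h j)) = first_time l (\<lambda>j. jump_time_B \<phi> (rate j) ?s x (h j))"
      "first_index l (\<lambda>j. jump_time_A \<phi> (rate j) ?s x (h j)) = first_index l (\<lambda>j. jump_time_B \<phi> (rate j) ?s x (h j))"
      by (rule first_cong[OF eq], assumption)+
    then show ?thesis unfolding next_state_def Some option.case Let_def by (rule arg_cong2)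
  qed (simp add: next_state_def)
  then show ?thesis
    unfolding step_op_def by (intro nn_integral_cong_AE) (use AE in eventually_elim, simp)
qed

lemma chain_A_indep:
  assumes w: "w \<in> M" and "\<And>j r. j \<in> {1..l} \<Longrightarrow> 1 \<le> r \<Longrightarrow> r \<le> n \<Longrightarrow> e j r = e' j r"
    and "\<And>r. 1 \<le> r \<Longrightarrow> r \<le> n \<Longrightarrow> u r = u' r"
  shows "k \<le> n \<Longrightarrow> chainA w e u k = chainA w e' u' k"
proof (induction k)
  case (Suc k)
  have "next_A c (\<lambda>j. e j (Suc k)) v = next_A c (\<lambda>j. e' j (Suc k)) v" for c v
    using Suc.prems by (intro next_cong assms) auto
  moreover have "u (Suc k) = u' (Suc k)" using Suc.prems by (intro assms) auto
  ultimately show ?case using Suc unfolding chain_A_mem_Suc(2)[OF w] by simp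
qed simp

abbreviation "JA \<equiv> ({1..l} \<times> {1..}) <+> {1..} :: (nat \<times> nat + nat) set"
abbreviation "JB \<equiv> ({1..l} \<times> {1..}) <+> ({1..l} \<times> {1..}) :: (nat \<times> nat + nat \<times> nat) set"
abbreviation "PA \<equiv> PiM JA driving_law"
abbreviation "PB \<equiv> PiM JB driving_law"

abbreviation canonical_A :: "'a \<Rightarrow> (nat \<times> nat + nat \<Rightarrow> real) \<Rightarrow> nat \<Rightarrow> 'a option \<times> ennreal \<times> nat" where
  "canonical_A w \<omega> \<equiv> chainA w (\<lambda>j k. \<omega> (Inl (j, k))) (\<lambda>k. \<omega> (Inr k))"

lemma measurable_coordinate: "z \<in> J \<Longrightarrow> (\<lambda>\<omega>. \<omega> z) \<in> borel_measurable (PiM J driving_law)"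
  using measurable_component_singleton[of z J driving_law]
  by (simp add: measurable_cong_sets[OF refl sets_driving_law])

lemma measurable_canonical_A:
  assumes "W \<in> N \<rightarrow>\<^sub>M manifold_borel M" "\<omega> \<in> N \<rightarrow>\<^sub>M PA"
  shows "(\<lambda>x. canonical_A (W x) (\<omega> x) n) \<in> N \<rightarrow>\<^sub>M SS"
  by (rule measurable_chain_A[OF assms(1)]) (auto intro!: measurable_compose[OF assms(2) measurable_coordinate])

lemma nn_integral_chain_A:
  assumes w: "w \<in> M" and f: "\<And>n. f n \<in> borel_measurable SS" and g: "g \<in> borel_measurable SS"
  shows "(\<integral>\<^sup>+\<omega>. (\<Prod>m\<le>n. f m (canonical_A w \<omega> m)) * g (canonical_A w \<omega> n) \<partial>PA) = path_integral f w n g"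
  using g
proof (induction n arbitrary: g)
  case 0
  interpret PA: prob_space PA by (intro prob_space_PiM prob_space_driving_law)
  show ?case using PA.emeasure_space_1 by simp
next
  case (Suc n)
  let ?c = "canonical_A w"
  define L where "L = (\<lambda>\<omega>. \<Prod>m\<le>n. f m (?c \<omega> m))"
  define k where "k = (\<lambda>c. f (Suc n) c * g c)"
  have k [measurable]: "k \<in> borel_measurable SS" unfolding k_def using f Suc.prems by measurable
  have c: "(\<lambda>\<omega>. ?c \<omega> m) \<in> PA \<rightarrow>\<^sub>M SS" for m
    using w by (intro measurable_canonical_A measurable_const measurable_ident_sets) auto
  have cm: "?c \<omega> m \<in> space SS" for \<omega> m by (rule chain_A_mem_Suc(1)[OF w])
  have L [measurable]: "L \<in> borel_measurable PA"
    unfolding L_def by (intro borel_measurable_prod_ennreal measurable_compose[OF c f])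
  have indep: "?c \<omega> m = ?c \<omega>' m" if "m \<le> n" "\<And>j r. j \<in> {1..l} \<Longrightarrow> 1 \<le> r \<Longrightarrow> r \<le> n \<Longrightarrow> \<omega> (Inl (j, r)) = \<omega>' (Inl (j, r))"
      "\<And>r. 1 \<le> r \<Longrightarrow> r \<le> n \<Longrightarrow> \<omega> (Inr r) = \<omega>' (Inr r)" for \<omega> \<omega>' m
    using that(1) by (rule chain_A_indep[OF w, rotated -1]) (use that in auto)
  let ?h = "\<lambda>\<omega>. \<lambda>j\<in>{1..l}. \<omega> (Inl (j, Suc n))"
  have h: "?h \<in> PA \<rightarrow>\<^sub>M PE"
    by (intro measurable_into_PE) (auto intro!: measurable_coordinate)
  have step: "?c \<omega> (Suc n) = next_A (?c \<omega> n) (?h \<omega>) (\<omega> (Inr (Suc n)))" for \<omega>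
    unfolding chain_A_mem_Suc(2)[OF w] by (rule next_cong(1)) simp
  define R where "R = (\<lambda>\<omega> h. \<integral>\<^sup>+u. k (next_A (?c \<omega> n) h u) \<partial>unif_law)"
  have u: "(\<lambda>\<omega>. \<omega> (Inr (Suc n))) \<in> borel_measurable PA" by (rule measurable_coordinate) auto
  have ku: "(\<lambda>u. k (next_A c h u)) \<in> borel_measurable unif_law" if "c \<in> space SS" "h \<in> space PE" for c h
    using that by (intro measurable_compose[OF measurable_next_state_PE k]) (auto simp: measurable_cong_sets[OF sets_unif_law refl])
  have Rh: "(\<lambda>h. R \<omega> h) \<in> borel_measurable PE" for \<omega>
    unfolding R_def by (rule measurable_step_inner[OF k]) (auto simp: cm)
  have R\<omega>: "(\<lambda>\<omega>. R \<omega> (?h \<omega>)) \<in> borel_measurable PA"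
    unfolding R_def by (rule measurable_step_inner[OF k c h]) simp
  have "(\<integral>\<^sup>+\<omega>. (\<Prod>m\<le>Suc n. f m (?c \<omega> m)) * g (?c \<omega> (Suc n)) \<partial>PA) = (\<integral>\<^sup>+\<omega>. L \<omega> * k (?c \<omega> (Suc n)) \<partial>PA)"
    by (simp only: prod.atMost_Suc L_def k_def mult.assoc)
  also have "\<dots> = (\<integral>\<^sup>+\<omega>. (\<integral>\<^sup>+u. L \<omega> * k (next_A (?c \<omega> n) (?h \<omega>) u) \<partial>driving_law (Inr (Suc n) :: nat \<times> nat + nat)) \<partial>PA)"
  proof (rule nn_integral_integrate_out_one[where J=JA and \<nu>=driving_law and z="Inr (Suc n)"
        and \<Phi>="\<lambda>\<omega> u. L \<omega> * k (next_A (?c \<omega> n) (?h \<omega>) u)"])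
    show "prob_space (driving_law z)" for z :: "nat \<times> nat + nat" by (rule prob_space_driving_law)
    show "Inr (Suc n) \<in> JA" by auto
    show "(\<lambda>\<omega>. L \<omega> * k (?c \<omega> (Suc n))) \<in> borel_measurable PA"
      using measurable_compose[OF c k] by measurable
    show "L \<omega> * k (?c \<omega> (Suc n)) = L \<omega> * k (next_A (?c \<omega> n) (?h \<omega>) (\<omega> (Inr (Suc n))))" for \<omega>
      unfolding step ..
    fix \<omega> \<omega>' :: "nat \<times> nat + nat \<Rightarrow> real" and u :: real assume agree: "\<And>y. y \<in> JA - {Inr (Suc n)} \<Longrightarrow> \<omega> y = \<omega>' y"
    have y: "\<omega> (Inl (j, r)) = \<omega>' (Inl (j, r))" if "j \<in> {1..l}" "1 \<le> r" for j r
      by (rule agree) (use that in auto)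
    have "\<omega> (Inr r) = \<omega>' (Inr r)" if "1 \<le> r" "r \<le> n" for r
      by (rule agree) (use that in auto)
    note y = y this
    then have "?c \<omega> m = ?c \<omega>' m" if "m \<le> n" for m using that by (intro indep) auto
    moreover have "?h \<omega> = ?h \<omega>'" using y(1) by (intro restrict_ext) auto
    ultimately show "L \<omega> * k (next_A (?c \<omega> n) (?h \<omega>) u) = L \<omega>' * k (next_A (?c \<omega>' n) (?h \<omega>') u)"
      by (simp add: L_def)
  next
    fix \<omega> assume "\<omega> \<in> space PA"
    then have "?h \<omega> \<in> space PE" by (rule measurable_space[OF h])
    from ku[OF cm this]
    show "(\<lambda>u. L \<omega> * k (next_A (?c \<omega> n) (?h \<omega>) u)) \<in> borel_measurable (driving_law (Inr (Suc n) :: nat \<times> nat + nat))"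
      by simp
  qed
  also have "\<dots> = (\<integral>\<^sup>+\<omega>. L \<omega> * R \<omega> (?h \<omega>) \<partial>PA)"
    unfolding R_def sum.case
    by (intro nn_integral_cong nn_integral_cmult ku cm measurable_space[OF h])
  also have "\<dots> = (\<integral>\<^sup>+\<omega>. (\<integral>\<^sup>+h. L \<omega> * R \<omega> h \<partial>PiM {1..l} (\<lambda>i. driving_law (Inl (i, Suc n) :: nat \<times> nat + nat))) \<partial>PA)"
  proof (rule nn_integral_integrate_out[where J=JA and \<nu>=driving_law and I="{1..l}" and f="\<lambda>i. Inl (i, Suc n)"
        and \<Phi>="\<lambda>\<omega> h. L \<omega> * R \<omega> h"])
    show "prob_space (driving_law z)" for z :: "nat \<times> nat + nat" by (rule prob_space_driving_law)
    show "inj_on (\<lambda>i. Inl (i, Suc n)) {1..l}" by (auto simp: inj_on_def)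
    show "(\<lambda>i. Inl (i, Suc n)) ` {1..l} \<subseteq> JA" by auto
    show "(\<lambda>\<omega>. L \<omega> * R \<omega> (?h \<omega>)) \<in> borel_measurable PA" using R\<omega> by measurable
    fix \<omega> \<omega>' :: "nat \<times> nat + nat \<Rightarrow> real" and h :: "nat \<Rightarrow> real" assume agree: "\<And>z. z \<in> JA - (\<lambda>i. Inl (i, Suc n)) ` {1..l} \<Longrightarrow> \<omega> z = \<omega>' z"
    have y: "\<omega> (Inl (j, r)) = \<omega>' (Inl (j, r))" if "j \<in> {1..l}" "1 \<le> r" "r \<le> n" for j r
      by (rule agree) (use that in auto)
    have "\<omega> (Inr r) = \<omega>' (Inr r)" if "1 \<le> r" "r \<le> n" for r
      by (rule agree) (use that in auto)
    note y = y this
    then have "?c \<omega> m = ?c \<omega>' m" if "m \<le> n" for m using that by (intro indep) auto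
    then show "L \<omega> * R \<omega> h = L \<omega>' * R \<omega>' h" by (simp add: L_def R_def)
  qed simp
  also have "\<dots> = (\<integral>\<^sup>+\<omega>. L \<omega> * step_op k (?c \<omega> n) \<partial>PA)"
    unfolding sum.case
  proof (intro nn_integral_cong)
    fix \<omega> show "(\<integral>\<^sup>+h. L \<omega> * R \<omega> h \<partial>PE) = L \<omega> * step_op k (?c \<omega> n)"
      using Rh step_op_A[OF cm k] by (simp add: nn_integral_cmult R_def)
  qed
  also have "\<dots> = path_integral f w n (step_op k)"
    unfolding L_def by (rule Suc.IH[OF measurable_step_op[OF k]])
  finally show ?case by (simp only: path_integral.simps k_def)
qed

lemma clock_renewal:
  assumes c: "c \<in> space SS" and f: "f \<in> borel_measurable SS"
    and g: "(\<lambda>(c, h). g c h) \<in> borel_measurable (SS \<Otimes>\<^sub>M PE)"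
    and g_None: "\<And>c h h'. c \<in> space SS \<Longrightarrow> fst c = None \<Longrightarrow> h \<in> space PE \<Longrightarrow> h' \<in> space PE \<Longrightarrow> g c h = g c h'"
  shows "(\<integral>\<^sup>+h. (\<integral>\<^sup>+e. (\<integral>\<^sup>+u. f (next_B c h u) * g (next_B c h u) (next_clocks c h e) \<partial>unif_law) \<partial>exp_law) \<partial>PE)
       = step_op (\<lambda>c. f c * (\<integral>\<^sup>+K. g c K \<partial>PE)) c"
proof (cases "fst c")
  case None
  let ?c = "(None, \<infinity>, 1) :: 'a option \<times> ennreal \<times> nat"
  have nxt: "next_B c h u = ?c" for h u by (simp add: next_state_def None)
  have mem: "?c \<in> space SS" using next_state_mem[OF c, of "jump_time_B \<phi>"] nxt by simp
  define h0 :: "nat \<Rightarrow> real" where "h0 = (\<lambda>j\<in>{1..l}. 0)"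
  have h0: "h0 \<in> space PE" unfolding h0_def space_PE by (rule restrict_extensional)
  have const: "g ?c h = g ?c h0" if "h \<in> space PE" for h
    by (rule g_None[OF mem _ that h0]) simp
  have K: "(\<integral>\<^sup>+K. g ?c K \<partial>PE) = g ?c h0"
  proof -
    have "(\<integral>\<^sup>+K. g ?c K \<partial>PE) = (\<integral>\<^sup>+K. g ?c h0 \<partial>PE)" by (intro nn_integral_cong const)
    then show ?thesis using PE.emeasure_space_1 by simp
  qed
  show ?thesis
    unfolding step_op_def nxt K const[OF next_clocks_mem]
    using PE.emeasure_space_1 E.emeasure_space_1 V.emeasure_space_1 by simp
next
  case (Some x)
  with c have x: "x \<in> M" by (auto simp: space_SS with_cemetery_iff)
  define s where "s = enn2real (fst (snd c))"
  have s: "0 \<le> s" by (simp add: s_def)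
  define T where "T = (\<lambda>j. jump_time_B \<phi> (rate j) s x)"
  define \<Lambda> where "\<Lambda> = (\<lambda>j t. cumulative_rate \<phi> (rate j) s t x)"
  define S where "S = (\<lambda>h. first_time l (\<lambda>j. T j (h j)))"
  define \<iota> where "\<iota> = (\<lambda>h. first_index l (\<lambda>j. T j (h j)))"
  define \<Psi> where "\<Psi> = (\<lambda>t i K. \<integral>\<^sup>+u. f (jump_state s x t i u) * g (jump_state s x t i u) K \<partial>unif_law)"
  have nxt: "next_B c h u = jump_state s x (S h) (\<iota> h) u" for h u
    unfolding next_state_def Some option.case Let_def s_def[symmetric] S_def \<iota>_def T_def ..
  have clocks: "next_clocks c h e = (\<lambda>j\<in>{1..l}. if j = \<iota> h then e else h j - \<Lambda> j (enn2real (S h)))" for h e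
    unfolding next_clocks_def next_index_def Some option.case Let_def s_def[symmetric] S_def \<iota>_def T_def \<Lambda>_def ..
  have js: "(\<lambda>\<omega>. jump_state s x (t \<omega>) (i \<omega>) (u \<omega>)) \<in> N \<rightarrow>\<^sub>M SS"
    if "t \<in> borel_measurable N" "i \<in> N \<rightarrow>\<^sub>M count_space {1..l}" "u \<in> borel_measurable N"
    for t i u and N :: "'z measure"
    using s x that by (intro measurable_jump_state) auto
  have fg: "(\<lambda>\<omega>. f (jump_state s x (t \<omega>) (i \<omega>) (u \<omega>)) * g (jump_state s x (t \<omega>) (i \<omega>) (u \<omega>)) (K \<omega>)) \<in> borel_measurable N"
    if "t \<in> borel_measurable N" "i \<in> N \<rightarrow>\<^sub>M count_space {1..l}" "u \<in> borel_measurable N" "K \<in> N \<rightarrow>\<^sub>M PE"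
    for t i u K and N :: "'z measure"
  proof -
    have "(\<lambda>\<omega>. (jump_state s x (t \<omega>) (i \<omega>) (u \<omega>), K \<omega>)) \<in> N \<rightarrow>\<^sub>M SS \<Otimes>\<^sub>M PE"
      using js[OF that(1-3)] that(4) by (rule measurable_Pair)
    from measurable_compose[OF this g] measurable_compose[OF js[OF that(1-3)] f]
    show ?thesis by simp
  qed
  have \<Psi>_meas: "(\<lambda>(t, i, K). \<Psi> t i K) \<in> borel_measurable (borel \<Otimes>\<^sub>M count_space {1..l} \<Otimes>\<^sub>M PE)"
    unfolding \<Psi>_def split_beta
  proof (rule V.borel_measurable_nn_integral, unfold split_beta, rule fg)
    let ?N = "(borel \<Otimes>\<^sub>M count_space {1..l} \<Otimes>\<^sub>M PE) \<Otimes>\<^sub>M unif_law"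
    show "(\<lambda>p. fst (fst p)) \<in> borel_measurable ?N" by measurable
    show "(\<lambda>p. fst (snd (fst p))) \<in> ?N \<rightarrow>\<^sub>M count_space {1..l}" by measurable
    show "(\<lambda>p. snd (snd (fst p))) \<in> ?N \<rightarrow>\<^sub>M PE" by measurable
    show "snd \<in> borel_measurable ?N" by measurable
  qed
  have "(\<integral>\<^sup>+h. (\<integral>\<^sup>+e. \<Psi> (S h) (\<iota> h) (\<lambda>j\<in>{1..l}. if j = \<iota> h then e else h j - \<Lambda> j (enn2real (S h))) \<partial>exp_law) \<partial>PE)
       = (\<integral>\<^sup>+h. (\<integral>\<^sup>+K. \<Psi> (S h) (\<iota> h) K \<partial>PE) \<partial>PE)"
    unfolding S_def \<iota>_def
  proof (rule competing_clocks[OF l s])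
    fix j assume j: "j \<in> {1..l}"
    show "T j \<in> borel_measurable borel"
      unfolding T_def
      by (rule measurable_jump_time_B[OF j, where s="\<lambda>_. s" and h="\<lambda>h. h" and x="\<lambda>_. x"])
         (auto simp: s x intro!: measurable_const)
    show "\<Lambda> j \<in> borel_measurable borel"
      unfolding \<Lambda>_def
      by (rule measurable_cumulative_rate[OF j, where s="\<lambda>_. s" and t="\<lambda>h. h" and x="\<lambda>_. x"])
         (auto simp: s x intro!: measurable_const)
    show "0 \<le> \<Lambda> j t" if "s \<le> t" for t
      unfolding \<Lambda>_def by (rule cumulative_rate_nonneg[OF j s x that])
    show "ennreal s \<le> T j h" for h
      unfolding T_def by (rule jump_time_B_ge[OF j s x])
    show "ennreal t < T j h" if "s \<le> t" "\<Lambda> j t < h" for t h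
      using that unfolding T_def \<Lambda>_def by (rule jump_time_B_gt[OF j s x])
    show "T j h < ennreal t" if "s \<le> t" "0 < h" "h < \<Lambda> j t" for t h
      using that unfolding T_def \<Lambda>_def by (intro jump_time_B_lt[OF j s x]) auto
  next
    show "(\<lambda>(t, i, K). \<Psi> t i K) \<in> borel_measurable (borel \<Otimes>\<^sub>M count_space {1..l} \<Otimes>\<^sub>M PE)" by (rule \<Psi>_meas)
    fix i K K' assume i: "i \<in> {1..l}" and K: "K \<in> space PE" "K' \<in> space PE"
    have "jump_state s x \<infinity> i u \<in> space SS" "fst (jump_state s x \<infinity> i u) = None" for u
      using l by (simp_all add: jump_state_def space_SS with_cemetery_def)
    from g_None[OF this K] show "\<Psi> \<infinity> i K = \<Psi> \<infinity> i K'"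
      unfolding \<Psi>_def by simp
  qed
  also have "\<dots> = (\<integral>\<^sup>+h. (\<integral>\<^sup>+u. f (next_B c h u) * (\<integral>\<^sup>+K. g (next_B c h u) K \<partial>PE) \<partial>unif_law) \<partial>PE)"
  proof (intro nn_integral_cong)
    fix h
    interpret pair_sigma_finite unif_law PE ..
    have \<iota>: "\<iota> h \<in> {1..l}" unfolding \<iota>_def by (rule first_index_mem(1)[OF l])
    have m: "(\<lambda>p. f (jump_state s x (S h) (\<iota> h) (fst p)) * g (jump_state s x (S h) (\<iota> h) (fst p)) (snd p)) \<in> borel_measurable (unif_law \<Otimes>\<^sub>M PE)"
      using \<iota> by (intro fg) auto
    have "(\<integral>\<^sup>+K. \<Psi> (S h) (\<iota> h) K \<partial>PE)
        = (\<integral>\<^sup>+u. (\<integral>\<^sup>+K. f (jump_state s x (S h) (\<iota> h) u) * g (jump_state s x (S h) (\<iota> h) u) K \<partial>PE) \<partial>unif_law)"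
      unfolding \<Psi>_def using Fubini'[of "\<lambda>u K. f (jump_state s x (S h) (\<iota> h) u) * g (jump_state s x (S h) (\<iota> h) u) K"] m
      by (simp add: split_beta)
    also have "\<dots> = (\<integral>\<^sup>+u. f (next_B c h u) * (\<integral>\<^sup>+K. g (next_B c h u) K \<partial>PE) \<partial>unif_law)"
    proof (intro nn_integral_cong)
      fix u
      have "(\<lambda>K. g (next_B c h u) K) \<in> borel_measurable PE"
        using measurable_compose[OF measurable_Pair1'[OF next_state_mem[OF c]] g, of "jump_time_B \<phi>" h u] by simp
      then show "(\<integral>\<^sup>+K. f (jump_state s x (S h) (\<iota> h) u) * g (jump_state s x (S h) (\<iota> h) u) K \<partial>PE)
          = f (next_B c h u) * (\<integral>\<^sup>+K. g (next_B c h u) K \<partial>PE)"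
        unfolding nxt by (rule nn_integral_cmult)
    qed
    finally show "(\<integral>\<^sup>+K. \<Psi> (S h) (\<iota> h) K \<partial>PE) = (\<integral>\<^sup>+u. f (next_B c h u) * (\<integral>\<^sup>+K. g (next_B c h u) K \<partial>PE) \<partial>unif_law)" .
  qed
  finally show ?thesis
    unfolding step_op_def clocks by (simp only: nxt \<Psi>_def)
qed

abbreviation canonical_B :: "'a \<Rightarrow> (nat \<times> nat + nat \<times> nat \<Rightarrow> real) \<Rightarrow> nat \<Rightarrow> _" where
  "canonical_B w \<omega> \<equiv> stateB w (\<lambda>j k. \<omega> (Inl (j, k))) (\<lambda>j k. \<omega> (Inr (j, k)))"

lemma stateB_clocks_mem: "fst (snd (stateB w e u k)) \<in> space PE"
proof (cases k)
  case 0
  then show ?thesis unfolding space_PE by (simp only: stateB.simps fst_conv snd_conv restrict_extensional)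
next
  case (Suc n)
  then show ?thesis using next_clocks_mem by (simp only: stateB.simps Let_def split_beta fst_conv snd_conv)
qed

lemma measurable_canonical_B:
  assumes "W \<in> N \<rightarrow>\<^sub>M manifold_borel M" "\<omega> \<in> N \<rightarrow>\<^sub>M PB"
  shows "(\<lambda>x. fst (canonical_B (W x) (\<omega> x) n)) \<in> N \<rightarrow>\<^sub>M SS"
    and "(\<lambda>x. fst (snd (canonical_B (W x) (\<omega> x) n))) \<in> N \<rightarrow>\<^sub>M PE"
    and "j \<in> {1..l} \<Longrightarrow> (\<lambda>x. snd (snd (canonical_B (W x) (\<omega> x) n)) j) \<in> N \<rightarrow>\<^sub>M count_space {1..}"
proof -
  have z: "(\<lambda>x. \<omega> x z) \<in> borel_measurable N" if "z \<in> JB" for z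
    by (rule measurable_compose[OF assms(2) measurable_coordinate[OF that]])
  have *: "(\<lambda>x. fst (canonical_B (W x) (\<omega> x) n)) \<in> N \<rightarrow>\<^sub>M SS \<and>
    (\<forall>j\<in>{1..l}. (\<lambda>x. fst (snd (canonical_B (W x) (\<omega> x) n)) j) \<in> borel_measurable N) \<and>
    (\<forall>j\<in>{1..l}. (\<lambda>x. snd (snd (canonical_B (W x) (\<omega> x) n)) j) \<in> N \<rightarrow>\<^sub>M count_space {1..})"
    by (rule measurable_stateB[OF assms(1)]) (auto intro!: z)
  then show "(\<lambda>x. fst (canonical_B (W x) (\<omega> x) n)) \<in> N \<rightarrow>\<^sub>M SS"
    and "j \<in> {1..l} \<Longrightarrow> (\<lambda>x. snd (snd (canonical_B (W x) (\<omega> x) n)) j) \<in> N \<rightarrow>\<^sub>M count_space {1..}"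
    by blast+
  show "(\<lambda>x. fst (snd (canonical_B (W x) (\<omega> x) n))) \<in> N \<rightarrow>\<^sub>M PE"
    using * stateB_clocks_mem unfolding space_PE by (intro measurable_into_PE) blast+
qed

lemma nn_integral_chain_B:
  assumes w: "w \<in> M" and f: "\<And>n. f n \<in> borel_measurable SS"
    and g: "(\<lambda>(c, h). g c h) \<in> borel_measurable (SS \<Otimes>\<^sub>M PE)"
    and g_None: "\<And>c h h'. c \<in> space SS \<Longrightarrow> fst c = None \<Longrightarrow> h \<in> space PE \<Longrightarrow> h' \<in> space PE \<Longrightarrow> g c h = g c h'"
  shows "(\<integral>\<^sup>+\<omega>. (\<Prod>m\<le>n. f m (fst (canonical_B w \<omega> m))) * g (fst (canonical_B w \<omega> n)) (fst (snd (canonical_B w \<omega> n))) \<partial>PB)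
       = path_integral f w n (\<lambda>c. \<integral>\<^sup>+K. g c K \<partial>PE)"
  using g g_None
proof (induction n arbitrary: g)
  case 0
  let ?c = "(Some w, 0, 1) :: 'a option \<times> ennreal \<times> nat"
  interpret PB: prob_space PB by (intro prob_space_PiM prob_space_driving_law)
  have c: "?c \<in> space SS" using w l by (simp add: space_SS with_cemetery_def)
  have single: "(\<Prod>m\<in>{0}. X m) = X 0" for X :: "nat \<Rightarrow> ennreal" by simp
  have f0g: "(\<lambda>h. g ?c h) \<in> borel_measurable PE"
    using measurable_compose[OF measurable_Pair1'[OF c] 0(1)] by simp
  have h: "(\<lambda>\<omega>. \<lambda>j\<in>{1..l}. \<omega> (Inl (j, 1))) \<in> PB \<rightarrow>\<^sub>M PE"
    by (intro measurable_into_PE) (auto intro!: measurable_coordinate)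
  have "(\<integral>\<^sup>+\<omega>. f 0 ?c * g ?c (\<lambda>j\<in>{1..l}. \<omega> (Inl (j, 1))) \<partial>PB)
      = (\<integral>\<^sup>+\<omega>. (\<integral>\<^sup>+h. f 0 ?c * g ?c h \<partial>PiM {1..l} (\<lambda>i. driving_law (Inl (i, 1) :: nat \<times> nat + nat \<times> nat))) \<partial>PB)"
  proof (rule nn_integral_integrate_out[where J=JB and \<nu>=driving_law and I="{1..l}" and f="\<lambda>i. Inl (i, 1)"
        and \<Phi>="\<lambda>\<omega> h. f 0 ?c * g ?c h"])
    show "prob_space (driving_law z)" for z :: "nat \<times> nat + nat \<times> nat" by (rule prob_space_driving_law)
    show "inj_on (\<lambda>i. Inl (i, 1)) {1..l}" by (auto simp: inj_on_def)
    show "(\<lambda>i. Inl (i, 1)) ` {1..l} \<subseteq> JB" by auto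
    show "(\<lambda>\<omega>. f 0 ?c * g ?c (\<lambda>j\<in>{1..l}. \<omega> (Inl (j, 1)))) \<in> borel_measurable PB"
      using measurable_compose[OF h f0g] by measurable
  qed auto
  also have "\<dots> = f 0 ?c * (\<integral>\<^sup>+K. g ?c K \<partial>PE)"
    using f0g PB.emeasure_space_1 by (simp add: nn_integral_cmult)
  finally show ?case
    by (simp only: stateB.simps path_integral.simps fst_conv snd_conv atMost_0 single)
next
  case (Suc n)
  define B where "B = (\<lambda>\<omega>. canonical_B w \<omega>)"
  define c where "c = (\<lambda>\<omega> m. fst (B \<omega> m))"
  define H where "H = (\<lambda>\<omega>. fst (snd (B \<omega> n)))"
  define C where "C = (\<lambda>\<omega>. snd (snd (B \<omega> n)))"
  define L where "L = (\<lambda>\<omega>. \<Prod>m\<le>n. f m (c \<omega> m))"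
  define \<Theta>' where "\<Theta>' = (\<lambda>c h e u. f (Suc n) (next_B c h u) * g (next_B c h u) (next_clocks c h e))"
  define \<Theta> where "\<Theta> = (\<lambda>c h. \<integral>\<^sup>+e. (\<integral>\<^sup>+u. \<Theta>' c h e u \<partial>unif_law) \<partial>exp_law)"
  define ix where "ix = (\<lambda>\<omega>. next_index (c \<omega> n) (H \<omega>))"
  define ev where "ev = (\<lambda>i m \<omega>. ix \<omega> = i \<and> C \<omega> i = m)"
  have id: "(\<lambda>\<omega>. \<omega>) \<in> PB \<rightarrow>\<^sub>M PB" by simp
  have W: "(\<lambda>_. w) \<in> PB \<rightarrow>\<^sub>M manifold_borel M" using w by simp
  have cm: "(\<lambda>\<omega>. c \<omega> m) \<in> PB \<rightarrow>\<^sub>M SS" for m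
    unfolding c_def B_def by (rule measurable_canonical_B(1)[OF W id])
  have Hm: "H \<in> PB \<rightarrow>\<^sub>M PE"
    unfolding H_def B_def by (rule measurable_canonical_B(2)[OF W id])
  have Cm: "(\<lambda>\<omega>. C \<omega> i) \<in> PB \<rightarrow>\<^sub>M count_space {1..}" if "i \<in> {1..l}" for i
    unfolding C_def B_def by (rule measurable_canonical_B(3)[OF W id that])
  have ixm: "ix \<in> PB \<rightarrow>\<^sub>M count_space {1..l}"
    unfolding ix_def by (rule measurable_next_index[OF cm measurable_PE_component[OF Hm]])
  have c_in: "c \<omega> m \<in> space SS" for \<omega> m unfolding c_def B_def by (rule stateB_mem[OF w])
  have H_in: "H \<omega> \<in> space PE" for \<omega> unfolding H_def B_def by (rule stateB_clocks_mem)
  have ix_in: "ix \<omega> \<in> {1..l}" for \<omega> unfolding ix_def by (rule next_index_mem)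
  have C_le: "C \<omega> i \<in> {..Suc n}" for \<omega> i unfolding C_def B_def using stateB_counter_le by simp
  have Lm [measurable]: "L \<in> borel_measurable PB"
    unfolding L_def by (intro borel_measurable_prod_ennreal measurable_compose[OF cm f])
  have evm: "{\<omega> \<in> space PB. ev i m \<omega>} \<in> sets PB" if "i \<in> {1..l}" for i m
  proof -
    have "{\<omega> \<in> space PB. ix \<omega> = i} \<in> sets PB"
      using measurable_sets[OF ixm, of "{i}"] that by (simp add: vimage_def Int_def conj_commute)
    moreover have "{\<omega> \<in> space PB. C \<omega> i = m} \<in> sets PB"
    proof (cases "1 \<le> m")
      case True
      then show ?thesis
        using measurable_sets[OF Cm[OF that], of "{m}"] by (simp add: vimage_def Int_def conj_commute)
    next
      case False
      then have "{\<omega> \<in> space PB. C \<omega> i = m} = {}"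
        using stateB_counter_ge unfolding C_def B_def by auto
      then show ?thesis by (simp only: sets.empty_sets)
    qed
    ultimately show ?thesis unfolding ev_def by (intro sets.sets_Collect_conj)
  qed
  have if_ev: "(\<lambda>\<omega>. if ev i m \<omega> then L \<omega> * X \<omega> else 0) \<in> borel_measurable PB"
    if "i \<in> {1..l}" "X \<in> borel_measurable PB" for i m X
    by (rule measurable_If[OF borel_measurable_times_ennreal[OF Lm that(2)] measurable_const evm[OF that(1)]]) simp
  have \<Theta>'m: "(\<lambda>x. \<Theta>' (c x) (h x) (e x) (u x)) \<in> borel_measurable N"
    if "c \<in> N \<rightarrow>\<^sub>M SS" "h \<in> N \<rightarrow>\<^sub>M PE" "e \<in> borel_measurable N" "u \<in> borel_measurable N"
    for c h e u and N :: "'z measure"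
  proof -
    have n: "(\<lambda>x. next_B (c x) (h x) (u x)) \<in> N \<rightarrow>\<^sub>M SS"
      by (rule measurable_next_state_PE[OF that(1,2,4)]) simp
    have "(\<lambda>x. (next_B (c x) (h x) (u x), next_clocks (c x) (h x) (e x))) \<in> N \<rightarrow>\<^sub>M SS \<Otimes>\<^sub>M PE"
      using n measurable_next_clocks_PE[OF that(1-3)] by (rule measurable_Pair)
    from measurable_compose[OF this Suc.prems(1)] measurable_compose[OF n f[of "Suc n"]]
    show ?thesis unfolding \<Theta>'_def by simp
  qed
  have \<Theta>1m: "(\<lambda>x. \<integral>\<^sup>+u. \<Theta>' (c x) (h x) (e x) u \<partial>unif_law) \<in> borel_measurable N"
    if "c \<in> N \<rightarrow>\<^sub>M SS" "h \<in> N \<rightarrow>\<^sub>M PE" "e \<in> borel_measurable N" for c h e and N :: "'z measure"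
  proof (rule V.borel_measurable_nn_integral, unfold split_beta, rule \<Theta>'m)
    show "(\<lambda>p. c (fst p)) \<in> N \<Otimes>\<^sub>M unif_law \<rightarrow>\<^sub>M SS" by (rule measurable_compose[OF measurable_fst that(1)])
    show "(\<lambda>p. h (fst p)) \<in> N \<Otimes>\<^sub>M unif_law \<rightarrow>\<^sub>M PE" by (rule measurable_compose[OF measurable_fst that(2)])
    show "(\<lambda>p. e (fst p)) \<in> borel_measurable (N \<Otimes>\<^sub>M unif_law)" by (rule measurable_compose[OF measurable_fst that(3)])
  qed measurable
  have \<Theta>m: "(\<lambda>(c, h). \<Theta> c h) \<in> borel_measurable (SS \<Otimes>\<^sub>M PE)"
    unfolding \<Theta>_def split_beta
  proof (rule E.borel_measurable_nn_integral, unfold split_beta, rule \<Theta>1m)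
    show "(\<lambda>p. fst (fst p)) \<in> (SS \<Otimes>\<^sub>M PE) \<Otimes>\<^sub>M exp_law \<rightarrow>\<^sub>M SS" by measurable
    show "(\<lambda>p. snd (fst p)) \<in> (SS \<Otimes>\<^sub>M PE) \<Otimes>\<^sub>M exp_law \<rightarrow>\<^sub>M PE" by measurable
  qed measurable
  have step: "fst (B \<omega> (Suc n)) = next_B (c \<omega> n) (H \<omega>) (\<omega> (Inr (ix \<omega>, C \<omega> (ix \<omega>) + 1)))"
    "fst (snd (B \<omega> (Suc n))) = next_clocks (c \<omega> n) (H \<omega>) (\<omega> (Inl (ix \<omega>, C \<omega> (ix \<omega>) + 1)))" for \<omega>
    unfolding B_def c_def H_def C_def ix_def by (simp_all add: Let_def split_beta)
  define F where "F = (\<lambda>i m \<omega>. if ev i m \<omega> then L \<omega> * \<Theta>' (c \<omega> n) (H \<omega>) (\<omega> (Inl (i, m + 1))) (\<omega> (Inr (i, m + 1))) else 0)"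
  have split: "X (ix \<omega>) (C \<omega> (ix \<omega>)) = (\<Sum>i\<in>{1..l}. \<Sum>m\<in>{..Suc n}. if ev i m \<omega> then X i m else 0)" for X :: "nat \<Rightarrow> nat \<Rightarrow> ennreal" and \<omega>
  proof -
    have "(\<Sum>m\<in>{..Suc n}. if ev i m \<omega> then X i m else 0) = (if ix \<omega> = i then X i (C \<omega> i) else 0)" for i
      using C_le[of \<omega> i] by (auto simp: ev_def)
    then show ?thesis using ix_in[of \<omega>] by simp
  qed
  have Fm: "F i m \<in> borel_measurable PB" if i: "i \<in> {1..l}" for i m
  proof -
    have "(\<lambda>\<omega>. \<Theta>' (c \<omega> n) (H \<omega>) (\<omega> (Inl (i, m + 1))) (\<omega> (Inr (i, m + 1)))) \<in> borel_measurable PB"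
      using i by (intro \<Theta>'m cm Hm measurable_coordinate) auto
    then show ?thesis unfolding F_def by (rule if_ev[OF i])
  qed
  have indep: "(ev i m \<omega> \<longleftrightarrow> ev i m \<omega>') \<and> (ev i m \<omega> \<longrightarrow> L \<omega> = L \<omega>' \<and> c \<omega> n = c \<omega>' n \<and> H \<omega> = H \<omega>')"
    if agree: "\<And>z. z \<in> JB \<Longrightarrow> z \<noteq> Inl (i, m + 1) \<Longrightarrow> z \<noteq> Inr (i, m + 1) \<Longrightarrow> \<omega> z = \<omega>' z"
    for i m \<omega> \<omega>'
  proof -
    have *: "B x k = B y k" if "C x i = m" "k \<le> n"
      and xy: "\<And>z. z \<in> JB \<Longrightarrow> z \<noteq> Inl (i, m + 1) \<Longrightarrow> z \<noteq> Inr (i, m + 1) \<Longrightarrow> x z = y z" for x y k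
      unfolding B_def
    proof (rule stateB_indep[OF _ \<open>k \<le> n\<close>])
      fix j r assume j: "j \<in> {1..l}" and r: "1 \<le> r" "r \<le> snd (snd (canonical_B w x n)) j"
      then have "(j, r) \<noteq> (i, m + 1)" using \<open>C x i = m\<close> by (auto simp: C_def B_def)
      with j r(1) show "x (Inl (j, r)) = y (Inl (j, r)) \<and> x (Inr (j, r)) = y (Inr (j, r))"
        by (intro conjI xy) auto
    qed
    have 1: "ev i m \<omega>' \<and> L \<omega> = L \<omega>' \<and> c \<omega> n = c \<omega>' n \<and> H \<omega> = H \<omega>'" if "ev i m \<omega>"
    proof -
      have "B \<omega> k = B \<omega>' k" if "k \<le> n" for k
        using *[of \<omega> k \<omega>'] \<open>ev i m \<omega>\<close> that agree by (auto simp: ev_def)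
      then show ?thesis using that by (simp add: L_def c_def H_def ev_def ix_def C_def)
    qed
    have "ev i m \<omega>" if "ev i m \<omega>'"
    proof -
      have "B \<omega>' k = B \<omega> k" if "k \<le> n" for k
        using *[of \<omega>' k \<omega>] \<open>ev i m \<omega>'\<close> that agree by (auto simp: ev_def)
      then show ?thesis using that by (simp add: c_def H_def ev_def ix_def C_def)
    qed
    with 1 show ?thesis by blast
  qed
  have one: "(\<integral>\<^sup>+\<omega>. F i m \<omega> \<partial>PB) = (\<integral>\<^sup>+\<omega>. (if ev i m \<omega> then L \<omega> * \<Theta> (c \<omega> n) (H \<omega>) else 0) \<partial>PB)"
    if i: "i \<in> {1..l}" for i m
  proof -
    let ?R = "\<lambda>\<omega> e. \<integral>\<^sup>+u. \<Theta>' (c \<omega> n) (H \<omega>) e u \<partial>unif_law"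
    have u: "(\<lambda>u. \<Theta>' (c \<omega> n) (H \<omega>) e u) \<in> borel_measurable unif_law" for \<omega> e
      using c_in H_in by (intro \<Theta>'m) (auto simp: measurable_cong_sets[OF sets_unif_law refl])
    have e: "?R \<omega> \<in> borel_measurable exp_law" for \<omega>
      using c_in H_in by (intro \<Theta>1m) (auto simp: measurable_cong_sets[OF sets_exp_law refl])
    have "(\<integral>\<^sup>+\<omega>. F i m \<omega> \<partial>PB) = (\<integral>\<^sup>+\<omega>. (\<integral>\<^sup>+u. (if ev i m \<omega> then L \<omega> * \<Theta>' (c \<omega> n) (H \<omega>) (\<omega> (Inl (i, m + 1))) u else 0)
         \<partial>driving_law (Inr (i, m + 1) :: nat \<times> nat + nat \<times> nat)) \<partial>PB)"
    proof (rule nn_integral_integrate_out_one[where J=JB and \<nu>=driving_law and z="Inr (i, m + 1)"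
        and \<Phi>="\<lambda>\<omega> u. if ev i m \<omega> then L \<omega> * \<Theta>' (c \<omega> n) (H \<omega>) (\<omega> (Inl (i, m + 1))) u else 0"])
      show "prob_space (driving_law z)" for z :: "nat \<times> nat + nat \<times> nat" by (rule prob_space_driving_law)
      show "Inr (i, m + 1) \<in> JB" using i by auto
      show "F i m \<in> borel_measurable PB" by (rule Fm[OF i])
      show "F i m \<omega> = (if ev i m \<omega> then L \<omega> * \<Theta>' (c \<omega> n) (H \<omega>) (\<omega> (Inl (i, m + 1))) (\<omega> (Inr (i, m + 1))) else 0)" for \<omega>
        unfolding F_def ..
      fix \<omega> \<omega>' :: "nat \<times> nat + nat \<times> nat \<Rightarrow> real" and u :: real
      assume agree: "\<And>y. y \<in> JB - {Inr (i, m + 1)} \<Longrightarrow> \<omega> y = \<omega>' y"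
      have "\<omega> (Inl (i, m + 1)) = \<omega>' (Inl (i, m + 1))" by (rule agree) (use i in auto)
      moreover have "(ev i m \<omega> \<longleftrightarrow> ev i m \<omega>') \<and> (ev i m \<omega> \<longrightarrow> L \<omega> = L \<omega>' \<and> c \<omega> n = c \<omega>' n \<and> H \<omega> = H \<omega>')"
        by (rule indep) (rule agree, simp)
      ultimately show "(if ev i m \<omega> then L \<omega> * \<Theta>' (c \<omega> n) (H \<omega>) (\<omega> (Inl (i, m + 1))) u else 0)
          = (if ev i m \<omega>' then L \<omega>' * \<Theta>' (c \<omega>' n) (H \<omega>') (\<omega>' (Inl (i, m + 1))) u else 0)" by auto
    next
      fix \<omega>
      show "(\<lambda>u. if ev i m \<omega> then L \<omega> * \<Theta>' (c \<omega> n) (H \<omega>) (\<omega> (Inl (i, m + 1))) u else 0)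
          \<in> borel_measurable (driving_law (Inr (i, m + 1) :: nat \<times> nat + nat \<times> nat))"
        using u by simp
    qed
    also have "\<dots> = (\<integral>\<^sup>+\<omega>. (if ev i m \<omega> then L \<omega> * ?R \<omega> (\<omega> (Inl (i, m + 1))) else 0) \<partial>PB)"
      using u by (intro nn_integral_cong) (simp add: nn_integral_cmult)
    also have "\<dots> = (\<integral>\<^sup>+\<omega>. (\<integral>\<^sup>+e. (if ev i m \<omega> then L \<omega> * ?R \<omega> e else 0)
         \<partial>driving_law (Inl (i, m + 1) :: nat \<times> nat + nat \<times> nat)) \<partial>PB)"
    proof (rule nn_integral_integrate_out_one[where J=JB and \<nu>=driving_law and z="Inl (i, m + 1)"
        and \<Phi>="\<lambda>\<omega> e. if ev i m \<omega> then L \<omega> * ?R \<omega> e else 0"])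
      show "prob_space (driving_law z)" for z :: "nat \<times> nat + nat \<times> nat" by (rule prob_space_driving_law)
      show "Inl (i, m + 1) \<in> JB" using i by auto
      have "(\<lambda>\<omega>. ?R \<omega> (\<omega> (Inl (i, m + 1)))) \<in> borel_measurable PB"
        using i by (intro \<Theta>1m cm Hm measurable_coordinate) auto
      then show "(\<lambda>\<omega>. if ev i m \<omega> then L \<omega> * ?R \<omega> (\<omega> (Inl (i, m + 1))) else 0) \<in> borel_measurable PB"
        by (rule if_ev[OF i])
      fix \<omega> \<omega>' :: "nat \<times> nat + nat \<times> nat \<Rightarrow> real" and e :: real
      assume agree: "\<And>y. y \<in> JB - {Inl (i, m + 1)} \<Longrightarrow> \<omega> y = \<omega>' y"
      have "(ev i m \<omega> \<longleftrightarrow> ev i m \<omega>') \<and> (ev i m \<omega> \<longrightarrow> L \<omega> = L \<omega>' \<and> c \<omega> n = c \<omega>' n \<and> H \<omega> = H \<omega>')"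
        by (rule indep) (rule agree, simp)
      then show "(if ev i m \<omega> then L \<omega> * ?R \<omega> e else 0) = (if ev i m \<omega>' then L \<omega>' * ?R \<omega>' e else 0)" by auto
    next
      fix \<omega>
      show "(\<lambda>e. if ev i m \<omega> then L \<omega> * ?R \<omega> e else 0)
          \<in> borel_measurable (driving_law (Inl (i, m + 1) :: nat \<times> nat + nat \<times> nat))"
        using e by simp
    qed simp
    also have "\<dots> = (\<integral>\<^sup>+\<omega>. (if ev i m \<omega> then L \<omega> * \<Theta> (c \<omega> n) (H \<omega>) else 0) \<partial>PB)"
      using e unfolding \<Theta>_def by (intro nn_integral_cong) (simp add: nn_integral_cmult)
    finally show ?thesis .
  qed
  have \<Theta>cH: "(\<lambda>\<omega>. \<Theta> (c \<omega> n) (H \<omega>)) \<in> borel_measurable PB"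
    using measurable_compose[OF measurable_Pair[OF cm Hm] \<Theta>m] by simp
  have "(\<integral>\<^sup>+\<omega>. (\<Prod>m\<le>Suc n. f m (fst (canonical_B w \<omega> m))) * g (fst (canonical_B w \<omega> (Suc n))) (fst (snd (canonical_B w \<omega> (Suc n)))) \<partial>PB)
      = (\<integral>\<^sup>+\<omega>. (\<Sum>i\<in>{1..l}. \<Sum>m\<in>{..Suc n}. F i m \<omega>) \<partial>PB)"
  proof (intro nn_integral_cong)
    fix \<omega>
    have "(\<Prod>m\<le>Suc n. f m (fst (B \<omega> m))) * g (fst (B \<omega> (Suc n))) (fst (snd (B \<omega> (Suc n))))
        = L \<omega> * \<Theta>' (c \<omega> n) (H \<omega>) (\<omega> (Inl (ix \<omega>, C \<omega> (ix \<omega>) + 1))) (\<omega> (Inr (ix \<omega>, C \<omega> (ix \<omega>) + 1)))"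
      unfolding prod.atMost_Suc step by (simp only: L_def c_def \<Theta>'_def mult.assoc)
    also have "\<dots> = (\<Sum>i\<in>{1..l}. \<Sum>m\<in>{..Suc n}. F i m \<omega>)"
      unfolding F_def by (rule split)
    finally show "(\<Prod>m\<le>Suc n. f m (fst (canonical_B w \<omega> m))) * g (fst (canonical_B w \<omega> (Suc n))) (fst (snd (canonical_B w \<omega> (Suc n))))
        = (\<Sum>i\<in>{1..l}. \<Sum>m\<in>{..Suc n}. F i m \<omega>)" unfolding B_def .
  qed
  also have "\<dots> = (\<Sum>i\<in>{1..l}. \<Sum>m\<in>{..Suc n}. \<integral>\<^sup>+\<omega>. F i m \<omega> \<partial>PB)"
    by (subst nn_integral_sum, intro borel_measurable_sum Fm, assumption)
       (intro sum.cong refl nn_integral_sum Fm)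
  also have "\<dots> = (\<Sum>i\<in>{1..l}. \<Sum>m\<in>{..Suc n}. \<integral>\<^sup>+\<omega>. (if ev i m \<omega> then L \<omega> * \<Theta> (c \<omega> n) (H \<omega>) else 0) \<partial>PB)"
    by (intro sum.cong refl one)
  also have "\<dots> = (\<integral>\<^sup>+\<omega>. (\<Sum>i\<in>{1..l}. \<Sum>m\<in>{..Suc n}. if ev i m \<omega> then L \<omega> * \<Theta> (c \<omega> n) (H \<omega>) else 0) \<partial>PB)"
    by (subst nn_integral_sum, intro borel_measurable_sum if_ev \<Theta>cH, assumption)
       (intro sum.cong refl nn_integral_sum[symmetric] if_ev \<Theta>cH)
  also have "\<dots> = (\<integral>\<^sup>+\<omega>. L \<omega> * \<Theta> (c \<omega> n) (H \<omega>) \<partial>PB)"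
    by (intro nn_integral_cong split[symmetric])
  also have "\<dots> = path_integral f w n (\<lambda>c. \<integral>\<^sup>+K. \<Theta> c K \<partial>PE)"
    unfolding L_def c_def H_def B_def
  proof (rule Suc.IH[OF \<Theta>m])
    fix c :: "'a option \<times> ennreal \<times> nat" and h h' assume c: "c \<in> space SS" "fst c = None"
    have "next_B c h u = (None, \<infinity>, 1)" for h u using c(2) by (simp add: next_state_def)
    moreover have "(None, \<infinity>, 1) \<in> space SS" using l by (simp add: space_SS with_cemetery_def)
    ultimately show "\<Theta> c h = \<Theta> c h'"
      unfolding \<Theta>_def \<Theta>'_def using Suc.prems(2)[OF _ _ next_clocks_mem next_clocks_mem]
      by (intro nn_integral_cong) (metis fst_conv)
  qed
  also have "\<dots> = path_integral f w (Suc n) (\<lambda>c. \<integral>\<^sup>+K. g c K \<partial>PE)"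
    unfolding path_integral.simps \<Theta>_def \<Theta>'_def
    by (intro path_integral_cong[OF w] clock_renewal f Suc.prems)
  finally show ?case .
qed

end

lemma prod_indicator:
  fixes n :: nat
  shows "(\<Prod>m\<le>n. indicator (B m) (z m) :: ennreal) = (if \<forall>m\<le>n. z m \<in> B m then 1 else 0)"
  by (induction n) (auto simp: le_Suc_eq indicator_def)

lemma distr_sequence_eqI:
  assumes P: "prob_space P" "prob_space P'"
    and X: "\<And>k. (\<lambda>\<omega>. X \<omega> k) \<in> P \<rightarrow>\<^sub>M S" and Y: "\<And>k. (\<lambda>\<omega>. Y \<omega> k) \<in> P' \<rightarrow>\<^sub>M S"
    and eq: "\<And>n A. (\<And>m. A m \<in> sets S) \<Longrightarrow>
        (\<integral>\<^sup>+\<omega>. (\<Prod>m\<le>n. indicator (A m) (X \<omega> m)) \<partial>P) = (\<integral>\<^sup>+\<omega>. (\<Prod>m\<le>n. indicator (A m) (Y \<omega> m)) \<partial>P')"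
  shows "X \<in> P \<rightarrow>\<^sub>M PiM UNIV (\<lambda>_::nat. S)" "Y \<in> P' \<rightarrow>\<^sub>M PiM UNIV (\<lambda>_::nat. S)"
    "distr P (PiM UNIV (\<lambda>_::nat. S)) X = distr P' (PiM UNIV (\<lambda>_::nat. S)) Y"
proof -
  interpret P: prob_space P by fact
  interpret P': prob_space P' by fact
  have XY [measurable]: "X \<in> P \<rightarrow>\<^sub>M PiM UNIV (\<lambda>_::nat. S)" "Y \<in> P' \<rightarrow>\<^sub>M PiM UNIV (\<lambda>_::nat. S)"
    using measurable_PiM_single'[of UNIV "\<lambda>k \<omega>. X \<omega> k" P "\<lambda>_. S"] measurable_PiM_single'[of UNIV "\<lambda>k \<omega>. Y \<omega> k" P' "\<lambda>_. S"]
      X Y measurable_space[OF X] measurable_space[OF Y] by (auto simp: PiE_def)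
  then show "X \<in> P \<rightarrow>\<^sub>M PiM UNIV (\<lambda>_::nat. S)" "Y \<in> P' \<rightarrow>\<^sub>M PiM UNIV (\<lambda>_::nat. S)" .
  have cyl: "emeasure (distr Q (PiM UNIV (\<lambda>_::nat. S)) Z) (prod_emb UNIV (\<lambda>_. S) J (Pi\<^sub>E J A))
      = (\<integral>\<^sup>+\<omega>. (\<Prod>m\<le>Max (insert 0 J). indicator (if m \<in> J then A m else space S) (Z \<omega> m)) \<partial>Q)"
    if Z [measurable]: "Z \<in> Q \<rightarrow>\<^sub>M PiM UNIV (\<lambda>_::nat. S)" and J: "finite J" and A: "\<And>i. i \<in> J \<Longrightarrow> A i \<in> sets S"
    for Z J A and Q :: "'z measure"
  proof -
    let ?C = "prod_emb UNIV (\<lambda>_. S) J (Pi\<^sub>E J A)"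
    have C: "?C \<in> sets (PiM UNIV (\<lambda>_::nat. S))" using J A by (intro sets_PiM_I) auto
    have Zm: "Z \<omega> m \<in> space S" if "\<omega> \<in> space Q" for \<omega> m
      using measurable_space[OF Z that] by (auto simp: space_PiM)
    have "emeasure (distr Q (PiM UNIV (\<lambda>_::nat. S)) Z) ?C = (\<integral>\<^sup>+\<omega>. indicator (Z -` ?C \<inter> space Q) \<omega> \<partial>Q)"
      using C by (simp add: emeasure_distr measurable_sets[OF Z])
    also have "\<dots> = (\<integral>\<^sup>+\<omega>. (\<Prod>m\<le>Max (insert 0 J). indicator (if m \<in> J then A m else space S) (Z \<omega> m)) \<partial>Q)"
    proof (intro nn_integral_cong)
      fix \<omega> assume \<omega>: "\<omega> \<in> space Q"
      have le: "m \<le> Max (insert 0 J)" if "m \<in> J" for m using J that by (intro Max_ge) auto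
      have "\<omega> \<in> Z -` ?C \<inter> space Q \<longleftrightarrow> (\<forall>m\<in>J. Z \<omega> m \<in> A m)"
        using \<omega> Zm by (auto simp: prod_emb_def PiE_iff space_PiM)
      also have "\<dots> \<longleftrightarrow> (\<forall>m\<le>Max (insert 0 J). Z \<omega> m \<in> (if m \<in> J then A m else space S))"
        using le Zm[OF \<omega>] by auto
      finally show "indicator (Z -` ?C \<inter> space Q) \<omega>
          = (\<Prod>m\<le>Max (insert 0 J). indicator (if m \<in> J then A m else space S) (Z \<omega> m) :: ennreal)"
        unfolding prod_indicator by (simp add: indicator_def)
    qed
    finally show ?thesis .
  qed
  interpret D: prob_space "distr P (PiM UNIV (\<lambda>_::nat. S)) X" by (rule P.prob_space_distr) simp
  show "distr P (PiM UNIV (\<lambda>_::nat. S)) X = distr P' (PiM UNIV (\<lambda>_::nat. S)) Y"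
  proof (rule measure_eqI_PiM_infinite[where I=UNIV and M="\<lambda>_. S"])
    fix A and J :: "nat set" assume J: "finite J" and A: "\<And>i. i \<in> J \<Longrightarrow> A i \<in> sets S"
    show "emeasure (distr P (PiM UNIV (\<lambda>_. S)) X) (prod_emb UNIV (\<lambda>_. S) J (Pi\<^sub>E J A))
        = emeasure (distr P' (PiM UNIV (\<lambda>_. S)) Y) (prod_emb UNIV (\<lambda>_. S) J (Pi\<^sub>E J A))"
    proof -
      have B: "(if m \<in> J then A m else space S) \<in> sets S" for m using A by auto
      have "emeasure (distr P (PiM UNIV (\<lambda>_. S)) X) (prod_emb UNIV (\<lambda>_. S) J (Pi\<^sub>E J A))
        = (\<integral>\<^sup>+\<omega>. (\<Prod>m\<le>Max (insert 0 J). indicator (if m \<in> J then A m else space S) (X \<omega> m)) \<partial>P)"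
        by (rule cyl[OF XY(1) J]) (rule A)
      also have "\<dots> = (\<integral>\<^sup>+\<omega>. (\<Prod>m\<le>Max (insert 0 J). indicator (if m \<in> J then A m else space S) (Y \<omega> m)) \<partial>P')"
        by (rule eq) (rule B)
      also have "\<dots> = emeasure (distr P' (PiM UNIV (\<lambda>_. S)) Y) (prod_emb UNIV (\<lambda>_. S) J (Pi\<^sub>E J A))"
        by (rule cyl[OF XY(2) J, symmetric]) (rule A)
      finally show ?thesis .
    qed
  qed (auto intro: D.finite_measure_axioms)
qed

lemma distr_independent_pair:
  assumes P: "prob_space P" and ind: "independent_rv P K V L Z"
  shows "distr P (K \<Otimes>\<^sub>M L) (\<lambda>\<omega>. (V \<omega>, Z \<omega>)) = distr P K V \<Otimes>\<^sub>M distr P L Z"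
proof (rule pair_measure_eqI[symmetric])
  interpret P: prob_space P by fact
  have V [measurable]: "V \<in> P \<rightarrow>\<^sub>M K" and Z [measurable]: "Z \<in> P \<rightarrow>\<^sub>M L" using ind by (auto simp: independent_rv_def)
  show "sigma_finite_measure (distr P K V)" "sigma_finite_measure (distr P L Z)"
    using P.prob_space_distr[OF V] P.prob_space_distr[OF Z] by (auto intro: prob_space_imp_sigma_finite)
  fix A B assume AB: "A \<in> sets (distr P K V)" "B \<in> sets (distr P L Z)"
  then have "P.prob ((V -` A \<inter> space P) \<inter> (Z -` B \<inter> space P)) = P.prob (V -` A \<inter> space P) * P.prob (Z -` B \<inter> space P)"
    using ind unfolding independent_rv_def by (intro P.indep_setD) auto
  moreover have "(\<lambda>\<omega>. (V \<omega>, Z \<omega>)) -` (A \<times> B) \<inter> space P = (V -` A \<inter> space P) \<inter> (Z -` B \<inter> space P)" by auto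
  ultimately show "emeasure (distr P K V) A * emeasure (distr P L Z) B
      = emeasure (distr P (K \<Otimes>\<^sub>M L) (\<lambda>\<omega>. (V \<omega>, Z \<omega>))) (A \<times> B)"
    using AB by (simp add: emeasure_distr P.emeasure_eq_measure ennreal_mult)
qed simp

lemma distr_driving:
  fixes Z :: "'x + 'y \<Rightarrow> 'v \<Rightarrow> real"
  assumes P: "prob_space P" and J: "J \<noteq> {}" and ind: "prob_space.indep_vars P (\<lambda>_. borel) Z J"
    and E: "\<And>x. Inl x \<in> J \<Longrightarrow> distributed P lborel (Z (Inl x)) (exponential_density 1)"
    and U: "\<And>y. Inr y \<in> J \<Longrightarrow> Z (Inr y) \<in> P \<rightarrow>\<^sub>M unif01 \<and> distr P unif01 (Z (Inr y)) = unif01"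
  shows "distr P (PiM J driving_law) (\<lambda>\<omega>. \<lambda>z\<in>J. Z z \<omega>) = PiM J driving_law"
proof -
  interpret P: prob_space P by fact
  have rv: "Z z \<in> borel_measurable P" if "z \<in> J" for z
    using ind that by (auto simp: P.indep_vars_def)
  have "distr P (PiM J driving_law) (\<lambda>\<omega>. \<lambda>z\<in>J. Z z \<omega>) = distr P (PiM J (\<lambda>_. borel)) (\<lambda>\<omega>. \<lambda>z\<in>J. Z z \<omega>)"
    by (intro distr_cong sets_PiM_cong) (simp_all add: sets_driving_law)
  also have "\<dots> = PiM J (\<lambda>z. distr P borel (Z z))"
    using P.indep_vars_iff_distr_eq_PiM'[OF J, where M'="\<lambda>_. borel" and X=Z] rv ind by simp
  also have "\<dots> = PiM J driving_law"
  proof (intro PiM_cong refl)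
    fix z assume z: "z \<in> J"
    show "distr P borel (Z z) = driving_law z"
    proof (cases z)
      case (Inl x)
      have "distr P borel (Z z) = distr P lborel (Z z)" by (intro distr_cong) simp_all
      also have "\<dots> = exp_law"
        using distributed_distr_eq_density[OF E] z Inl by (simp add: exp_law_def)
      finally show ?thesis using Inl by simp
    next
      case (Inr y)
      with U[of y] z have "Z z \<in> P \<rightarrow>\<^sub>M unif01" "distr P unif01 (Z z) = unif01" by auto
      then have "unif_law = distr P borel (Z z)"
        unfolding unif_law_def using distr_distr[OF measurable_unif01_borel, of "Z z" P] by (simp add: o_def)
      then show ?thesis using Inr by simp
    qed
  qed
  finally show ?thesis .
qed

context pdmp_setting
begin

lemma chain_space_eq: "chain_space \<tau> l = PiM UNIV (\<lambda>_. SS)"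
  by (simp add: chain_space_def SS_def)

lemma driving_transfer:
  fixes Z :: "'x + 'y \<Rightarrow> 'v \<Rightarrow> real"
  assumes P: "prob_space P" and J: "J \<noteq> {}" and ind: "prob_space.indep_vars P (\<lambda>_. borel) Z J"
    and E: "\<And>x. Inl x \<in> J \<Longrightarrow> distributed P lborel (Z (Inl x)) (exponential_density 1)"
    and U: "\<And>y. Inr y \<in> J \<Longrightarrow> Z (Inr y) \<in> P \<rightarrow>\<^sub>M unif01 \<and> distr P unif01 (Z (Inr y)) = unif01"
    and W: "distr P (manifold_borel M) W = \<mu>\<^sub>0"
    and WZ: "independent_rv P (manifold_borel M) W (PiM J (\<lambda>_. borel)) (\<lambda>\<omega>. \<lambda>z\<in>J. Z z \<omega>)"
    and F: "F \<in> borel_measurable (manifold_borel M \<Otimes>\<^sub>M PiM J driving_law)"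
  shows "(\<integral>\<^sup>+\<omega>. F (W \<omega>, \<lambda>z\<in>J. Z z \<omega>) \<partial>P) = (\<integral>\<^sup>+w. (\<integral>\<^sup>+\<omega>. F (w, \<omega>) \<partial>PiM J driving_law) \<partial>\<mu>\<^sub>0)"
proof -
  interpret P: prob_space P by fact
  interpret D: prob_space "PiM J driving_law" by (intro prob_space_PiM prob_space_driving_law)
  have [simp]: "sets (PiM J (\<lambda>_. borel)) = sets (PiM J driving_law)"
    by (intro sets_PiM_cong) (simp_all add: sets_driving_law)
  have WZ': "independent_rv P (manifold_borel M) W (PiM J driving_law) (\<lambda>\<omega>. \<lambda>z\<in>J. Z z \<omega>)"
    using WZ unfolding independent_rv_def by (simp cong: measurable_cong_sets)
  have WZm: "W \<in> P \<rightarrow>\<^sub>M manifold_borel M" "(\<lambda>\<omega>. \<lambda>z\<in>J. Z z \<omega>) \<in> P \<rightarrow>\<^sub>M PiM J driving_law"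
    using WZ' unfolding independent_rv_def by auto
  have [simp]: "sets \<mu>\<^sub>0 = sets (manifold_borel M)" unfolding W[symmetric] by simp
  have F': "F \<in> borel_measurable (\<mu>\<^sub>0 \<Otimes>\<^sub>M PiM J driving_law)"
    using F by (subst measurable_cong_sets[OF sets_pair_measure_cong refl]) auto
  have distr_Z: "distr P (PiM J driving_law) (\<lambda>\<omega>. \<lambda>z\<in>J. Z z \<omega>) = PiM J driving_law"
    by (rule distr_driving[OF P J ind]) (use E U in auto)
  have "(\<integral>\<^sup>+\<omega>. F (W \<omega>, \<lambda>z\<in>J. Z z \<omega>) \<partial>P)
      = (\<integral>\<^sup>+x. F x \<partial>distr P (manifold_borel M \<Otimes>\<^sub>M PiM J driving_law) (\<lambda>\<omega>. (W \<omega>, \<lambda>z\<in>J. Z z \<omega>)))"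
    using measurable_Pair[OF WZm] F by (subst nn_integral_distr) auto
  also have "\<dots> = (\<integral>\<^sup>+x. F x \<partial>(\<mu>\<^sub>0 \<Otimes>\<^sub>M PiM J driving_law))"
    unfolding distr_independent_pair[OF P WZ'] W distr_Z ..
  also have "\<dots> = (\<integral>\<^sup>+w. (\<integral>\<^sup>+\<omega>. F (w, \<omega>) \<partial>PiM J driving_law) \<partial>\<mu>\<^sub>0)"
    using F' by (rule D.nn_integral_fst[symmetric])
  finally show ?thesis .
qed

lemma measurable_driving_A:
  assumes "driving_A P M \<mu>\<^sub>0 l W E U"
  shows "W \<in> P \<rightarrow>\<^sub>M manifold_borel M" "\<And>j k. j \<in> {1..l} \<Longrightarrow> 1 \<le> k \<Longrightarrow> E j k \<in> borel_measurable P"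
    "\<And>k. 1 \<le> k \<Longrightarrow> U k \<in> borel_measurable P"
proof -
  show "W \<in> P \<rightarrow>\<^sub>M manifold_borel M" using assms by (simp add: driving_A_def Let_def)
  show "E j k \<in> borel_measurable P" if "j \<in> {1..l}" "1 \<le> k" for j k
  proof -
    have "distributed P lborel (E j k) (exponential_density 1)"
      using assms that unfolding driving_A_def Let_def by blast
    from distributed_measurable[OF this] show ?thesis by simp
  qed
  show "U k \<in> borel_measurable P" if "1 \<le> k" for k
  proof -
    have "U k \<in> P \<rightarrow>\<^sub>M unif01" using assms that unfolding driving_A_def Let_def by blast
    from measurable_compose[OF this measurable_unif01_borel] show ?thesis .
  qed
qed

lemma measurable_driving_B:
  assumes "driving_B P M \<mu>\<^sub>0 l W E U"
  shows "W \<in> P \<rightarrow>\<^sub>M manifold_borel M" "\<And>j k. j \<in> {1..l} \<Longrightarrow> 1 \<le> k \<Longrightarrow> E j k \<in> borel_measurable P"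
    "\<And>j k. j \<in> {1..l} \<Longrightarrow> 1 \<le> k \<Longrightarrow> U j k \<in> borel_measurable P"
proof -
  show "W \<in> P \<rightarrow>\<^sub>M manifold_borel M" using assms by (simp add: driving_B_def Let_def)
  show "E j k \<in> borel_measurable P" if "j \<in> {1..l}" "1 \<le> k" for j k
  proof -
    have "distributed P lborel (E j k) (exponential_density 1)"
      using assms that unfolding driving_B_def Let_def by blast
    from distributed_measurable[OF this] show ?thesis by simp
  qed
  show "U j k \<in> borel_measurable P" if "j \<in> {1..l}" "1 \<le> k" for j k
  proof -
    have "U j k \<in> P \<rightarrow>\<^sub>M unif01" using assms that unfolding driving_B_def Let_def by blast
    from measurable_compose[OF this measurable_unif01_borel] show ?thesis .
  qed
qed

lemma path_law_A:
  assumes dr: "driving_A P M \<mu>\<^sub>0 l W E U" and f: "\<And>n. f n \<in> borel_measurable SS"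
  shows "(\<integral>\<^sup>+\<omega>. (\<Prod>m\<le>n. f m (chainA (W \<omega>) (\<lambda>j k. E j k \<omega>) (\<lambda>k. U k \<omega>) m)) \<partial>P)
       = (\<integral>\<^sup>+w. path_integral f w n (\<lambda>_. 1) \<partial>\<mu>\<^sub>0)"
proof -
  let ?Z = "case_sum (\<lambda>(j, k). E j k) U"
  define F where "F = (\<lambda>p. \<Prod>m\<le>n. f m (canonical_A (fst p) (snd p) m))"
  have F: "F \<in> borel_measurable (manifold_borel M \<Otimes>\<^sub>M PA)"
    unfolding F_def
    by (intro borel_measurable_prod_ennreal measurable_compose[OF measurable_canonical_A[OF measurable_fst measurable_snd] f])
  have mem: "W \<omega> \<in> M" if "\<omega> \<in> space P" for \<omega>
    using measurable_space[OF measurable_driving_A(1)[OF dr] that] by simp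
  have "(\<integral>\<^sup>+\<omega>. (\<Prod>m\<le>n. f m (chainA (W \<omega>) (\<lambda>j k. E j k \<omega>) (\<lambda>k. U k \<omega>) m)) \<partial>P)
      = (\<integral>\<^sup>+\<omega>. F (W \<omega>, \<lambda>z\<in>JA. ?Z z \<omega>) \<partial>P)"
  proof (intro nn_integral_cong)
    fix \<omega> assume \<omega>: "\<omega> \<in> space P"
    have "chainA (W \<omega>) (\<lambda>j k. E j k \<omega>) (\<lambda>k. U k \<omega>) m = canonical_A (W \<omega>) (\<lambda>z\<in>JA. ?Z z \<omega>) m" for m
      by (rule chain_A_indep[OF mem[OF \<omega>] _ _ order_refl]) auto
    then show "(\<Prod>m\<le>n. f m (chainA (W \<omega>) (\<lambda>j k. E j k \<omega>) (\<lambda>k. U k \<omega>) m)) = F (W \<omega>, \<lambda>z\<in>JA. ?Z z \<omega>)"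
      by (simp only: F_def fst_conv snd_conv)
  qed
  also have "\<dots> = (\<integral>\<^sup>+w. (\<integral>\<^sup>+\<omega>. F (w, \<omega>) \<partial>PA) \<partial>\<mu>\<^sub>0)"
  proof (rule driving_transfer[OF _ _ _ _ _ _ _ F])
    show "JA \<noteq> {}" by auto
    show "distributed P lborel (?Z (Inl x)) (exponential_density 1)" if "Inl x \<in> JA" for x
      using dr that unfolding driving_A_def Let_def by (cases x) auto
    show "?Z (Inr y) \<in> P \<rightarrow>\<^sub>M unif01 \<and> distr P unif01 (?Z (Inr y)) = unif01" if "Inr y \<in> JA" for y
      using dr that unfolding driving_A_def Let_def by auto
  qed (use dr in \<open>auto simp only: driving_A_def Let_def\<close>)
  also have "\<dots> = (\<integral>\<^sup>+w. path_integral f w n (\<lambda>_. 1) \<partial>\<mu>\<^sub>0)"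
  proof (intro nn_integral_cong)
    fix w assume "w \<in> space \<mu>\<^sub>0"
    moreover have "space \<mu>\<^sub>0 = M" using dr unfolding driving_A_def Let_def by (metis space_distr space_manifold_borel)
    ultimately have "w \<in> M" by simp
    from nn_integral_chain_A[where f=f and n=n and g="\<lambda>_. 1", OF this f]
    show "(\<integral>\<^sup>+\<omega>. F (w, \<omega>) \<partial>PA) = path_integral f w n (\<lambda>_. 1)" by (simp add: F_def)
  qed
  finally show ?thesis .
qed

lemma path_law_B:
  assumes dr: "driving_B P M \<mu>\<^sub>0 l W E U" and f: "\<And>n. f n \<in> borel_measurable SS"
  shows "(\<integral>\<^sup>+\<omega>. (\<Prod>m\<le>n. f m (chain_B l \<phi> rate G (W \<omega>) (\<lambda>j k. E j k \<omega>) (\<lambda>j k. U j k \<omega>) m)) \<partial>P)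
       = (\<integral>\<^sup>+w. path_integral f w n (\<lambda>_. 1) \<partial>\<mu>\<^sub>0)"
proof -
  let ?Z = "case_sum (\<lambda>(j, k). E j k) (\<lambda>(j, k). U j k)"
  define F where "F = (\<lambda>p. \<Prod>m\<le>n. f m (fst (canonical_B (fst p) (snd p) m)))"
  have F: "F \<in> borel_measurable (manifold_borel M \<Otimes>\<^sub>M PB)"
    unfolding F_def
    by (intro borel_measurable_prod_ennreal measurable_compose[OF measurable_canonical_B(1)[OF measurable_fst measurable_snd] f])
  have mem: "W \<omega> \<in> M" if "\<omega> \<in> space P" for \<omega>
    using measurable_space[OF measurable_driving_B(1)[OF dr] that] by simp
  have "(\<integral>\<^sup>+\<omega>. (\<Prod>m\<le>n. f m (chain_B l \<phi> rate G (W \<omega>) (\<lambda>j k. E j k \<omega>) (\<lambda>j k. U j k \<omega>) m)) \<partial>P)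
      = (\<integral>\<^sup>+\<omega>. F (W \<omega>, \<lambda>z\<in>JB. ?Z z \<omega>) \<partial>P)"
  proof (intro nn_integral_cong)
    fix \<omega> assume \<omega>: "\<omega> \<in> space P"
    have "stateB (W \<omega>) (\<lambda>j k. E j k \<omega>) (\<lambda>j k. U j k \<omega>) m = canonical_B (W \<omega>) (\<lambda>z\<in>JB. ?Z z \<omega>) m" for m
      by (rule stateB_indep[OF _ order_refl]) auto
    then show "(\<Prod>m\<le>n. f m (chain_B l \<phi> rate G (W \<omega>) (\<lambda>j k. E j k \<omega>) (\<lambda>j k. U j k \<omega>) m)) = F (W \<omega>, \<lambda>z\<in>JB. ?Z z \<omega>)"
      by (simp only: F_def fst_conv snd_conv chain_B_eq[OF mem[OF \<omega>]])
  qed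
  also have "\<dots> = (\<integral>\<^sup>+w. (\<integral>\<^sup>+\<omega>. F (w, \<omega>) \<partial>PB) \<partial>\<mu>\<^sub>0)"
  proof (rule driving_transfer[OF _ _ _ _ _ _ _ F])
    show "JB \<noteq> {}" using l by auto
    show "distributed P lborel (?Z (Inl x)) (exponential_density 1)" if "Inl x \<in> JB" for x
      using dr that unfolding driving_B_def Let_def by (cases x) auto
    show "?Z (Inr y) \<in> P \<rightarrow>\<^sub>M unif01 \<and> distr P unif01 (?Z (Inr y)) = unif01" if "Inr y \<in> JB" for y
      using dr that unfolding driving_B_def Let_def by (cases y) auto
  qed (use dr in \<open>auto simp only: driving_B_def Let_def\<close>)
  also have "\<dots> = (\<integral>\<^sup>+w. path_integral f w n (\<lambda>_. 1) \<partial>\<mu>\<^sub>0)"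
  proof (intro nn_integral_cong)
    fix w assume "w \<in> space \<mu>\<^sub>0"
    moreover have "space \<mu>\<^sub>0 = M" using dr unfolding driving_B_def Let_def by (metis space_distr space_manifold_borel)
    ultimately have w: "w \<in> M" by simp
    from nn_integral_chain_B[where f=f and n=n and g="\<lambda>_ _. 1", OF w f]
    have "(\<integral>\<^sup>+\<omega>. F (w, \<omega>) \<partial>PB) = path_integral f w n (\<lambda>c. \<integral>\<^sup>+K. 1 \<partial>PE)" by (simp add: F_def)
    then show "(\<integral>\<^sup>+\<omega>. F (w, \<omega>) \<partial>PB) = path_integral f w n (\<lambda>_. 1)" using PE.emeasure_space_1 by simp
  qed
  finally show ?thesis .
qed

lemma chains_same_law:
  assumes A: "driving_A P M \<mu>\<^sub>0 l W E U" and B: "driving_B P' M \<mu>\<^sub>0 l W' E' U'"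
  defines "X \<equiv> \<lambda>\<omega>. chainA (W \<omega>) (\<lambda>j k. E j k \<omega>) (\<lambda>k. U k \<omega>)"
    and "Y \<equiv> \<lambda>\<omega>. chain_B l \<phi> rate G (W' \<omega>) (\<lambda>j k. E' j k \<omega>) (\<lambda>j k. U' j k \<omega>)"
  shows "X \<in> P \<rightarrow>\<^sub>M chain_space \<tau> l" "Y \<in> P' \<rightarrow>\<^sub>M chain_space \<tau> l"
    "distr P (chain_space \<tau> l) X = distr P' (chain_space \<tau> l) Y"
proof -
  have P: "prob_space P" "prob_space P'" using A B by (auto simp: driving_A_def driving_B_def Let_def)
  have X: "(\<lambda>\<omega>. X \<omega> k) \<in> P \<rightarrow>\<^sub>M SS" for k
    unfolding X_def
  proof (rule measurable_chain_A)
    show "W \<in> P \<rightarrow>\<^sub>M manifold_borel M" by (rule measurable_driving_A(1)[OF A])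
    show "E j k \<in> borel_measurable P" if "j \<in> {1..l}" "1 \<le> k" for j k
      by (rule measurable_driving_A(2)[OF A that])
    show "U k \<in> borel_measurable P" if "1 \<le> k" for k
      by (rule measurable_driving_A(3)[OF A that])
  qed
  have Y: "(\<lambda>\<omega>. Y \<omega> k) \<in> P' \<rightarrow>\<^sub>M SS" for k
  proof -
    have "(\<lambda>\<omega>. fst (stateB (W' \<omega>) (\<lambda>j k. E' j k \<omega>) (\<lambda>j k. U' j k \<omega>) k)) \<in> P' \<rightarrow>\<^sub>M SS"
    proof (rule conjunct1[OF measurable_stateB])
      show "W' \<in> P' \<rightarrow>\<^sub>M manifold_borel M" by (rule measurable_driving_B(1)[OF B])
    qed (erule (1) measurable_driving_B[OF B])+
    also have "?this \<longleftrightarrow> ?thesis"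
      unfolding Y_def using measurable_space[OF measurable_driving_B(1)[OF B]]
      by (intro measurable_cong) (simp add: chain_B_eq)
    finally show ?thesis .
  qed
  have eq: "(\<integral>\<^sup>+\<omega>. (\<Prod>m\<le>n. indicator (A m) (X \<omega> m)) \<partial>P) = (\<integral>\<^sup>+\<omega>. (\<Prod>m\<le>n. indicator (A m) (Y \<omega> m)) \<partial>P')"
    if "\<And>m. A m \<in> sets SS" for n A
    unfolding X_def Y_def
    using path_law_A[OF A, of "\<lambda>m. indicator (A m)" n] path_law_B[OF B, of "\<lambda>m. indicator (A m)" n] that
    by simp
  show "X \<in> P \<rightarrow>\<^sub>M chain_space \<tau> l"
    unfolding chain_space_eq by (rule distr_sequence_eqI(1)[OF P X Y eq])
  show "Y \<in> P' \<rightarrow>\<^sub>M chain_space \<tau> l"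
    unfolding chain_space_eq by (rule distr_sequence_eqI(2)[OF P X Y eq])
  show "distr P (chain_space \<tau> l) X = distr P' (chain_space \<tau> l) Y"
    unfolding chain_space_eq by (rule distr_sequence_eqI(3)[OF P X Y eq])
qed

end

section \<open>Time changes\<close>

definition kink :: "real \<Rightarrow> real \<Rightarrow> real \<Rightarrow> real \<Rightarrow> real" where
  "kink a b c t = (if t \<le> a then t else if t \<le> b then a + (t - a) * ((c - a) / (b - a)) else t - b + c)"

lemma kink_inverse:
  assumes "a < b" "a < c" shows "kink a c b (kink a b c t) = t"
proof -
  consider "t \<le> a" | "a < t" "t \<le> b" | "b < t" by linarith
  then show ?thesis
  proof cases
    case 2
    let ?y = "a + (t - a) * ((c - a) / (b - a))"
    have 1: "a < ?y" using 2 assms by (simp add: divide_pos_pos)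
    have "(t - a) * ((c - a) / (b - a)) \<le> (b - a) * ((c - a) / (b - a))"
      using 2 assms by (intro mult_right_mono) auto
    then have 3: "?y \<le> c" using assms by simp
    have "kink a b c t = ?y" using 2 by (simp add: kink_def)
    moreover have "kink a c b ?y = a + (?y - a) * ((b - a) / (c - a))" using 1 3 by (simp add: kink_def)
    moreover have "(?y - a) * ((b - a) / (c - a)) = t - a" using assms by simp
    ultimately show ?thesis by simp
  qed (use assms in \<open>auto simp: kink_def\<close>)
qed

lemma kink_strict_mono:
  assumes "a < b" "a < c" "s < t" shows "kink a b c s < kink a b c t"
proof -
  define m where "m = (c - a) / (b - a)"
  define X where "X = (\<lambda>x. a + (x - a) * m)"
  have kink: "kink a b c x = (if x \<le> a then x else if x \<le> b then X x else x - b + c)" for x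
    by (simp add: kink_def X_def m_def)
  have m: "0 < m" using assms by (simp add: m_def)
  have "X b = c" using assms by (simp add: X_def m_def)
  moreover have mono: "X x < X y" if "x < y" for x y
    using that m by (simp add: X_def mult_strict_right_mono)
  moreover have "X a = a" by (simp add: X_def)
  ultimately have "X x \<le> c" if "x \<le> b" for x using that by (cases "x = b") (auto simp: less_imp_le)
  moreover have "a < X x" if "a < x" for x using mono[OF that] \<open>X a = a\<close> by simp
  ultimately show ?thesis
    using mono[OF assms(3)] assms unfolding kink by (smt (verit))
qed

lemma kink_time_change:
  assumes "0 \<le> a" "a < b" "a < c" shows "kink a b c \<in> time_changes"
proof -
  have nonneg: "0 \<le> kink a b c t" if "a < b" "a < c" "0 \<le> t" for b c t
    using kink_strict_mono[OF that(1,2), of 0 t] that(3) assms(1) by (cases "t = 0") (auto simp: kink_def)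
  have "bij_betw (kink a b c) {0..} {0..}"
    using assms by (intro bij_betw_byWitness[where f'="kink a c b"]) (auto simp: kink_inverse nonneg)
  moreover have "strict_mono_on {0..} (kink a b c)"
    using kink_strict_mono[OF assms(2,3)] by (auto simp: strict_mono_on_def)
  ultimately show ?thesis by (simp add: time_changes_def)
qed

lemma time_change_nonneg: "g \<in> time_changes \<Longrightarrow> 0 \<le> t \<Longrightarrow> 0 \<le> g t"
  by (auto simp: time_changes_def bij_betw_def)

lemma time_change_less: "g \<in> time_changes \<Longrightarrow> 0 \<le> s \<Longrightarrow> s < t \<Longrightarrow> g s < g t"
  by (auto simp: time_changes_def strict_mono_on_def)

lemma time_change_compose: "g \<in> time_changes \<Longrightarrow> h \<in> time_changes \<Longrightarrow> g \<circ> h \<in> time_changes"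
proof -
  assume g: "g \<in> time_changes" and h: "h \<in> time_changes"
  have "bij_betw (g \<circ> h) {0..} {0..}" 
    using bij_betw_trans[of h "{0..}" "{0..}" g "{0..}"] g h by (simp add: time_changes_def)
  moreover have "g (h s) < g (h t)" if "0 \<le> s" "s < t" for s t
    by (rule time_change_less[OF g time_change_nonneg[OF h that(1)] time_change_less[OF h that]])
  then have "strict_mono_on {0..} (g \<circ> h)" by (auto simp: strict_mono_on_def)
  ultimately show "g \<circ> h \<in> time_changes" by (simp add: time_changes_def)
qed

lemma time_change_through:
  fixes r r' :: "nat \<Rightarrow> real"
  assumes "0 < r 0" "0 < r' 0" "\<And>i. r i < r (Suc i)" "\<And>i. r' i < r' (Suc i)"
  shows "\<exists>g\<in>time_changes. \<forall>i<m. g (r i) = r' i"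
proof (induction m)
  case 0
  have "(\<lambda>t. t) \<in> time_changes" using bij_betw_id by (auto simp: time_changes_def strict_mono_on_def id_def)
  then show ?case by auto
next
  case (Suc m)
  then obtain g where g: "g \<in> time_changes" and gr: "\<And>i. i < m \<Longrightarrow> g (r i) = r' i" by auto
  have mono: "strict_mono r" "strict_mono r'" using assms by (auto simp: strict_mono_Suc_iff)
  have pos: "0 < r i" "0 < r' i" for i
    using strict_mono_less_eq[OF mono(1), of 0 i] strict_mono_less_eq[OF mono(2), of 0 i] assms(1,2) by linarith+
  define a where "a = (case m of 0 \<Rightarrow> 0 | Suc k \<Rightarrow> r' k)"
  have a: "0 \<le> a" "a < g (r m)" "a < r' m"
  proof -
    show "0 \<le> a" using less_imp_le[OF pos(2)] by (simp add: a_def split: nat.split)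
    show "a < r' m"
    proof (cases m)
      case (Suc k)
      then show ?thesis using assms(4)[of k] by (simp add: a_def)
    qed (use assms(2) in \<open>simp add: a_def\<close>)
    show "a < g (r m)"
    proof (cases m)
      case 0
      have "g 0 < g (r 0)" by (rule time_change_less[OF g order_refl assms(1)])
      then show ?thesis using time_change_nonneg[OF g, of 0] 0 by (simp add: a_def)
    next
      case (Suc k)
      have "g (r k) < g (r m)"
        unfolding Suc by (rule time_change_less[OF g less_imp_le[OF pos(1)] assms(3)])
      then show ?thesis using gr[of k] Suc by (simp add: a_def)
    qed
  qed
  let ?h = "kink a (g (r m)) (r' m) \<circ> g"
  have "?h \<in> time_changes" using kink_time_change[OF a] g by (rule time_change_compose)
  moreover have "?h (r i) = r' i" if "i < Suc m" for i
  proof (cases "i = m")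
    case True
    then show ?thesis using a by (simp add: kink_def)
  next
    case False
    with that have i: "i < m" by simp
    then obtain k where k: "m = Suc k" "i \<le> k" by (cases m) auto
    then have "r' i \<le> a" using strict_mono_less_eq[OF mono(2)] by (simp add: a_def)
    then show ?thesis using gr[OF i] by (simp add: kink_def)
  qed
  ultimately show ?case by blast
qed

section \<open>The Borel sets of the Skorokhod topology\<close>

context Metric_space
begin

definition window :: "real \<Rightarrow> 'a \<Rightarrow> 'a \<Rightarrow> real \<Rightarrow> real \<Rightarrow> (real \<Rightarrow> 'a) \<Rightarrow> bool" where
  "window \<delta> a b p q f \<longleftrightarrow>
     (\<exists>r\<in>{p..q}. (\<forall>t\<in>{p..<r}. d a (f t) \<le> \<delta>) \<and> (\<forall>t\<in>{r..q}. d b (f t) \<le> \<delta>))"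

text \<open>A pattern lists the approximate values at the points of a grid.  Two consecutive entries differ
  when the path may jump in between; such windows are separated by constant ones, so that the jumps of
  two paths with the same pattern can be matched by a time change.\<close>

definition pattern :: "'a list \<Rightarrow> bool" where
  "pattern as \<longleftrightarrow> 2 \<le> length as \<and> as ! 0 = as ! 1 \<and>
     (\<forall>i. i + 2 < length as \<longrightarrow> as ! i = as ! (i + 1) \<or> as ! (i + 1) = as ! (i + 2))"

definition follows :: "real \<Rightarrow> real \<Rightarrow> 'a list \<Rightarrow> (real \<Rightarrow> 'a) \<Rightarrow> bool" where
  "follows \<eta> \<delta> as f \<longleftrightarrow>
     (\<forall>i. i + 1 < length as \<longrightarrow> window \<delta> (as ! i) (as ! (i + 1)) (real i * \<eta>) (real (i + 1) * \<eta>) f)"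

lemma follows_nodes:
  assumes as: "pattern as" and f: "follows \<eta> \<delta> as f" and \<eta>: "0 < \<eta>"
  obtains r where "\<And>i. real i * \<eta> \<le> r i" "\<And>i. r i \<le> real (i + 1) * \<eta>" "\<And>i. r i < r (Suc i)" "0 < r 0"
    "\<And>i t. i + 1 < length as \<Longrightarrow> t < r i \<Longrightarrow> (case i of 0 \<Rightarrow> 0 | Suc k \<Rightarrow> r k) \<le> t \<Longrightarrow> d (as ! i) (f t) \<le> \<delta>"
proof -
  let ?l = "length as"
  have "\<exists>r. real i * \<eta> \<le> r \<and> r \<le> real (i + 1) * \<eta> \<and>
      (i + 1 < ?l \<longrightarrow> (\<forall>t\<in>{real i * \<eta>..<r}. d (as ! i) (f t) \<le> \<delta>) \<and>
         (\<forall>t\<in>{r..real (i + 1) * \<eta>}. d (as ! (i + 1)) (f t) \<le> \<delta>)) \<and>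
      (i + 1 < ?l \<and> as ! i \<noteq> as ! (i + 1) \<or> r = (real i + 1 / 2) * \<eta>)" for i
  proof -
    have mid: "real i * \<eta> \<le> (real i + 1 / 2) * \<eta>" "(real i + 1 / 2) * \<eta> \<le> real (i + 1) * \<eta>"
      using \<eta> by (auto intro!: mult_right_mono)
    show ?thesis
    proof (cases "i + 1 < ?l")
      case True
      then obtain r where r: "r \<in> {real i * \<eta>..real (i + 1) * \<eta>}"
        "\<forall>t\<in>{real i * \<eta>..<r}. d (as ! i) (f t) \<le> \<delta>" "\<forall>t\<in>{r..real (i + 1) * \<eta>}. d (as ! (i + 1)) (f t) \<le> \<delta>"
        using f unfolding follows_def window_def by meson
      show ?thesis
      proof (cases "as ! i = as ! (i + 1)")
        case True
        then have "d (as ! i) (f t) \<le> \<delta>" if "t \<in> {real i * \<eta>..real (i + 1) * \<eta>}" for t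
          using r that by (cases "t < r") auto
        then show ?thesis using mid True by (intro exI[of _ "(real i + 1 / 2) * \<eta>"]) auto
      next
        case False
        with \<open>i + 1 < ?l\<close> r show ?thesis by (intro exI[of _ r]) auto
      qed
    next
      case False
      then show ?thesis using mid by (intro exI[of _ "(real i + 1 / 2) * \<eta>"]) auto
    qed
  qed
  then obtain r where r: "\<And>i. real i * \<eta> \<le> r i" "\<And>i. r i \<le> real (i + 1) * \<eta>"
      "\<And>i t. i + 1 < ?l \<Longrightarrow> t \<in> {real i * \<eta>..<r i} \<Longrightarrow> d (as ! i) (f t) \<le> \<delta>"
      "\<And>i t. i + 1 < ?l \<Longrightarrow> t \<in> {r i..real (i + 1) * \<eta>} \<Longrightarrow> d (as ! (i + 1)) (f t) \<le> \<delta>"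
      "\<And>i. i + 1 < ?l \<and> as ! i \<noteq> as ! (i + 1) \<or> r i = (real i + 1 / 2) * \<eta>"
    by metis
  show ?thesis
  proof (rule that[of r])
    show "real i * \<eta> \<le> r i" "r i \<le> real (i + 1) * \<eta>" for i by (fact r)+
    have "r 0 = (real 0 + 1 / 2) * \<eta>" using r(5)[of 0] as by (auto simp: pattern_def)
    then show "0 < r 0" using \<eta> by simp
    show "r i < r (Suc i)" for i
    proof -
      have "r i = (real i + 1 / 2) * \<eta> \<or> r (Suc i) = (real (Suc i) + 1 / 2) * \<eta>"
        using r(5)[of i] r(5)[of "Suc i"] as by (auto simp: pattern_def)
      moreover have "(real i + 1 / 2) * \<eta> < real (i + 1) * \<eta>" "real (i + 1) * \<eta> < (real (Suc i) + 1 / 2) * \<eta>"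
        using \<eta> by (auto intro!: mult_strict_right_mono)
      ultimately show ?thesis using r(2)[of i] r(1)[of "Suc i"] by auto
    qed
    fix i t assume i: "i + 1 < ?l" and t: "t < r i" "(case i of 0 \<Rightarrow> 0 | Suc k \<Rightarrow> r k) \<le> t"
    show "d (as ! i) (f t) \<le> \<delta>"
    proof (cases "real i * \<eta> \<le> t")
      case True
      then show ?thesis using r(3)[OF i] t by simp
    next
      case False
      then obtain k where k: "i = Suc k" using t(2) by (cases i) auto
      then show ?thesis using r(4)[of k t] False t(2) i by auto
    qed
  qed
qed

lemma follows_nbhd:
  assumes as: "pattern as" "set as \<subseteq> M" and f: "f \<in> cadlag mtopology" "follows \<eta> \<delta> as f"
    and k: "k \<in> cadlag mtopology" "follows \<eta> \<delta> as k"
    and \<eta>: "0 < \<eta>" "2 * \<eta> < \<epsilon>" "2 * \<delta> < \<epsilon>" and T: "T < real (length as - 2) * \<eta>"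
  shows "k \<in> skorokhod_nbhd M d f T \<epsilon>"
proof -
  obtain r where r: "\<And>i. real i * \<eta> \<le> r i" "\<And>i. r i \<le> real (i + 1) * \<eta>" "\<And>i. r i < r (Suc i)" "0 < r 0"
    "\<And>i t. i + 1 < length as \<Longrightarrow> t < r i \<Longrightarrow> (case i of 0 \<Rightarrow> 0 | Suc k \<Rightarrow> r k) \<le> t \<Longrightarrow> d (as ! i) (k t) \<le> \<delta>"
    using follows_nodes[OF as(1) k(2) \<eta>(1)] by blast
  obtain r' where r': "\<And>i. real i * \<eta> \<le> r' i" "\<And>i. r' i \<le> real (i + 1) * \<eta>" "\<And>i. r' i < r' (Suc i)" "0 < r' 0"
    "\<And>i t. i + 1 < length as \<Longrightarrow> t < r' i \<Longrightarrow> (case i of 0 \<Rightarrow> 0 | Suc k \<Rightarrow> r' k) \<le> t \<Longrightarrow> d (as ! i) (f t) \<le> \<delta>"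
    using follows_nodes[OF as(1) f(2) \<eta>(1)] by blast
  obtain g where g: "g \<in> time_changes" and gr: "\<And>i. i < length as \<Longrightarrow> g (r i) = r' i"
    using time_change_through[OF r(4) r'(4) r(3) r'(3), of "length as"] by blast
  have r_pos: "0 \<le> r i" for i using r(1)[of i] \<eta>(1) by (meson le_less_trans linorder_not_less mult_nonneg_nonneg of_nat_0_le_iff less_imp_le)
  have "\<bar>g t - t\<bar> < \<epsilon> \<and> d (f (g t)) (k t) < \<epsilon>" if t: "t \<in> {0..T}" for t
  proof -
    let ?P = "\<lambda>i. t < r i"
    have l2: "2 \<le> length as" using as(1) by (simp add: pattern_def)
    have P: "?P (length as - 2)" using t T r(1)[of "length as - 2"] by auto
    define i where "i = (LEAST i. ?P i)"
    have i: "?P i" "i \<le> length as - 2" unfolding i_def using LeastI[of ?P, OF P] Least_le[of ?P, OF P] by auto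
    have il: "i + 1 < length as" using i(2) l2 by simp
    have t_ge: "(case i of 0 \<Rightarrow> 0 | Suc k \<Rightarrow> r k) \<le> t"
    proof (cases i)
      case (Suc n)
      then have "\<not> ?P n" unfolding i_def by (intro not_less_Least) simp
      with Suc show ?thesis by simp
    qed (use t in simp)
    have g1: "g t < r' i" using time_change_less[OF g _ i(1)] t gr[of i] il by simp
    have g2: "(case i of 0 \<Rightarrow> 0 | Suc k \<Rightarrow> r' k) \<le> g t"
    proof (cases i)
      case 0
      then show ?thesis using time_change_nonneg[OF g] t by simp
    next
      case (Suc n)
      then have "r n \<le> t" using t_ge by simp
      then have "g (r n) \<le> g t"
        using time_change_less[OF g r_pos, of n t] by (cases "r n = t") auto
      then show ?thesis using gr[of n] Suc il by simp
    qed
    have range: "(real i - 1) * \<eta> \<le> x \<and> x < (real i + 1) * \<eta>"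
      if "(case i of 0 \<Rightarrow> 0 | Suc k \<Rightarrow> q k) \<le> x" "x < q i" "\<And>i. real i * \<eta> \<le> q i" "\<And>i. q i \<le> real (i + 1) * \<eta>" for x q
    proof
      show "(real i - 1) * \<eta> \<le> x"
      proof (cases i)
        case 0
        then show ?thesis using that(1) \<eta>(1) by simp
      next
        case (Suc n)
        then show ?thesis using that(1) that(3)[of n] by simp
      qed
      show "x < (real i + 1) * \<eta>" using that(2) that(4)[of i] by (simp add: add.commute)
    qed
    have "\<bar>g t - t\<bar> < 2 * \<eta>"
      using range[of r t, OF t_ge i(1) r(1,2)] range[of r' "g t", OF g2 g1 r'(1,2)] by (simp add: algebra_simps abs_less_iff)
    moreover have "d (f (g t)) (k t) \<le> 2 * \<delta>"
    proof -
      have "as ! i \<in> M" using as(2) il by (auto simp: subset_iff)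
      moreover have "f (g t) \<in> M" "k t \<in> M"
        using f(1) k(1) t time_change_nonneg[OF g] by (auto simp: cadlag_def PiE_iff)
      ultimately have "d (f (g t)) (k t) \<le> d (as ! i) (f (g t)) + d (as ! i) (k t)"
        using triangle'' by blast
      also have "\<dots> \<le> 2 * \<delta>" using r(5)[OF il i(1) t_ge] r'(5)[OF il g1 g2] by simp
      finally show ?thesis .
    qed
    ultimately show ?thesis using \<eta> by linarith
  qed
  then show ?thesis unfolding skorokhod_nbhd_def using k(1) g by blast
qed

lemma cadlag_right:
  assumes "f \<in> cadlag mtopology" "0 \<le> t" "0 < e"
  obtains t' where "t < t'" "\<And>u. t < u \<Longrightarrow> u < t' \<Longrightarrow> d (f u) (f t) < e"
proof -
  have "\<forall>\<^sub>F u in at_right t. d (f u) (f t) < e"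
  proof -
    have "limitin mtopology f (f t) (at_right t)" using assms(1,2) by (simp add: cadlag_def)
    then have "\<forall>\<^sub>F u in at_right t. f u \<in> M \<and> d (f u) (f t) < e" using assms(3) by (simp add: limitin_metric)
    then show ?thesis by (rule eventually_mono) simp
  qed
  then show ?thesis using that unfolding eventually_at_right_field by blast
qed

lemma cadlag_mem: "f \<in> cadlag mtopology \<Longrightarrow> 0 \<le> t \<Longrightarrow> f t \<in> M"
  by (auto simp: cadlag_def PiE_iff)

lemma cadlag_left:
  assumes "f \<in> cadlag mtopology" "0 < t" "0 < e"
  obtains t' where "t' < t" "\<And>u v. t' < u \<Longrightarrow> u < t \<Longrightarrow> t' < v \<Longrightarrow> v < t \<Longrightarrow> d (f u) (f v) < e"
proof -
  obtain a where a: "limitin mtopology f a (at_left t)" using assms by (auto simp: cadlag_def)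
  then have "\<forall>\<^sub>F u in at_left t. f u \<in> M \<and> d (f u) a < e / 2" and aM: "a \<in> M"
    unfolding limitin_metric using half_gt_zero[OF assms(3)] by blast+
  then obtain t' where t': "t' < t" "\<And>u. t' < u \<Longrightarrow> u < t \<Longrightarrow> f u \<in> M \<and> d (f u) a < e / 2"
    unfolding eventually_at_left_field by blast
  have "d (f u) (f v) < e" if "t' < u" "u < t" "t' < v" "v < t" for u v
    using triangle[of "f u" a "f v"] t'(2)[of u] t'(2)[of v] that aM commute[of a "f v"] by auto
  with t'(1) show ?thesis by (rule that)
qed

lemma cadlag_partition:
  assumes f: "f \<in> cadlag mtopology" and e: "0 < e" and T: "0 \<le> T"
  shows "\<exists>D. finite D \<and> (\<forall>u v. 0 \<le> u \<longrightarrow> u \<le> v \<longrightarrow> v < T \<longrightarrow> D \<inter> {u<..v} = {} \<longrightarrow> d (f u) (f v) < e)"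
proof -
  define P where "P = (\<lambda>a b. \<exists>D. finite D \<and>
    (\<forall>u v. 0 \<le> u \<longrightarrow> a \<le> u \<longrightarrow> u \<le> v \<longrightarrow> v < b \<longrightarrow> D \<inter> {u<..v} = {} \<longrightarrow> d (f u) (f v) < e))"
  have "P 0 T"
    using T
  proof (induction rule: Bolzano)
    case (trans a b c)
    then obtain D D' where D: "finite D" "\<And>u v. 0 \<le> u \<Longrightarrow> a \<le> u \<Longrightarrow> u \<le> v \<Longrightarrow> v < b \<Longrightarrow> D \<inter> {u<..v} = {} \<Longrightarrow> d (f u) (f v) < e"
      and D': "finite D'" "\<And>u v. 0 \<le> u \<Longrightarrow> b \<le> u \<Longrightarrow> u \<le> v \<Longrightarrow> v < c \<Longrightarrow> D' \<inter> {u<..v} = {} \<Longrightarrow> d (f u) (f v) < e"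
      unfolding P_def by metis
    have "d (f u) (f v) < e"
      if "0 \<le> u" "a \<le> u" "u \<le> v" "v < c" "insert b (D \<union> D') \<inter> {u<..v} = {}" for u v
    proof -
      consider "v < b" | "b \<le> u" | "u < b" "b \<le> v" by linarith
      then show ?thesis
      proof cases
        case 1
        moreover have "D \<inter> {u<..v} = {}" using that(5) by blast
        ultimately show ?thesis by (intro D(2) that)
      next
        case 2
        moreover have "D' \<inter> {u<..v} = {}" using that(5) by blast
        ultimately show ?thesis by (intro D'(2) that)
      next
        case 3
        then have "b \<in> insert b (D \<union> D') \<inter> {u<..v}" by simp
        with that(5) show ?thesis by blast
      qed
    qed
    with D(1) D'(1) show ?case unfolding P_def by (intro exI[of _ "insert b (D \<union> D')"]) auto
  next
    case (local x)
  obtain t1 where t1: "x < t1" "\<And>u. x < u \<Longrightarrow> u < t1 \<Longrightarrow> d (f u) (f x) < e / 2"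
    using cadlag_right[OF f local(1), of "e / 2"] e by auto
  obtain t2 where t2: "t2 < x" "\<And>u v. 0 \<le> u \<Longrightarrow> t2 < u \<Longrightarrow> u < x \<Longrightarrow> t2 < v \<Longrightarrow> v < x \<Longrightarrow> d (f u) (f v) < e"
  proof (cases "x = 0")
    case True
    then show ?thesis using that[of "-1"] by auto
  next
    case False
    with local(1) have x: "0 < x" by simp
    show ?thesis
      by (rule cadlag_left[OF f x e]) (rule that)
  qed
  have near: "d (f u) (f x) < e / 2" if "x \<le> u" "u < t1" for u
    using t1(2)[of u] that e cadlag_mem[OF f local(1)] by (cases "u = x") auto
  have "P a b" if "a \<le> x" "x \<le> b" "b - a < min (t1 - x) (x - t2)" for a b
    unfolding P_def
  proof (intro exI[of _ "{x}"] conjI allI impI)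
    fix u v assume uv: "0 \<le> u" "a \<le> u" "u \<le> v" "v < b" "{x} \<inter> {u<..v} = {}"
    show "d (f u) (f v) < e"
    proof (cases "v < x")
      case True
      then show ?thesis using uv that by (intro t2(2)) auto
    next
      case False
      then have u: "x \<le> u" using uv by auto
      then have M: "f u \<in> M" "f v \<in> M" "f x \<in> M" using uv local(1) by (auto intro!: cadlag_mem[OF f])
      have "d (f u) (f x) < e / 2" by (rule near) (use u uv that in auto)
      moreover have "d (f v) (f x) < e / 2" by (rule near) (use u uv that in auto)
      ultimately have "d (f u) (f x) < e / 2" "d (f v) (f x) < e / 2" .
      then show ?thesis using triangle[OF M(1,3,2)] commute[of "f x" "f v"] by simp
    qed
  qed simp
  then show ?case using t1(1) t2(1) by (intro exI[of _ "min (t1 - x) (x - t2)"]) auto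
  qed
  then show ?thesis unfolding P_def by auto
qed

lemma finite_gap:
  fixes D :: "real set"
  assumes "finite D"
  obtains \<gamma> where "0 < \<gamma>" "\<And>x y. x \<in> D \<Longrightarrow> y \<in> D \<Longrightarrow> x \<noteq> y \<Longrightarrow> \<gamma> \<le> \<bar>x - y\<bar>"
proof -
  let ?S = "insert 1 ((\<lambda>(x, y). \<bar>x - y\<bar>) ` {p \<in> D \<times> D. fst p \<noteq> snd p})"
  have fin: "finite ?S" using assms by auto
  have "0 < Min ?S" using fin by (subst Min_gr_iff) auto
  moreover have "Min ?S \<le> \<bar>x - y\<bar>" if "x \<in> D" "y \<in> D" "x \<noteq> y" for x y
    using fin that by (intro Min_le) force+
  ultimately show ?thesis by (rule that)
qed

lemma cadlag_follows:
  assumes f: "f \<in> cadlag mtopology" and T: "0 < T" and \<epsilon>: "0 < \<epsilon>"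
    and S: "S \<subseteq> M" "\<And>x e. x \<in> M \<Longrightarrow> 0 < e \<Longrightarrow> \<exists>y\<in>S. d y x < e"
  shows "\<exists>N n as. set as \<subseteq> S \<and> pattern as \<and> follows (1 / real (Suc N)) (1 / real (Suc n)) as f \<and>
     T < real (length as - 2) * (1 / real (Suc N)) \<and> 2 * (1 / real (Suc N)) < \<epsilon> \<and> 2 * (1 / real (Suc n)) < \<epsilon>"
proof -
  obtain n where n: "1 / real (Suc n) < \<epsilon> / 2"
    using reals_Archimedean[of "\<epsilon> / 2"] \<epsilon> by (auto simp: inverse_eq_divide)
  define \<delta> where "\<delta> = 1 / real (Suc n)"
  have \<delta>: "0 < \<delta>" "2 * \<delta> < \<epsilon>" using n by (auto simp: \<delta>_def)
  define T' where "T' = T + 4"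
  obtain D where D: "finite D" "\<And>u v. 0 \<le> u \<Longrightarrow> u \<le> v \<Longrightarrow> v < T' \<Longrightarrow> D \<inter> {u<..v} = {} \<Longrightarrow> d (f u) (f v) < \<delta> / 2"
    using cadlag_partition[OF f, of "\<delta> / 2" T'] \<delta> T by (auto simp: T'_def)
  define D1 where "D1 = insert 0 (D \<inter> {0..})"
  have fin: "finite D1" using D(1) by (simp add: D1_def)
  obtain \<gamma> where \<gamma>: "0 < \<gamma>" "\<And>x y. x \<in> D1 \<Longrightarrow> y \<in> D1 \<Longrightarrow> x \<noteq> y \<Longrightarrow> \<gamma> \<le> \<bar>x - y\<bar>"
    using finite_gap[OF fin] by blast
  obtain N where N: "1 / real (Suc N) < min 1 (min (\<epsilon> / 2) (\<gamma> / 2))"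
    using reals_Archimedean[of "min 1 (min (\<epsilon> / 2) (\<gamma> / 2))"] \<epsilon> \<gamma>(1) by (auto simp: inverse_eq_divide)
  define \<eta> where "\<eta> = 1 / real (Suc N)"
  have \<eta>: "0 < \<eta>" "2 * \<eta> < \<epsilon>" "2 * \<eta> < \<gamma>" "\<eta> < 1" using N by (auto simp: \<eta>_def)
  have \<eta>Suc: "real (Suc i) * \<eta> = real i * \<eta> + \<eta>" for i by (simp add: distrib_right)
  define m where "m = nat \<lceil>T / \<eta>\<rceil> + 2"
  have "real m = of_int \<lceil>T / \<eta>\<rceil> + 2" using T \<eta> by (simp add: m_def)
  then have "T / \<eta> + 2 \<le> real m" "real m < T / \<eta> + 3" by linarith+
  then have "(T / \<eta> + 2) * \<eta> \<le> real m * \<eta>" "real m * \<eta> < (T / \<eta> + 3) * \<eta>"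
    using \<eta>(1) by (auto intro: mult_right_mono mult_strict_right_mono simp del: times_divide_eq_left)
  then have m: "T + 2 * \<eta> \<le> real m * \<eta>" "real m * \<eta> < T + 3 * \<eta>"
    using \<eta>(1) by (simp_all add: distrib_right)
  have mT': "real m * \<eta> < T'" using m(2) \<eta>(4) by (simp add: T'_def)
  have grid: "0 \<le> real i * \<eta>" for i using \<eta>(1) by simp
  define p where "p = (\<lambda>t. Max {x \<in> D1. x \<le> t})"
  have p: "p t \<in> D1" "p t \<le> t" "0 \<le> p t" "D1 \<inter> {p t<..t} = {}" if "0 \<le> t" for t
  proof -
    have ne: "{x \<in> D1. x \<le> t} \<noteq> {}" using that by (auto simp: D1_def)
    have "p t \<in> {x \<in> D1. x \<le> t}" unfolding p_def using fin ne by (intro Max_in) auto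
    then show "p t \<in> D1" "p t \<le> t" by auto
    then show "0 \<le> p t" by (auto simp: D1_def)
    have "x \<le> p t" if "x \<in> D1" "x \<le> t" for x unfolding p_def using fin that by (intro Max_ge) auto
    then show "D1 \<inter> {p t<..t} = {}" by fastforce
  qed
  have "\<exists>y\<in>S. d y (f (p (real i * \<eta>))) < \<delta> / 2" for i
    by (rule S(2)[OF cadlag_mem[OF f p(3)[OF grid]] half_gt_zero[OF \<delta>(1)]])
  then obtain y where y: "\<And>i. y i \<in> S" "\<And>i. d (y i) (f (p (real i * \<eta>))) < \<delta> / 2"
    by metis
  have close: "d (y i) (f u) \<le> \<delta>" if "p (real i * \<eta>) \<le> u" "u < T'" "D1 \<inter> {p (real i * \<eta>)<..u} = {}" for i u
  proof -
    have p0: "0 \<le> p (real i * \<eta>)" by (rule p(3)[OF grid])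
    then have "D \<inter> {p (real i * \<eta>)<..u} = {}" using that(3) by (auto simp: D1_def)
    then have "d (f (p (real i * \<eta>))) (f u) < \<delta> / 2" using p0 that by (intro D(2)) auto
    moreover have "y i \<in> M" "f (p (real i * \<eta>)) \<in> M" "f u \<in> M"
      using y(1) S(1) p0 that(1) by (auto intro!: cadlag_mem[OF f])
    ultimately show ?thesis using triangle[of "y i" "f (p (real i * \<eta>))" "f u"] y(2)[of i] by simp
  qed
  define y' where "y' = (\<lambda>i. y (LEAST k. p (real k * \<eta>) = p (real i * \<eta>)))"
  have y'_eq: "y' i = y' (Suc i)" if "p (real i * \<eta>) = p (real (Suc i) * \<eta>)" for i
    using that by (simp add: y'_def)
  have least: "p (real (LEAST k. p (real k * \<eta>) = p (real i * \<eta>)) * \<eta>) = p (real i * \<eta>)" for i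
    by (rule LeastI[of "\<lambda>k. p (real k * \<eta>) = p (real i * \<eta>)" i]) simp
  have close': "d (y' i) (f u) \<le> \<delta>" if "p (real i * \<eta>) \<le> u" "u < T'" "D1 \<inter> {p (real i * \<eta>)<..u} = {}" for i u
    unfolding y'_def using that by (intro close) (simp_all only: least)
  have no_jump: "p (real (Suc i) * \<eta>) = p (real i * \<eta>)" if "D1 \<inter> {real i * \<eta><..real (Suc i) * \<eta>} = {}" for i
  proof -
    have "{x \<in> D1. x \<le> real (Suc i) * \<eta>} = {x \<in> D1. x \<le> real i * \<eta>}"
      using that \<eta>(1) \<eta>Suc[of i] by fastforce
    then show ?thesis by (simp only: p_def)
  qed
  define as where "as = map y' [0..<Suc m]"
  have len: "length as = Suc m" by (simp add: as_def)
  have nth: "as ! i = y' i" if "i \<le> m" for i using that unfolding as_def by (subst nth_map) (auto simp del: upt_Suc)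
  have "set as \<subseteq> S" using y(1) by (auto simp: as_def y'_def)
  moreover have "pattern as"
    unfolding pattern_def
  proof (intro conjI allI impI)
    show "2 \<le> length as" by (simp add: len m_def)
    have "D1 \<inter> {real 0 * \<eta><..real (Suc 0) * \<eta>} = {}"
      using \<gamma>(2)[of _ 0] \<eta> by (fastforce simp: D1_def)
    then have "y' 0 = y' (Suc 0)" using no_jump[of 0] y'_eq[of 0] by simp
    then show "as ! 0 = as ! 1" using nth[of 0] nth[of 1] by (simp add: m_def)
    fix i assume i: "i + 2 < length as"
    have "p (real (Suc i) * \<eta>) = p (real i * \<eta>) \<or> p (real (Suc (Suc i)) * \<eta>) = p (real (Suc i) * \<eta>)"
    proof (rule ccontr)
      assume "\<not> ?thesis"
      then have "D1 \<inter> {real i * \<eta><..real (Suc i) * \<eta>} \<noteq> {}"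
        "D1 \<inter> {real (Suc i) * \<eta><..real (Suc (Suc i)) * \<eta>} \<noteq> {}"
        using no_jump[of i] no_jump[of "Suc i"] by blast+
      then obtain x x' where x: "x \<in> D1" "real i * \<eta> < x" "x \<le> real (Suc i) * \<eta>"
        "x' \<in> D1" "real (Suc i) * \<eta> < x'" "x' \<le> real (Suc (Suc i)) * \<eta>"
        by (auto simp del: of_nat_Suc)
      with \<gamma>(2)[of x' x] have "\<gamma> \<le> x' - x" by simp
      with x(2,6)[unfolded \<eta>Suc] \<eta>(3) show False by linarith
    qed
    then have "y' i = y' (Suc i) \<or> y' (Suc i) = y' (Suc (Suc i))" using y'_eq[of i] y'_eq[of "Suc i"] by auto
    then show "as ! i = as ! (i + 1) \<or> as ! (i + 1) = as ! (i + 2)"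
      using i nth[of i] nth[of "i + 1"] nth[of "i + 2"] by (simp add: len)
  qed
  moreover have "follows \<eta> \<delta> as f"
    unfolding follows_def
  proof (intro allI impI)
    fix i assume "i + 1 < length as"
    then have i: "Suc i \<le> m" by (simp add: len)
    have "real (Suc i) * \<eta> \<le> real m * \<eta>" using i \<eta>(1) by (intro mult_right_mono) auto
    then have iT: "real (Suc i) * \<eta> < T'" using mT' by simp
    have pi: "p (real i * \<eta>) \<le> real i * \<eta>" "D1 \<inter> {p (real i * \<eta>)<..real i * \<eta>} = {}" using p grid by auto
    have before: "d (y' i) (f t) \<le> \<delta>" if "real i * \<eta> \<le> t" "t \<le> real (Suc i) * \<eta>" "D1 \<inter> {real i * \<eta><..t} = {}" for t
    proof (rule close')
      show "D1 \<inter> {p (real i * \<eta>)<..t} = {}" using that(3) pi(2) by fastforce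
    qed (use that pi iT in auto)
    have "window \<delta> (y' i) (y' (Suc i)) (real i * \<eta>) (real (Suc i) * \<eta>) f"
    proof (cases "D1 \<inter> {real i * \<eta><..real (Suc i) * \<eta>} = {}")
      case True
      have "y' i = y' (Suc i)" using no_jump[OF True] y'_eq by simp
      moreover have "d (y' i) (f t) \<le> \<delta>" if "real i * \<eta> \<le> t" "t \<le> real (Suc i) * \<eta>" for t
        using that True by (intro before) auto
      ultimately show ?thesis
        unfolding window_def using \<eta>(1) \<eta>Suc[of i] by (intro bexI[of _ "real i * \<eta>"]) auto
    next
      case False
      then obtain x where x: "x \<in> D1" "real i * \<eta> < x" "x \<le> real (Suc i) * \<eta>" by auto
      have uniq: "z = x" if "z \<in> D1" "real i * \<eta> < z" "z \<le> real (Suc i) * \<eta>" for z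
        using \<gamma>(2)[of z x] that x \<eta>(1,3) \<eta>Suc[of i] by linarith
      have "p (real (Suc i) * \<eta>) = x"
        unfolding p_def
      proof (rule Max_eqI)
        show "z \<le> x" if "z \<in> {x \<in> D1. x \<le> real (Suc i) * \<eta>}" for z
          using uniq[of z] that x(2) by (cases "real i * \<eta> < z") auto
      qed (use fin x in auto)
      then have after: "d (y' (Suc i)) (f t) \<le> \<delta>" if "x \<le> t" "t \<le> real (Suc i) * \<eta>" for t
        using that p(4)[OF grid, of "Suc i"] iT by (intro close') (auto simp del: of_nat_Suc)
      have "d (y' i) (f t) \<le> \<delta>" if "real i * \<eta> \<le> t" "t < x" for t
      proof (rule before)
        show "t \<le> real (Suc i) * \<eta>" using that(2) x(3) by simp
        show "D1 \<inter> {real i * \<eta><..t} = {}"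
        proof (rule ccontr)
          assume "\<not> ?thesis"
          then obtain z where "z \<in> D1" "real i * \<eta> < z" "z \<le> t" by auto
          with uniq[of z] that(2) x(3) show False by simp
        qed
      qed (rule that(1))
      with after show ?thesis unfolding window_def using x by (intro bexI[of _ x]) auto
    qed
    then show "window \<delta> (as ! i) (as ! (i + 1)) (real i * \<eta>) (real (i + 1) * \<eta>) f"
      using i nth[of i] nth[of "Suc i"] by simp
  qed
  moreover have "T < real (length as - 2) * \<eta>"
  proof -
    have "real (length as - 2) = real m - 1" by (simp add: len m_def)
    then show ?thesis using m(1) \<eta>(1) by (simp add: left_diff_distrib)
  qed
  ultimately show ?thesis using \<eta>(2) \<delta>(2) unfolding \<eta>_def \<delta>_def by blast
qed

lemma dist_le_right_limit:
  fixes f :: "real \<Rightarrow> 'a"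
  assumes f: "limitin mtopology f (f t) (at_right t)" and c: "c \<in> M" and t: "t < v"
    and R: "\<And>s. s \<in> \<rat> \<Longrightarrow> t < s \<Longrightarrow> s < v \<Longrightarrow> d c (f s) \<le> \<delta>"
  shows "d c (f t) \<le> \<delta>"
proof (rule ccontr)
  assume "\<not> ?thesis"
  then have "0 < d c (f t) - \<delta>" by simp
  then have "\<forall>\<^sub>F u in at_right t. f u \<in> M \<and> d (f u) (f t) < d c (f t) - \<delta>" and ft: "f t \<in> M"
    using f unfolding limitin_metric by blast+
  then obtain t' where t': "t < t'" "\<And>u. t < u \<Longrightarrow> u < t' \<Longrightarrow> f u \<in> M \<and> d (f u) (f t) < d c (f t) - \<delta>"
    unfolding eventually_at_right_field by blast
  obtain s where s: "s \<in> \<rat>" "t < s" "s < min v t'" using Rats_dense_in_real[of t "min v t'"] t t'(1) by auto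
  then have "d c (f t) \<le> d c (f s) + d (f s) (f t)" using c ft t'(2)[of s] by (intro triangle) auto
  also have "\<dots> < \<delta> + (d c (f t) - \<delta>)" using R[of s] t'(2)[of s] s by (intro add_le_less_mono) auto
  finally show False by simp
qed

lemma window_iff_rational:
  assumes f: "f \<in> cadlag mtopology" and pq: "0 \<le> p" "p < q" and ab: "a \<in> M" "b \<in> M"
  shows "window \<delta> a b p q f \<longleftrightarrow> d b (f q) \<le> \<delta> \<and>
    (\<forall>s\<in>\<rat> \<inter> {p..<q}. \<forall>t\<in>\<rat> \<inter> {p..<q}. s < t \<longrightarrow> d b (f t) \<le> \<delta> \<or> d a (f s) \<le> \<delta>)"
proof
  assume "window \<delta> a b p q f"
  then show "d b (f q) \<le> \<delta> \<and>
    (\<forall>s\<in>\<rat> \<inter> {p..<q}. \<forall>t\<in>\<rat> \<inter> {p..<q}. s < t \<longrightarrow> d b (f t) \<le> \<delta> \<or> d a (f s) \<le> \<delta>)"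
    unfolding window_def by (fastforce simp: not_le)
next
  assume rat: "d b (f q) \<le> \<delta> \<and>
    (\<forall>s\<in>\<rat> \<inter> {p..<q}. \<forall>t\<in>\<rat> \<inter> {p..<q}. s < t \<longrightarrow> d b (f t) \<le> \<delta> \<or> d a (f s) \<le> \<delta>)"
  have extend: "d c (f t) \<le> \<delta>" if c: "c \<in> M" and t: "0 \<le> t" "t < v"
    and R: "\<And>s. s \<in> \<rat> \<Longrightarrow> t < s \<Longrightarrow> s < v \<Longrightarrow> d c (f s) \<le> \<delta>" for c t v
    using f t(1) by (intro dist_le_right_limit[OF _ c t(2) R]) (simp_all add: cadlag_def)
  define B where "B = {t \<in> \<rat> \<inter> {p..<q}. \<not> d b (f t) \<le> \<delta>}"
  show "window \<delta> a b p q f"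
  proof (cases "B = {}")
    case True
    have "d b (f t) \<le> \<delta>" if t: "p \<le> t" "t \<le> q" for t
    proof (cases "t = q")
      case False
      show ?thesis
      proof (rule extend[OF ab(2), of t q])
        show "d b (f s) \<le> \<delta>" if "s \<in> \<rat>" "t < s" "s < q" for s using that t(1) True by (auto simp: B_def)
      qed (use t False pq in auto)
    qed (use rat in simp)
    then show ?thesis unfolding window_def using pq by (intro bexI[of _ p]) auto
  next
    case False
    have bdd: "bdd_above B" unfolding B_def by (intro bdd_aboveI[of _ q]) auto
    define r where "r = Sup B"
    have r_ge: "t \<le> r" if "t \<in> B" for t unfolding r_def using that bdd by (rule cSup_upper)
    have "r \<le> q" unfolding r_def using False by (intro cSup_least) (auto simp: B_def)
    note rq = this
    moreover have "p \<le> r" using False r_ge by (fastforce simp: B_def)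
    moreover have "d a (f t) \<le> \<delta>" if t: "p \<le> t" "t < r" for t
    proof (rule extend[OF ab(1), of t r])
      fix s assume s: "s \<in> \<rat>" "t < s" "s < r"
      then obtain t' where "t' \<in> B" and st: "s < t'" unfolding r_def using less_cSup_iff[OF False bdd] by blast
      then have "t' \<in> \<rat> \<inter> {p..<q}" "\<not> d b (f t') \<le> \<delta>" by (auto simp: B_def)
      moreover have "s \<in> \<rat> \<inter> {p..<q}" using s t rq by auto
      ultimately show "d a (f s) \<le> \<delta>" using rat st by blast
    qed (use t pq in auto)
    moreover have "d b (f t) \<le> \<delta>" if t: "r \<le> t" "t \<le> q" for t
    proof (cases "t = q")
      case False
      show ?thesis
      proof (rule extend[OF ab(2), of t q])
        show "d b (f s) \<le> \<delta>" if "s \<in> \<rat>" "t < s" "s < q" for s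
          using r_ge[of s] that t(1) \<open>p \<le> r\<close> by (auto simp: B_def)
      qed (use t False pq \<open>p \<le> r\<close> in auto)
    qed (use rat in simp)
    ultimately show ?thesis unfolding window_def by (intro bexI[of _ r]) auto
  qed
qed

lemma topspace_skorokhod: "topspace (skorokhod_topology M d) = cadlag mtopology"
proof
  show "topspace (skorokhod_topology M d) \<subseteq> cadlag mtopology"
    using openin_topspace[of "skorokhod_topology M d"] unfolding openin_skorokhod_topology by blast
  have "openin (skorokhod_topology M d) (cadlag mtopology)"
    unfolding openin_skorokhod_topology skorokhod_nbhd_def by (auto intro: exI[of _ 1])
  then show "cadlag mtopology \<subseteq> topspace (skorokhod_topology M d)" by (rule openin_subset)
qed

lemma measurable_dist:
  assumes Z: "Z \<in> N \<rightarrow>\<^sub>M borel_of_topology mtopology" and a: "a \<in> M"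
  shows "{\<omega> \<in> space N. d a (Z \<omega>) \<le> \<delta>} \<in> sets N"
proof -
  have Zm: "Z \<omega> \<in> M" if "\<omega> \<in> space N" for \<omega>
    using measurable_space[OF Z that] by (simp add: borel_of_topology_def space_measure_of_conv)
  have "closedin mtopology (mcball a \<delta>)" by (rule closedin_mcball)
  then have "openin mtopology (M - mcball a \<delta>)" by (simp add: closedin_def)
  then have "M - mcball a \<delta> \<in> sets (borel_of_topology mtopology)"
    unfolding borel_of_topology_def
    by (subst sets_measure_of) (auto simp: openin_mtopology intro!: sigma_sets.Basic)
  from measurable_sets[OF Z this] have "space N - Z -` (M - mcball a \<delta>) \<inter> space N \<in> sets N" by auto
  also have "space N - Z -` (M - mcball a \<delta>) \<inter> space N = {\<omega> \<in> space N. d a (Z \<omega>) \<le> \<delta>}"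
    using a Zm by (auto simp: mcball_def)
  finally show ?thesis .
qed

lemma measurable_skorokhod:
  assumes X: "\<And>t. 0 \<le> t \<Longrightarrow> (\<lambda>\<omega>. X \<omega> t) \<in> N \<rightarrow>\<^sub>M borel_of_topology mtopology"
    and C: "{\<omega> \<in> space N. X \<omega> \<in> cadlag mtopology} \<in> sets N"
    and S: "countable S" "S \<subseteq> M" "\<And>x e. x \<in> M \<Longrightarrow> 0 < e \<Longrightarrow> \<exists>y\<in>S. d y x < e"
    and B: "B \<in> sets (borel_of_topology (skorokhod_topology M d))"
  shows "{\<omega> \<in> space N. X \<omega> \<in> B} \<in> sets N"
proof -
  let ?D = "cadlag mtopology"
  let ?C = "{\<omega> \<in> space N. X \<omega> \<in> ?D}"
  have window: "{\<omega> \<in> space N. X \<omega> \<in> ?D \<and> window \<delta> a b p q (X \<omega>)} \<in> sets N"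
    if pq: "0 \<le> p" "p < q" and ab: "a \<in> M" "b \<in> M" for \<delta> a b p q
  proof -
    have "{\<omega> \<in> space N. \<forall>s\<in>\<rat> \<inter> {p..<q}. \<forall>t\<in>\<rat> \<inter> {p..<q}. s < t \<longrightarrow> d b (X \<omega> t) \<le> \<delta> \<or> d a (X \<omega> s) \<le> \<delta>} \<in> sets N"
    proof (intro sets.sets_Collect_countable_All')
      show "countable (\<rat> \<inter> {p..<q})" "countable (\<rat> \<inter> {p..<q})" using countable_rat by auto
      fix s t assume st: "s \<in> \<rat> \<inter> {p..<q}" "t \<in> \<rat> \<inter> {p..<q}"
      show "{\<omega> \<in> space N. s < t \<longrightarrow> d b (X \<omega> t) \<le> \<delta> \<or> d a (X \<omega> s) \<le> \<delta>} \<in> sets N"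
        using st pq by (intro sets.sets_Collect_imp sets.sets_Collect_disj measurable_dist X ab sets.sets_Collect_const) auto
    qed
    moreover have "{\<omega> \<in> space N. d b (X \<omega> q) \<le> \<delta>} \<in> sets N"
      using pq by (intro measurable_dist X ab) auto
    ultimately have "{\<omega> \<in> space N. X \<omega> \<in> ?D \<and> d b (X \<omega> q) \<le> \<delta> \<and>
      (\<forall>s\<in>\<rat> \<inter> {p..<q}. \<forall>t\<in>\<rat> \<inter> {p..<q}. s < t \<longrightarrow> d b (X \<omega> t) \<le> \<delta> \<or> d a (X \<omega> s) \<le> \<delta>)} \<in> sets N"
      using C by (intro sets.sets_Collect_conj)
    also have "?this \<longleftrightarrow> ?thesis"
      by (intro arg_cong[where f="\<lambda>A. A \<in> sets N"] Collect_cong) (use window_iff_rational[OF _ pq ab] in blast)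
    finally show ?thesis .
  qed
  have follows: "{\<omega> \<in> space N. X \<omega> \<in> ?D \<and> follows \<eta> \<delta> as (X \<omega>)} \<in> sets N"
    if "0 < \<eta>" "set as \<subseteq> S" for \<eta> \<delta> as
  proof -
    have all: "{\<omega> \<in> space N. \<forall>i\<in>{i. i + 1 < length as}.
        X \<omega> \<in> ?D \<and> window \<delta> (as ! i) (as ! (i + 1)) (real i * \<eta>) (real (i + 1) * \<eta>) (X \<omega>)} \<in> sets N"
    proof (rule sets.sets_Collect_finite_All)
      show "finite {i. i + 1 < length as}" by (rule finite_subset[of _ "{..<length as}"]) auto
      fix i assume "i \<in> {i. i + 1 < length as}"
      then have "as ! i \<in> M" "as ! (i + 1) \<in> M" using that(2) S(2) by (auto intro!: subsetD[OF S(2)])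
      then show "{\<omega> \<in> space N. X \<omega> \<in> ?D \<and> window \<delta> (as ! i) (as ! (i + 1)) (real i * \<eta>) (real (i + 1) * \<eta>) (X \<omega>)} \<in> sets N"
        using that(1) by (intro window) auto
    qed
    note sets.sets_Collect_conj[OF all C]
    also have "{\<omega> \<in> space N. X \<omega> \<in> ?D \<and> (\<forall>i\<in>{i. i + 1 < length as}.
        X \<omega> \<in> ?D \<and> window \<delta> (as ! i) (as ! (i + 1)) (real i * \<eta>) (real (i + 1) * \<eta>) (X \<omega>))} \<in> sets N \<longleftrightarrow> ?thesis"
      unfolding follows_def by (intro arg_cong[where f="\<lambda>A. A \<in> sets N"] Collect_cong) auto
    finally show ?thesis .
  qed
  have op: "{\<omega> \<in> space N. X \<omega> \<in> A} \<in> sets N" if A: "openin (skorokhod_topology M d) A" for A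
  proof -
    have AD: "A \<subseteq> ?D" using A unfolding openin_skorokhod_topology by blast
    define I where "I = {(N, n, as). set as \<subseteq> S \<and> {f \<in> ?D. follows (1 / real (Suc N)) (1 / real (Suc n)) as f} \<subseteq> A}"
    have "I \<subseteq> UNIV \<times> UNIV \<times> lists S" by (auto simp: I_def)
    then have "countable I" by (rule countable_subset) (intro countable_SIGMA countable_lists S(1), auto)
    have "A = (\<Union>(N, n, as)\<in>I. {f \<in> ?D. follows (1 / real (Suc N)) (1 / real (Suc n)) as f})" (is "A = ?U")
    proof
      show "?U \<subseteq> A" by (auto simp: I_def)
      show "A \<subseteq> ?U"
      proof
        fix f assume f: "f \<in> A"
        then obtain T \<epsilon> where T: "0 < T" "0 < \<epsilon>" "skorokhod_nbhd M d f T \<epsilon> \<subseteq> A"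
          using A unfolding openin_skorokhod_topology by blast
        obtain N n as where as: "set as \<subseteq> S" "pattern as" "follows (1 / real (Suc N)) (1 / real (Suc n)) as f"
          "T < real (length as - 2) * (1 / real (Suc N))" "2 * (1 / real (Suc N)) < \<epsilon>" "2 * (1 / real (Suc n)) < \<epsilon>"
          using cadlag_follows[OF _ T(1,2) S(2,3), of f] f AD by blast
        have "k \<in> A" if k: "k \<in> ?D" "follows (1 / real (Suc N)) (1 / real (Suc n)) as k" for k
          using follows_nbhd[OF as(2) _ _ as(3) k _ as(5,6,4)] as(1) S(2) f AD T(3) by auto
        then have "(N, n, as) \<in> I" using as(1) by (auto simp: I_def)
        then show "f \<in> ?U" using as(3) f AD by auto
      qed
    qed
    then have "{\<omega> \<in> space N. X \<omega> \<in> A} = (\<Union>(n1, n, as)\<in>I. {\<omega> \<in> space N. X \<omega> \<in> ?D \<and> follows (1 / real (Suc n1)) (1 / real (Suc n)) as (X \<omega>)})"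
      by auto
    also have "\<dots> \<in> sets N"
      using \<open>countable I\<close> by (intro sets.countable_UN') (auto simp: I_def intro!: follows)
    finally show ?thesis .
  qed
  have "sets (borel_of_topology (skorokhod_topology M d)) = sigma_sets ?D {U. openin (skorokhod_topology M d) U}"
    unfolding borel_of_topology_def topspace_skorokhod
    by (rule sets_measure_of) (use openin_subset topspace_skorokhod in blast)
  with B have "B \<in> sigma_sets ?D {U. openin (skorokhod_topology M d) U}" by simp
  then show ?thesis
  proof induction
    case (Basic A)
    then show ?case by (intro op) simp
  next
    case (Compl A)
    have "{\<omega> \<in> space N. X \<omega> \<in> ?D - A} = ?C - {\<omega> \<in> space N. X \<omega> \<in> A}" by auto
    with Compl C show ?case by auto
  next
    case (Union A)
    have "{\<omega> \<in> space N. X \<omega> \<in> (\<Union>i. A i)} = (\<Union>i. {\<omega> \<in> space N. X \<omega> \<in> A i})" by auto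
    with Union show ?case by auto
  qed simp
qed

end

section \<open>The path of a chain\<close>

lemma enn2real_pos: "x \<noteq> \<infinity> \<Longrightarrow> x \<noteq> 0 \<Longrightarrow> 0 < enn2real x \<and> x = ennreal (enn2real x)"
  by (cases x) (auto simp: less_le)

context pdmp_setting
begin

sublocale K: Metric_space "with_cemetery M" d by (rule metric)

lemma limitin_Some:
  assumes "(g \<longlongrightarrow> y) F" "y \<in> M" "\<forall>\<^sub>F u in F. g u \<in> M" "\<forall>\<^sub>F u in F. f u = Some (g u)"
  shows "limitin \<tau> f (Some y) F"
  unfolding limitin_def
proof (intro conjI allI impI)
  show "Some y \<in> topspace \<tau>" using assms(2) by (simp add: with_cemetery_iff)
  fix U assume U: "openin \<tau> U \<and> Some y \<in> U"
  then have "openin (top_of_set M) (Some -` U)" by (intro openin_vimage_Some) simp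
  then obtain V where V: "open V" "Some -` U = M \<inter> V" unfolding openin_open by blast
  with U have "y \<in> V" by auto
  with assms(1) V(1) have "\<forall>\<^sub>F u in F. g u \<in> V" by (rule topological_tendstoD)
  then show "\<forall>\<^sub>F u in F. f u \<in> U"
    using assms(3,4)
  proof eventually_elim
    fix u assume "g u \<in> V" "g u \<in> M" "f u = Some (g u)"
    then show "f u \<in> U" using V(2) by (metis IntI vimageD)
  qed
qed

lemma limitin_Some_imp_tendsto:
  assumes f: "limitin \<tau> f (Some y) F" and eq: "\<forall>\<^sub>F u in F. f u = Some (g u)"
  shows "(g \<longlongrightarrow> y) F"
proof (rule topological_tendstoI)
  have y: "y \<in> M" using f by (auto simp: limitin_def with_cemetery_iff)
  fix V assume V: "open V" "y \<in> V"
  have "openin \<tau> (Some ` (M \<inter> V))" using V(1) openin_Some[of "M \<inter> V"] by auto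
  then have "\<forall>\<^sub>F u in F. f u \<in> Some ` (M \<inter> V)" using f V(2) y by (auto simp: limitin_def)
  then show "\<forall>\<^sub>F u in F. g u \<in> V" using eq by eventually_elim auto
qed

abbreviation jump :: "(nat \<Rightarrow> 'a option \<times> ennreal \<times> nat) \<Rightarrow> nat \<Rightarrow> ennreal" where
  "jump c k \<equiv> fst (snd (c k))"

definition good :: "(nat \<Rightarrow> 'a option \<times> ennreal \<times> nat) \<Rightarrow> bool" where
  "good c \<longleftrightarrow> jump c 0 = 0 \<and>
     (\<forall>k. fst (c k) \<in> with_cemetery M \<and> jump c k \<le> jump c (Suc k) \<and> (fst (c k) = None \<longrightarrow> jump c k = \<infinity>))"

lemma next_state_good:
  assumes c: "c \<in> space SS" and J: "J \<in> {jump_time_A \<phi>, jump_time_B \<phi>}"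
    and inv: "fst c = None \<longleftrightarrow> fst (snd c) = \<infinity>"
  shows "fst (snd c) \<le> fst (snd (next_state J c h u))"
    and "fst (next_state J c h u) = None \<longleftrightarrow> fst (snd (next_state J c h u)) = \<infinity>"
proof -
  show "fst (next_state J c h u) = None \<longleftrightarrow> fst (snd (next_state J c h u)) = \<infinity>"
    by (auto simp: next_state_def jump_state_def Let_def split: option.split)
  show "fst (snd c) \<le> fst (snd (next_state J c h u))"
  proof (cases "fst c")
    case None
    then show ?thesis by (simp add: next_state_def)
  next
    case (Some x)
    with c have x: "x \<in> M" by (auto simp: space_SS with_cemetery_iff)
    let ?s = "enn2real (fst (snd c))"
    have "fst (snd c) = ennreal ?s" using inv Some by (simp add: ennreal_enn2real_if)
    also have "\<dots> \<le> first_time l (\<lambda>j. J (rate j) ?s x (h j))"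
      by (rule first_time_jump_ge[OF _ x J]) simp
    also have "\<dots> = fst (snd (next_state J c h u))"
      unfolding next_state_def Some option.case Let_def by (simp add: jump_state_def)
    finally show ?thesis .
  qed
qed

lemma good_iterates:
  assumes w: "w \<in> M" and c0: "c 0 = (Some w, 0, 1)" and J: "J \<in> {jump_time_A \<phi>, jump_time_B \<phi>}"
    and step: "\<And>k. \<exists>h u. c (Suc k) = next_state J (c k) h u"
  shows "good c"
proof -
  have inv: "c k \<in> space SS \<and> (fst (c k) = None \<longleftrightarrow> jump c k = \<infinity>)" for k
  proof (induction k)
    case 0
    then show ?case using w l by (simp add: c0 space_SS with_cemetery_iff)
  next
    case (Suc k)
    obtain h u where "c (Suc k) = next_state J (c k) h u" using step by blast
    then show ?case using Suc next_state_mem[OF _ J] next_state_good(2)[OF _ J] by simp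
  qed
  have "jump c k \<le> jump c (Suc k)" for k
  proof -
    obtain h u where "c (Suc k) = next_state J (c k) h u" using step by blast
    then show ?thesis using inv[of k] next_state_good(1)[OF _ J, of "c k" h u] by simp
  qed
  then show ?thesis unfolding good_def using inv by (simp add: c0 space_SS)
qed

lemma good_chain_A: "w \<in> M \<Longrightarrow> good (chainA w e u)"
  by (rule good_iterates[where J="jump_time_A \<phi>"]) (auto simp: chain_A_mem_Suc(2) simp del: chain_A.simps(2))

lemma good_chain_B:
  assumes "w \<in> M" shows "good (chain_B l \<phi> rate G w e u)"
proof (rule good_iterates[where J="jump_time_B \<phi>", OF assms])
  show "chain_B l \<phi> rate G w e u 0 = (Some w, 0, 1)" by (simp add: chain_B_def)
  show "\<exists>h v. chain_B l \<phi> rate G w e u (Suc k) = next_B (chain_B l \<phi> rate G w e u k) h v" for k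
    unfolding chain_B_eq[OF assms] by (auto simp: Let_def split: prod.split)
qed simp

context
  fixes c assumes c: "good c"
begin

abbreviation (input) "trajectory \<equiv> pdmp_path \<phi> c"
abbreviation (input) "\<zeta> \<equiv> (SUP k. jump c k)"

lemma jump_mono: "i \<le> k \<Longrightarrow> jump c i \<le> jump c k"
proof -
  have "jump c n \<le> jump c (Suc n)" for n using c unfolding good_def by blast
  then show "i \<le> k \<Longrightarrow> jump c i \<le> jump c k" by (rule lift_Suc_mono_le[of "jump c"])
qed

lemma jump_0: "jump c 0 = 0"
  using c by (simp add: good_def)

lemma jump_finite: "jump c k \<noteq> \<infinity> \<Longrightarrow> \<exists>x\<in>M. fst (c k) = Some x"
  using c by (fastforce simp: good_def with_cemetery_iff)

lemma path_eq:
  assumes t: "0 \<le> t" "jump c k \<le> ennreal t" "ennreal t < jump c (Suc k)" and x: "fst (c k) = Some x"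
  shows "trajectory t = Some (\<phi> (enn2real (jump c k)) t x)"
proof -
  have "jump c (Suc k) \<le> \<zeta>" by (rule SUP_upper) simp
  with t(3) have "\<not> \<zeta> \<le> ennreal t" by auto
  moreover have "(GREATEST n. jump c n \<le> ennreal t) = k"
  proof (rule Greatest_equality)
    show "jump c k \<le> ennreal t" by (rule t(2))
    fix n assume n: "jump c n \<le> ennreal t"
    show "n \<le> k"
    proof (rule ccontr)
      assume "\<not> n \<le> k"
      then have "jump c (Suc k) \<le> jump c n" by (intro jump_mono) simp
      with n t(3) show False by simp
    qed
  qed
  ultimately show ?thesis using t(1) x by (simp add: pdmp_path_def Let_def)
qed

lemma path_None: "0 \<le> t \<Longrightarrow> \<zeta> \<le> ennreal t \<Longrightarrow> trajectory t = None"
  by (simp add: pdmp_path_def Let_def)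

lemma jump_interval:
  assumes "0 \<le> t" "ennreal t < \<zeta>"
  obtains k x where "jump c k \<le> ennreal t" "ennreal t < jump c (Suc k)" "fst (c k) = Some x" "x \<in> M"
proof -
  obtain n where n: "ennreal t < jump c n" using assms(2) by (auto simp: less_SUP_iff)
  define m where "m = (LEAST n. ennreal t < jump c n)"
  have m: "ennreal t < jump c m" unfolding m_def using n by (rule LeastI)
  then have "m \<noteq> 0" using jump_0 by (metis not_less_zero)
  then obtain k where k: "m = Suc k" by (cases m) auto
  have "\<not> ennreal t < jump c k" using not_less_Least[of k "\<lambda>n. ennreal t < jump c n"] k by (simp add: m_def)
  then have le: "jump c k \<le> ennreal t" by simp
  then have "jump c k \<noteq> \<infinity>" by (metis ennreal_less_top infinity_ennreal_def leD)
  then obtain x where "x \<in> M" "fst (c k) = Some x" using jump_finite by blast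
  then show ?thesis using that le m k by blast
qed

lemma jump_interval_left:
  assumes "0 < t" "ennreal t \<le> jump c n"
  obtains k x where "jump c k < ennreal t" "ennreal t \<le> jump c (Suc k)" "fst (c k) = Some x" "x \<in> M"
proof -
  define m where "m = (LEAST n. ennreal t \<le> jump c n)"
  have m: "ennreal t \<le> jump c m" unfolding m_def using assms(2) by (rule LeastI)
  have "m \<noteq> 0"
  proof
    assume "m = 0"
    with m jump_0 assms(1) show False by (simp add: ennreal_eq_0_iff)
  qed
  then obtain k where k: "m = Suc k" by (cases m) auto
  have "\<not> ennreal t \<le> jump c k" using not_less_Least[of k "\<lambda>n. ennreal t \<le> jump c n"] k by (simp add: m_def)
  then have le: "jump c k < ennreal t" by simp
  then have "jump c k \<noteq> \<infinity>" by (metis ennreal_less_top infinity_ennreal_def less_imp_not_less)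
  then obtain x where "x \<in> M" "fst (c k) = Some x" using jump_finite by blast
  then show ?thesis using that le m k by blast
qed

lemma path_in: "0 \<le> t \<Longrightarrow> trajectory t \<in> with_cemetery M"
proof (cases "ennreal t < \<zeta>")
  case True
  assume t: "0 \<le> t"
  obtain k x where k: "jump c k \<le> ennreal t" "ennreal t < jump c (Suc k)" "fst (c k) = Some x" "x \<in> M"
    using jump_interval[OF t True] .
  have "enn2real (jump c k) \<le> t" using k(1) t by (simp add: enn2real_leI)
  then show ?thesis using path_eq[OF t k(1-3)] k(4) flow_in by (simp add: with_cemetery_iff)
next
  case False
  then show "0 \<le> t \<Longrightarrow> ?thesis" using path_None by (simp add: with_cemetery_iff not_less)
qed

lemma path_right:
  assumes t: "0 \<le> t" shows "limitin \<tau> trajectory (trajectory t) (at_right t)"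
proof (cases "ennreal t < \<zeta>")
  case True
  obtain k x where k: "jump c k \<le> ennreal t" "ennreal t < jump c (Suc k)" "fst (c k) = Some x" "x \<in> M"
    using jump_interval[OF t True] .
  let ?s = "enn2real (jump c k)"
  have s: "0 \<le> ?s" "?s \<le> t" using k(1) t by (simp_all add: enn2real_leI)
  obtain t' where t': "t < t'" "ennreal t' \<le> jump c (Suc k)"
  proof -
    obtain z where z: "ennreal t < z" "z < jump c (Suc k)" using k(2) dense by blast
    then have "z < \<infinity>" by (metis infinity_ennreal_def less_top order_less_le_trans top_greatest)
    then have "ennreal (enn2real z) = z" by (simp add: ennreal_enn2real_if)
    then show ?thesis using z t ennreal_less_iff[of t "enn2real z"] by (intro that[of "enn2real z"]) auto
  qed
  have ev: "\<forall>\<^sub>F u in at_right t. t < u \<and> u < t'"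
    using t'(1) by (auto simp: eventually_at_right_field)
  have "((\<lambda>u. \<phi> ?s u x) \<longlongrightarrow> \<phi> ?s t x) (at t within {?s..})"
    using continuous_on_flow[OF s(1) k(4)] s(2) by (simp add: continuous_on_def)
  then have tend: "((\<lambda>u. \<phi> ?s u x) \<longlongrightarrow> \<phi> ?s t x) (at_right t)"
    by (rule tendsto_within_subset) (use s in auto)
  have "limitin \<tau> trajectory (Some (\<phi> ?s t x)) (at_right t)"
  proof (rule limitin_Some[OF tend])
    show "\<phi> ?s t x \<in> M" using s k(4) by (intro flow_in)
    show "\<forall>\<^sub>F u in at_right t. \<phi> ?s u x \<in> M" using ev by eventually_elim (use s k(4) in \<open>auto intro!: flow_in\<close>)
    show "\<forall>\<^sub>F u in at_right t. trajectory u = Some (\<phi> ?s u x)"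
      using ev
    proof eventually_elim
      fix u assume u: "t < u \<and> u < t'"
      have "jump c k \<le> ennreal u" using k(1) u by (meson ennreal_leI less_imp_le order_trans)
      moreover have "ennreal u < jump c (Suc k)" using u t t' by (meson ennreal_lessI less_le_trans order_le_less_trans)
      ultimately show "trajectory u = Some (\<phi> ?s u x)" using u t k(3) by (intro path_eq) auto
    qed
  qed
  then show ?thesis using path_eq[OF t k(1-3)] by simp
next
  case False
  then have le: "\<zeta> \<le> ennreal t" by simp
  have "trajectory u = None" if "t \<le> u" for u
    using le that t by (intro path_None) (auto intro: order_trans ennreal_leI)
  then have "\<forall>\<^sub>F u in at_right t. trajectory u = trajectory t"
    using t by (auto simp: eventually_at_right_field intro!: exI[of _ "t + 1"])
  then show ?thesis
    unfolding limitin_def using path_in[OF t] by (auto elim: eventually_mono)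
qed

lemma path_left:
  assumes t: "0 < t" "ennreal t \<noteq> \<zeta>" shows "\<exists>a. limitin \<tau> trajectory a (at_left t)"
proof (cases "ennreal t < \<zeta>")
  case True
  then obtain n where "ennreal t \<le> jump c n" by (auto simp: less_SUP_iff dest: less_imp_le)
  then obtain k x where k: "jump c k < ennreal t" "ennreal t \<le> jump c (Suc k)" "fst (c k) = Some x" "x \<in> M"
    using jump_interval_left[OF t(1)] by blast
  let ?s = "enn2real (jump c k)"
  have js: "jump c k = ennreal ?s" using k(1) by (metis ennreal_enn2real infinity_ennreal_def less_top order_less_trans ennreal_less_top)
  have s: "0 \<le> ?s" "?s < t" using k(1) t(1) js ennreal_less_iff[of ?s t] by auto
  have ev: "\<forall>\<^sub>F u in at_left t. ?s < u \<and> u < t"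
    using s by (auto simp: eventually_at_left_field)
  have "((\<lambda>u. \<phi> ?s u x) \<longlongrightarrow> \<phi> ?s t x) (at t within {?s..})"
    using continuous_on_flow[OF s(1) k(4)] s(2) by (simp add: continuous_on_def)
  then have "((\<lambda>u. \<phi> ?s u x) \<longlongrightarrow> \<phi> ?s t x) (at t within {?s..t})"
    by (rule tendsto_within_subset) auto
  then have tend: "((\<lambda>u. \<phi> ?s u x) \<longlongrightarrow> \<phi> ?s t x) (at_left t)"
    using s(2) by (simp add: at_within_Icc_at_left)
  have "limitin \<tau> trajectory (Some (\<phi> ?s t x)) (at_left t)"
  proof (rule limitin_Some[OF tend])
    show "\<phi> ?s t x \<in> M" using s k(4) by (intro flow_in) auto
    show "\<forall>\<^sub>F u in at_left t. \<phi> ?s u x \<in> M" using ev by eventually_elim (use s k(4) in \<open>auto intro!: flow_in\<close>)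
    show "\<forall>\<^sub>F u in at_left t. trajectory u = Some (\<phi> ?s u x)"
      using ev
    proof eventually_elim
      fix u assume u: "?s < u \<and> u < t"
      have "jump c k \<le> ennreal u" using js u by (metis ennreal_leI less_imp_le)
      moreover have "ennreal u < jump c (Suc k)" using u s k(2) by (meson ennreal_lessI less_le_trans order_le_less_trans)
      moreover have "0 \<le> u" using s(1) u by linarith
      ultimately show "trajectory u = Some (\<phi> ?s u x)" using k(3) by (intro path_eq)
    qed
  qed
  then show ?thesis by blast
next
  case False
  with t(2) have lt: "\<zeta> < ennreal t" by simp
  let ?z = "enn2real \<zeta>"
  have z: "\<zeta> = ennreal ?z" using lt by (metis ennreal_enn2real infinity_ennreal_def less_top order_less_trans ennreal_less_top)
  have zt: "0 \<le> ?z" "?z < t" using lt z t(1) ennreal_less_iff[of ?z t] by auto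
  have "\<forall>\<^sub>F u in at_left t. ?z < u" using zt by (auto simp: eventually_at_left_field)
  then have "\<forall>\<^sub>F u in at_left t. trajectory u = None"
  proof eventually_elim
    fix u assume u: "?z < u"
    have "\<zeta> \<le> ennreal u" using z u by (metis ennreal_leI less_imp_le)
    moreover have "0 \<le> u" using zt(1) u by linarith
    ultimately show "trajectory u = None" by (intro path_None)
  qed
  then have "limitin \<tau> trajectory None (at_left t)"
    unfolding limitin_def by (auto simp: with_cemetery_iff elim: eventually_mono)
  then show ?thesis by blast
qed

lemma path_cadlag_iff:
  "trajectory \<in> cadlag \<tau> \<longleftrightarrow> \<zeta> = \<infinity> \<or> \<zeta> = 0 \<or> (\<exists>a. limitin \<tau> trajectory a (at_left (enn2real \<zeta>)))"
proof
  assume p: "trajectory \<in> cadlag \<tau>"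
  show "\<zeta> = \<infinity> \<or> \<zeta> = 0 \<or> (\<exists>a. limitin \<tau> trajectory a (at_left (enn2real \<zeta>)))"
  proof (cases "\<zeta> = \<infinity> \<or> \<zeta> = 0")
    case False
    then have "0 < enn2real \<zeta>" using enn2real_pos[of \<zeta>] by blast
    then show ?thesis using p by (auto simp: cadlag_def)
  qed blast
next
  assume R: "\<zeta> = \<infinity> \<or> \<zeta> = 0 \<or> (\<exists>a. limitin \<tau> trajectory a (at_left (enn2real \<zeta>)))"
  have "\<exists>a. limitin \<tau> trajectory a (at_left t)" if t: "0 < t" for t
  proof (cases "ennreal t = \<zeta>")
    case True
    then have "enn2real \<zeta> = t" "\<zeta> \<noteq> \<infinity>" "\<zeta> \<noteq> 0" using t by (metis enn2real_ennreal less_imp_le, auto simp flip: True)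
    with R show ?thesis by auto
  qed (use path_left t in blast)
  moreover have "trajectory \<in> {0..} \<rightarrow>\<^sub>E with_cemetery M"
    using path_in by (auto simp: PiE_iff pdmp_path_def Let_def)
  ultimately show "trajectory \<in> cadlag \<tau>" unfolding cadlag_def using path_right by auto
qed

lemma cadlag_or_explodes: "trajectory \<in> cadlag \<tau> \<or> explodes_without_limit \<tau> c trajectory"
proof (cases "trajectory \<in> cadlag \<tau>")
  case False
  then have "\<zeta> \<noteq> \<infinity>" "\<zeta> \<noteq> 0" "\<not> (\<exists>a. limitin \<tau> trajectory a (at_left (enn2real \<zeta>)))"
    unfolding path_cadlag_iff by auto
  with enn2real_pos[of \<zeta>] show ?thesis
    unfolding explodes_without_limit_def by (intro disjI2 exI[of _ "enn2real \<zeta>"]) blast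
qed simp

end

definition base_point :: 'a where "base_point = (SOME w. w \<in> M)"

lemma base_point: "base_point \<in> M"
  unfolding base_point_def using nonempty by (simp add: some_in_eq)

definition position :: "'a option \<Rightarrow> 'a" where
  "position y = (case y of None \<Rightarrow> base_point | Some x \<Rightarrow> x)"

lemma measurable_position: "position \<in> OM \<rightarrow>\<^sub>M manifold_borel M"
  unfolding position_def using base_point
  by (intro measurable_case_OM[of "\<lambda>y. y" OM "\<lambda>_. base_point" _ "\<lambda>_ x. x"]) (auto simp: split_beta)

lemma manifold_borel_dist:
  assumes "f \<in> N \<rightarrow>\<^sub>M manifold_borel M" "g \<in> N \<rightarrow>\<^sub>M manifold_borel M"
  shows "(\<lambda>\<omega>. dist (f \<omega>) (g \<omega>)) \<in> borel_measurable N"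
proof -
  have "(\<lambda>x. x) \<in> manifold_borel M \<rightarrow>\<^sub>M borel"
    unfolding manifold_borel_def by (rule measurable_restrict_space1) simp
  from measurable_compose[OF assms(1) this] measurable_compose[OF assms(2) this]
  show ?thesis by simp
qed

text \<open>The first alternative is convergence to the cemetery, the second one the Cauchy criterion in the
  closed set \<open>M\<close>; by right continuity rational times suffice.\<close>

lemma left_limit_iff:
  assumes c: "good c" and z: "(SUP k. jump c k) = ennreal z" "0 < z"
  defines "p \<equiv> pdmp_path \<phi> c"
  shows "(\<exists>a. limitin \<tau> p a (at_left z)) \<longleftrightarrow>
    (\<forall>n. \<exists>q\<in>\<rat> \<inter> {0..}. q < z \<and> (\<forall>s\<in>\<rat> \<inter> {0..}. q < s \<and> s < z \<longrightarrow> d None (p s) \<le> 1 / real (Suc n))) \<or>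
    (\<forall>n. \<exists>q\<in>\<rat> \<inter> {0..}. q < z \<and> (\<forall>s\<in>\<rat> \<inter> {0..}. \<forall>s'\<in>\<rat> \<inter> {0..}. q < s \<and> s < z \<and> q < s' \<and> s' < z \<longrightarrow>
        dist (position (p s)) (position (p s')) \<le> 1 / real (Suc n)))"
    (is "?L \<longleftrightarrow> ?A \<or> ?B")
proof
  let ?g = "\<lambda>u. position (p u)"
  have p: "p u = Some (?g u)" "?g u \<in> M" if "0 \<le> u" "u < z" for u
  proof -
    have "ennreal u < (SUP k. jump c k)" using that z by (simp add: ennreal_less_iff)
    from jump_interval[OF c that(1) this] obtain k x
      where k: "jump c k \<le> ennreal u" "ennreal u < jump c (Suc k)" "fst (c k) = Some x" "x \<in> M" .
    have "enn2real (jump c k) \<le> u" using k(1) that(1) by (simp add: enn2real_leI)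
    with path_eq[OF c that(1) k(1-3)] k(4) flow_in[of "enn2real (jump c k)" u x]
    show "p u = Some (?g u)" "?g u \<in> M" by (simp_all add: p_def position_def)
  qed
  have left: "\<forall>\<^sub>F u in at_left z. p u = Some (?g u)"
    using z(2) p(1) by (auto simp: eventually_at_left_field intro!: exI[of _ 0])
  show "?A \<or> ?B" if ?L
  proof -
    from that obtain a where a: "limitin \<tau> p a (at_left z)" by blast
    have rat: "\<exists>q\<in>\<rat> \<inter> {0..}. q < z \<and> (\<forall>u. q < u \<and> u < z \<longrightarrow> P u)" if "\<forall>\<^sub>F u in at_left z. P u" for P
    proof -
      from that obtain b where b: "b < z" "\<And>u. b < u \<Longrightarrow> u < z \<Longrightarrow> P u" by (auto simp: eventually_at_left_field)
      obtain q where "q \<in> \<rat>" "max 0 b < q" "q < z" using Rats_dense_in_real[of "max 0 b" z] b(1) z(2) by auto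
      with b(2) show ?thesis by (intro bexI[of _ q]) auto
    qed
    show ?thesis
    proof (cases a)
      case None
      have "\<forall>\<^sub>F u in at_left z. d None (p u) \<le> 1 / real (Suc n)" for n
      proof -
        have "0 < 1 / real (Suc n)" by simp
        then have "\<forall>\<^sub>F u in at_left z. p u \<in> with_cemetery M \<and> d (p u) None < 1 / real (Suc n)"
          using a None unfolding K.limitin_metric by blast
        then show ?thesis by eventually_elim (simp add: K.commute)
      qed
      from rat[OF this] have ?A by meson
      then show ?thesis ..
    next
      case (Some y)
      have tend: "(?g \<longlongrightarrow> y) (at_left z)"
        using a left unfolding Some by (rule limitin_Some_imp_tendsto)
      have ?B
      proof
        fix n
        have "\<forall>\<^sub>F u in at_left z. dist (?g u) y < 1 / (2 * real (Suc n))"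
          using tend by (rule tendstoD) simp
        from rat[OF this] obtain q where q: "q \<in> \<rat> \<inter> {0..}" "q < z"
          "\<And>u. q < u \<and> u < z \<Longrightarrow> dist (?g u) y < 1 / (2 * real (Suc n))" by blast
        have "dist (?g s) (?g s') \<le> 1 / real (Suc n)" if "q < s \<and> s < z \<and> q < s' \<and> s' < z" for s s'
        proof -
          have "dist (?g s) (?g s') \<le> dist (?g s) y + dist (?g s') y" by (rule dist_triangle2)
          also have "\<dots> \<le> 1 / (2 * real (Suc n)) + 1 / (2 * real (Suc n))"
            using q(3)[of s] q(3)[of s'] that by (intro add_mono less_imp_le) auto
          also have "\<dots> = 1 / real (Suc n)" by (simp add: field_simps del: of_nat_Suc)
          finally show ?thesis .
        qed
        with q(1,2) show "\<exists>q\<in>\<rat> \<inter> {0..}. q < z \<and> (\<forall>s\<in>\<rat> \<inter> {0..}. \<forall>s'\<in>\<rat> \<inter> {0..}. q < s \<and> s < z \<and> q < s' \<and> s' < z \<longrightarrow>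
            dist (?g s) (?g s') \<le> 1 / real (Suc n))" by blast
      qed
      then show ?thesis ..
    qed
  qed
  have right: "limitin \<tau> p (p u) (at_right u)" if "0 \<le> u" for u
    unfolding p_def by (rule path_right[OF c that])
  have small: "\<exists>n. 1 / real (Suc n) < e" if "0 < e" for e :: real
    using reals_Archimedean[OF that] by (simp add: inverse_eq_divide)
  show ?L if "?A \<or> ?B"
    using that
  proof
    assume A: ?A
    have "limitin \<tau> p None (at_left z)"
      unfolding K.limitin_metric
    proof (intro conjI allI impI)
      show None: "None \<in> with_cemetery M" by (simp add: with_cemetery_iff)
      fix e :: real assume "0 < e"
      then obtain n where n: "1 / real (Suc n) < e" using small by blast
      obtain q where q: "0 \<le> q" "q < z" "\<And>s. s \<in> \<rat> \<Longrightarrow> 0 \<le> s \<Longrightarrow> q < s \<Longrightarrow> s < z \<Longrightarrow> d None (p s) \<le> 1 / real (Suc n)"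
        using A by (metis IntE IntI atLeast_iff)
      have "p u \<in> with_cemetery M \<and> d (p u) None < e" if u: "q < u" "u < z" for u
      proof -
        have "d None (p u) \<le> 1 / real (Suc n)"
          using q u by (intro K.dist_le_right_limit[OF right None u(2)] q(3)) auto
        then show ?thesis using n path_in[OF c, of u] q(1) u(1) by (simp add: K.commute p_def)
      qed
      then show "\<forall>\<^sub>F u in at_left z. p u \<in> with_cemetery M \<and> d (p u) None < e"
        using q(2) by (auto simp: eventually_at_left_field intro!: exI[of _ q])
    qed
    then show ?L by blast
  next
    assume B: ?B
    have close: "\<exists>q. 0 \<le> q \<and> q < z \<and> (\<forall>u v. q < u \<longrightarrow> u < z \<longrightarrow> q < v \<longrightarrow> v < z \<longrightarrow> dist (?g u) (?g v) \<le> 1 / real (Suc n))" for n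
    proof -
      obtain q where q: "0 \<le> q" "q < z"
        "\<And>s s'. s \<in> \<rat> \<Longrightarrow> 0 \<le> s \<Longrightarrow> s' \<in> \<rat> \<Longrightarrow> 0 \<le> s' \<Longrightarrow> q < s \<Longrightarrow> s < z \<Longrightarrow> q < s' \<Longrightarrow> s' < z \<Longrightarrow>
          dist (?g s) (?g s') \<le> 1 / real (Suc n)"
        using B by (metis IntE IntI atLeast_iff)
      have tend: "(?g \<longlongrightarrow> ?g u) (at_right u)" if u: "0 \<le> u" "u < z" for u
      proof (rule limitin_Some_imp_tendsto)
        show "limitin \<tau> p (Some (?g u)) (at_right u)" using right[OF u(1)] p(1)[OF u] by simp
        show "\<forall>\<^sub>F v in at_right u. p v = Some (?g v)"
          using u p(1) by (auto simp: eventually_at_right_field intro!: exI[of _ z])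
      qed
      have ext: "dist y (?g u) \<le> 1 / real (Suc n)"
        if "q < u" "u < z" "\<And>s. s \<in> \<rat> \<Longrightarrow> u < s \<Longrightarrow> s < z \<Longrightarrow> dist y (?g s) \<le> 1 / real (Suc n)" for y u
        using tend[of u] that q(1)
        by (intro Met_TC.dist_le_right_limit[of ?g u y z]) (auto simp: mtopology_is_euclidean)
      have 1: "dist (?g s) (?g v) \<le> 1 / real (Suc n)" if "s \<in> \<rat>" "q < s" "s < z" "q < v" "v < z" for s v
        by (rule ext) (use that q in auto)
      have "dist (?g u) (?g v) \<le> 1 / real (Suc n)" if "q < u" "u < z" "q < v" "v < z" for u v
      proof (rule ext)
        show "dist (?g u) (?g s) \<le> 1 / real (Suc n)" if "s \<in> \<rat>" "v < s" "s < z" for s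
          using 1[of s u] that \<open>q < u\<close> \<open>u < z\<close> \<open>q < v\<close> by (simp add: dist_commute)
      qed (use that in auto)
      with q(1,2) show ?thesis by blast
    qed
    define u where "u = (\<lambda>k. z - z / real (Suc k))"
    have u0: "0 \<le> u k" "u k < z" for k using z(2) by (simp_all add: u_def field_simps)
    have "(\<lambda>k. z / real (Suc k)) \<longlonglongrightarrow> 0" by (rule LIMSEQ_Suc) (rule lim_const_over_n)
    from tendsto_diff[OF tendsto_const this, of z] have "u \<longlonglongrightarrow> z" by (simp add: u_def)
    then have u_ev: "\<forall>\<^sub>F k in sequentially. q < u k" if "q < z" for q
      using that by (rule order_tendstoD)
    have "Cauchy (\<lambda>k. ?g (u k))"
    proof (rule metric_CauchyI)
      fix e :: real assume "0 < e"
      then obtain n where n: "1 / real (Suc n) < e" using small by blast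
      obtain q where q: "q < z" "\<And>u v. q < u \<Longrightarrow> u < z \<Longrightarrow> q < v \<Longrightarrow> v < z \<Longrightarrow> dist (?g u) (?g v) \<le> 1 / real (Suc n)"
        using close by blast
      obtain k0 where "\<And>k. k0 \<le> k \<Longrightarrow> q < u k" using u_ev[OF q(1)] by (auto simp: eventually_sequentially)
      then have "dist (?g (u i)) (?g (u k)) < e" if "k0 \<le> i" "k0 \<le> k" for i k
        using q(2)[of "u i" "u k"] u0 that n by (meson le_less_trans)
      then show "\<exists>k0. \<forall>i\<ge>k0. \<forall>k\<ge>k0. dist (?g (u i)) (?g (u k)) < e" by blast
    qed
    then obtain y where y: "(\<lambda>k. ?g (u k)) \<longlonglongrightarrow> y" by (meson Cauchy_convergent convergent_def)
    have yM: "y \<in> M" using closed_sequentially[OF closed _ y] p(2)[OF u0] by blast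
    have "(?g \<longlongrightarrow> y) (at_left z)"
    proof (rule tendstoI)
      fix e :: real assume "0 < e"
      then obtain n where n: "1 / real (Suc n) < e" using small by blast
      obtain q where q: "q < z" "\<And>u v. q < u \<Longrightarrow> u < z \<Longrightarrow> q < v \<Longrightarrow> v < z \<Longrightarrow> dist (?g u) (?g v) \<le> 1 / real (Suc n)"
        using close by blast
      have "dist (?g v) y < e" if v: "q < v" "v < z" for v
      proof -
        have "(\<lambda>k. dist (?g v) (?g (u k))) \<longlonglongrightarrow> dist (?g v) y" using y by (intro tendsto_intros)
        moreover have "\<forall>\<^sub>F k in sequentially. dist (?g v) (?g (u k)) \<le> 1 / real (Suc n)"
          using u_ev[OF q(1)] by eventually_elim (rule q(2)[OF v _ u0(2)])
        ultimately have "dist (?g v) y \<le> 1 / real (Suc n)" by (rule tendsto_upperbound) simp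
        with n show ?thesis by simp
      qed
      then show "\<forall>\<^sub>F v in at_left z. dist (?g v) y < e"
        using q(1) by (auto simp: eventually_at_left_field intro!: exI[of _ q])
    qed
    then have "limitin \<tau> p (Some y) (at_left z)"
    proof (rule limitin_Some[OF _ yM _ left])
      show "\<forall>\<^sub>F v in at_left z. ?g v \<in> M"
        using z(2) p(2) by (auto simp: eventually_at_left_field intro!: exI[of _ 0])
    qed
    then show ?L by blast
  qed
qed

abbreviation "CS \<equiv> PiM (UNIV :: nat set) (\<lambda>_. SS)"
abbreviation "GS \<equiv> restrict_space CS {c. good c}"

lemma measurable_CS_component: "(\<lambda>c. c k) \<in> CS \<rightarrow>\<^sub>M SS"
  by simp

lemma measurable_GS_component: "(\<lambda>c. c k) \<in> GS \<rightarrow>\<^sub>M SS"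
  by (rule measurable_restrict_space1[OF measurable_CS_component])

lemma space_GS: "space GS = {c \<in> space CS. good c}"
  by (auto simp: space_restrict_space)

lemma good_set: "{c \<in> space CS. good c} \<in> sets CS"
proof -
  have mem: "fst (c k) \<in> with_cemetery M" if "c \<in> space CS" for c k
    using that by (auto simp: space_PiM PiE_iff space_SS)
  define S where "S = (\<lambda>k c. jump c k)"
  have [measurable]: "S k \<in> borel_measurable CS" for k
    unfolding S_def by (rule measurable_SS(2)[OF measurable_CS_component])
  have none: "{c \<in> space CS. fst (c k) = None} \<in> sets CS" for k
    using measurable_sets[OF measurable_SS(1)[OF measurable_CS_component] None_in_OM, of k]
    by (simp add: vimage_def Int_def conj_commute)
  have 0: "{c \<in> space CS. S 0 c = 0} \<in> sets CS" by measurable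
  have 1: "{c \<in> space CS. S k c \<le> S (Suc k) c} \<in> sets CS" for k by measurable
  have 2: "{c \<in> space CS. S k c = \<infinity>} \<in> sets CS" for k by measurable
  have "{c \<in> space CS. S 0 c = 0 \<and> (\<forall>k. S k c \<le> S (Suc k) c \<and> (fst (c k) = None \<longrightarrow> S k c = \<infinity>))} \<in> sets CS"
    by (intro sets.sets_Collect_conj sets.sets_Collect_countable_All sets.sets_Collect_imp none 0 1 2)
  also have "{c \<in> space CS. S 0 c = 0 \<and> (\<forall>k. S k c \<le> S (Suc k) c \<and> (fst (c k) = None \<longrightarrow> S k c = \<infinity>))}
      = {c \<in> space CS. good c}"
    using mem by (auto simp: good_def S_def)
  finally show ?thesis .
qed

lemma measurable_jump: "(\<lambda>c. jump c k) \<in> borel_measurable GS"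
  by (rule measurable_SS(2)[OF measurable_GS_component])

lemma measurable_path:
  assumes t: "0 \<le> t" shows "(\<lambda>c. pdmp_path \<phi> c t) \<in> GS \<rightarrow>\<^sub>M OM"
proof -
  define \<kappa> where "\<kappa> = (\<lambda>c. LEAST n. ennreal t < jump c (Suc n))"
  define f where "f = (\<lambda>k c. case fst (c k) of None \<Rightarrow> None
     | Some x \<Rightarrow> Some (\<phi> (min (enn2real (jump c k)) t) t x))"
  note [measurable] = measurable_jump
  have \<kappa>: "\<kappa> \<in> GS \<rightarrow>\<^sub>M count_space UNIV"
    unfolding \<kappa>_def by measurable
  have f: "f k \<in> GS \<rightarrow>\<^sub>M OM" for k
    unfolding f_def
  proof (rule measurable_case_OM[OF measurable_SS(1)[OF measurable_GS_component]], unfold split_beta)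
    show "(\<lambda>_. None) \<in> GS \<rightarrow>\<^sub>M OM" by (rule measurable_const) (simp add: with_cemetery_iff)
    have "(\<lambda>p. \<phi> (min (enn2real (jump (fst p) k)) t) t (snd p)) \<in> GS \<Otimes>\<^sub>M manifold_borel M \<rightarrow>\<^sub>M manifold_borel M"
      using measurable_compose[OF measurable_fst measurable_jump[of k]] t
      by (intro measurable_flow) auto
    from measurable_compose[OF this measurable_Some]
    show "(\<lambda>p. Some (\<phi> (min (enn2real (jump (fst p) k)) t) t (snd p))) \<in> GS \<Otimes>\<^sub>M manifold_borel M \<rightarrow>\<^sub>M OM" .
  qed
  have "(\<lambda>c. f (\<kappa> c) c) \<in> GS \<rightarrow>\<^sub>M OM"
    by (rule measurable_compose_countable'[OF f \<kappa>]) simp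
  moreover have "{c \<in> space GS. (SUP k. jump c k) \<le> ennreal t} \<in> sets GS" by measurable
  ultimately have "(\<lambda>c. if (SUP k. jump c k) \<le> ennreal t then None else f (\<kappa> c) c) \<in> GS \<rightarrow>\<^sub>M OM"
    by (intro measurable_If measurable_const) (simp_all add: with_cemetery_iff)
  also have "?this \<longleftrightarrow> ?thesis"
  proof (rule measurable_cong)
    fix c assume "c \<in> space GS"
    then have c: "good c" by (simp add: space_GS)
    show "(if (SUP k. jump c k) \<le> ennreal t then None else f (\<kappa> c) c) = pdmp_path \<phi> c t"
    proof (cases "(SUP k. jump c k) \<le> ennreal t")
      case True
      then show ?thesis using path_None[OF c t] by simp
    next
      case False
      then obtain k x where k: "jump c k \<le> ennreal t" "ennreal t < jump c (Suc k)" "fst (c k) = Some x"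
        using jump_interval[OF c t] by (metis not_le)
      have "\<kappa> c = k"
        unfolding \<kappa>_def
      proof (rule Least_equality)
        fix n assume n: "ennreal t < jump c (Suc n)"
        show "k \<le> n"
        proof (rule ccontr)
          assume "\<not> k \<le> n"
          then have "jump c (Suc n) \<le> jump c k" by (intro jump_mono[OF c]) simp
          with n k(1) show False by simp
        qed
      qed (rule k(2))
      moreover have "enn2real (jump c k) \<le> t" using k(1) t by (simp add: enn2real_leI)
      ultimately show ?thesis using False k(3) path_eq[OF c t k] by (simp add: f_def)
    qed
  qed
  finally show ?thesis .
qed

lemma measurable_cadlag: "{c \<in> space GS. pdmp_path \<phi> c \<in> cadlag \<tau>} \<in> sets GS"
proof -
  note [measurable] = measurable_jump
  define \<zeta> where "\<zeta> = (\<lambda>c. SUP k. jump c k)"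
  have \<zeta>: "(SUP k. jump c k) = \<zeta> c" for c unfolding \<zeta>_def ..
  have [measurable]: "\<zeta> \<in> borel_measurable GS" unfolding \<zeta>_def by measurable
  let ?p = "\<lambda>c. pdmp_path \<phi> c"
  have cQ: "countable (\<rat> \<inter> {0::real..})" using countable_rat by auto
  have lt: "{c \<in> space GS. s < enn2real (\<zeta> c)} \<in> sets GS" for s by measurable
  have None: "None \<in> with_cemetery M" by (simp add: with_cemetery_iff)
  have A: "{c \<in> space GS. \<forall>n. \<exists>q\<in>\<rat> \<inter> {0..}. q < enn2real (\<zeta> c) \<and>
      (\<forall>s\<in>\<rat> \<inter> {0..}. q < s \<and> s < enn2real (\<zeta> c) \<longrightarrow> d None (?p c s) \<le> 1 / real (Suc n))} \<in> sets GS" (is "?A \<in> _")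
    by (intro sets.sets_Collect_countable_All sets.sets_Collect_countable_Ex'[OF _ cQ] sets.sets_Collect_conj
        sets.sets_Collect_countable_All'[OF _ cQ] sets.sets_Collect_imp lt sets.sets_Collect_const
        K.measurable_dist[OF measurable_path None]) auto
  have pos: "(\<lambda>c. position (?p c s)) \<in> GS \<rightarrow>\<^sub>M manifold_borel M" if "s \<in> \<rat> \<inter> {0..}" for s
    using that by (intro measurable_compose[OF measurable_path measurable_position]) auto
  have dist_set: "{c \<in> space GS. dist (position (?p c s)) (position (?p c s')) \<le> r} \<in> sets GS"
    if "s \<in> \<rat> \<inter> {0..}" "s' \<in> \<rat> \<inter> {0..}" for s s' r
  proof -
    have [measurable]: "(\<lambda>c. dist (position (?p c s)) (position (?p c s'))) \<in> borel_measurable GS"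
      by (rule manifold_borel_dist[OF pos[OF that(1)] pos[OF that(2)]])
    show ?thesis by measurable
  qed
  have B: "{c \<in> space GS. \<forall>n. \<exists>q\<in>\<rat> \<inter> {0..}. q < enn2real (\<zeta> c) \<and>
      (\<forall>s\<in>\<rat> \<inter> {0..}. \<forall>s'\<in>\<rat> \<inter> {0..}. q < s \<and> s < enn2real (\<zeta> c) \<and> q < s' \<and> s' < enn2real (\<zeta> c) \<longrightarrow>
        dist (position (?p c s)) (position (?p c s')) \<le> 1 / real (Suc n))} \<in> sets GS" (is "?B \<in> _")
    by (intro sets.sets_Collect_countable_All sets.sets_Collect_countable_Ex'[OF _ cQ] sets.sets_Collect_conj
        sets.sets_Collect_countable_All'[OF _ cQ] sets.sets_Collect_imp lt sets.sets_Collect_const dist_set) auto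
  have "{c \<in> space GS. pdmp_path \<phi> c \<in> cadlag \<tau>}
      = {c \<in> space GS. \<zeta> c = \<infinity>} \<union> {c \<in> space GS. \<zeta> c = 0} \<union> (?A \<union> ?B)"
    (is "?C = ?U")
  proof (intro set_eqI)
    fix c
    show "c \<in> ?C \<longleftrightarrow> c \<in> ?U"
    proof (cases "c \<in> space GS \<and> \<zeta> c \<noteq> \<infinity> \<and> \<zeta> c \<noteq> 0")
      case True
      then have c: "good c" "c \<in> space GS" by (auto simp: space_GS)
      have z: "(SUP k. jump c k) = ennreal (enn2real (\<zeta> c))" "0 < enn2real (\<zeta> c)"
        using True enn2real_pos[of "\<zeta> c"] unfolding \<zeta> by blast+
      have "c \<in> ?C \<longleftrightarrow> (\<exists>a. limitin \<tau> (?p c) a (at_left (enn2real (\<zeta> c))))"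
        using path_cadlag_iff[OF c(1), unfolded \<zeta>] True by blast
      then show ?thesis
        unfolding left_limit_iff[OF c(1) z] using True by blast
    next
      case False
      then show ?thesis using path_cadlag_iff[of c, unfolded \<zeta>] space_GS by blast
    qed
  qed
  also have "\<dots> \<in> sets GS" using A B by measurable
  finally show ?thesis .
qed

lemma cemetery_dense:
  obtains S where "countable S" "S \<subseteq> with_cemetery M"
    "\<And>x e. x \<in> with_cemetery M \<Longrightarrow> 0 < e \<Longrightarrow> \<exists>y\<in>S. d y x < e"
proof -
  obtain T where T: "countable T" "T \<subseteq> M" "M \<subseteq> closure T" using separable by metis
  have "\<exists>y\<in>insert None (Some ` T). d y x < e" if x: "x \<in> with_cemetery M" and e: "0 < e" for x e
  proof (cases x)
    case None
    then show ?thesis using x e by (intro bexI[of _ None]) auto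
  next
    case (Some y)
    with x have y: "y \<in> M" by (auto simp: with_cemetery_iff)
    have "openin (top_of_set M) (Some -` K.mball x e)" by (rule openin_vimage_Some[OF K.openin_mball])
    then obtain V where V: "open V" "Some -` K.mball x e = M \<inter> V" unfolding openin_open by blast
    have "Some y \<in> K.mball x e" using Some x e by simp
    then have "y \<in> V" using V(2) by blast
    moreover have "y \<in> closure T" using T(3) y by blast
    ultimately obtain t where t: "t \<in> T" "t \<in> V" using V(1) by (meson closure_iff_nhds_not_empty disjoint_iff order_refl)
    then have "Some t \<in> K.mball x e" using T(2) V(2) by blast
    then show ?thesis using t(1) by (intro bexI[of _ "Some t"]) (auto simp: K.commute)
  qed
  then show ?thesis
    using T by (intro that[of "insert None (Some ` T)"]) (auto simp: with_cemetery_iff)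
qed

lemma measurable_path_skorokhod:
  assumes B: "B \<in> sets (borel_of_topology (skorokhod_topology (with_cemetery M) d))"
  shows "{c \<in> space CS. good c \<and> pdmp_path \<phi> c \<in> B} \<in> sets CS"
proof -
  obtain S where S: "countable S" "S \<subseteq> with_cemetery M"
    "\<And>x e. x \<in> with_cemetery M \<Longrightarrow> 0 < e \<Longrightarrow> \<exists>y\<in>S. d y x < e"
    using cemetery_dense by metis
  have "{c \<in> space GS. pdmp_path \<phi> c \<in> B} \<in> sets GS"
    by (rule K.measurable_skorokhod[OF measurable_path measurable_cadlag S B])
  moreover have "{c. good c} \<inter> space CS \<in> sets CS" using good_set by (simp add: Int_def conj_commute)
  ultimately have "{c \<in> space GS. pdmp_path \<phi> c \<in> B} \<in> sets CS"
    by (simp add: sets_restrict_space_iff)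
  also have "{c \<in> space GS. pdmp_path \<phi> c \<in> B} = {c \<in> space CS. good c \<and> pdmp_path \<phi> c \<in> B}"
    by (auto simp: space_GS)
  finally show ?thesis .
qed

end

text \<open>Values of the kernel representation outside \<open>[0,1]\<close> are irrelevant, since the driving uniform
  variables take values in \<open>[0,1]\<close>; clamping makes it measurable on the whole line.\<close>

lemma chain_A_clamp:
  assumes "\<And>k. 1 \<le> k \<Longrightarrow> u k \<in> {0..1}"
  shows "chain_A l \<phi> rate G w e u k = chain_A l \<phi> rate (\<lambda>i t x u. G i t x (max 0 (min 1 u))) w e u k"
proof (induction k)
  case (Suc k)
  have "max 0 (min 1 (u (Suc k))) = u (Suc k)" using assms[of "Suc k"] by simp
  then show ?case using Suc by (auto simp: Let_def split: option.split prod.split)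
qed simp

lemma chain_B_clamp:
  assumes l: "1 \<le> l" and u: "\<And>j k. j \<in> {1..l} \<Longrightarrow> 1 \<le> k \<Longrightarrow> u j k \<in> {0..1}"
  shows "chain_B l \<phi> rate G w e u k = chain_B l \<phi> rate (\<lambda>i t x u. G i t x (max 0 (min 1 u))) w e u k"
proof -
  have "max 0 (min 1 (u (first_index l T) (Suc n))) = u (first_index l T) (Suc n)" for T n
    using u[OF first_index_mem(1)[OF l], of "Suc n" T] by simp
  then have "state_B l \<phi> rate G w e u k = state_B l \<phi> rate (\<lambda>i t x u. G i t x (max 0 (min 1 u))) w e u k"
    by (induction k) (auto simp: Let_def split: option.split prod.split)
  then show ?thesis by (simp add: chain_B_def)
qed

lemma measurable_clamp: "(\<lambda>u. max 0 (min 1 u)) \<in> borel \<rightarrow>\<^sub>M unif01"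
  unfolding unif01_def by (rule measurable_restrict_space2) auto

theorem proposition2:
  fixes M :: "(real ^ 'n) set"
    and l :: nat
    and \<phi> :: "real \<Rightarrow> real \<Rightarrow> real ^ 'n \<Rightarrow> real ^ 'n"
    and rate :: "nat \<Rightarrow> real \<Rightarrow> real ^ 'n \<Rightarrow> real"
    and Q :: "nat \<Rightarrow> real \<Rightarrow> real ^ 'n \<Rightarrow> (real ^ 'n) measure"
    and G :: "nat \<Rightarrow> real \<Rightarrow> real ^ 'n \<Rightarrow> real \<Rightarrow> real ^ 'n"
    and \<mu>\<^sub>0 :: "(real ^ 'n) measure"
    and d :: "(real ^ 'n) option \<Rightarrow> (real ^ 'n) option \<Rightarrow> real"
    and P :: "'v measure" and W :: "'v \<Rightarrow> real ^ 'n"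
    and E :: "nat \<Rightarrow> nat \<Rightarrow> 'v \<Rightarrow> real" and U :: "nat \<Rightarrow> 'v \<Rightarrow> real"
    and P' :: "'w measure" and W' :: "'w \<Rightarrow> real ^ 'n"
    and E' :: "nat \<Rightarrow> nat \<Rightarrow> 'w \<Rightarrow> real" and U' :: "nat \<Rightarrow> nat \<Rightarrow> 'w \<Rightarrow> real"
    and chainX :: "'v \<Rightarrow> nat \<Rightarrow> (real ^ 'n) option \<times> ennreal \<times> nat"
    and chainY :: "'w \<Rightarrow> nat \<Rightarrow> (real ^ 'n) option \<times> ennreal \<times> nat"
    and X :: "'v \<Rightarrow> real \<Rightarrow> (real ^ 'n) option"
    and Y :: "'w \<Rightarrow> real \<Rightarrow> (real ^ 'n) option"
    and \<tau> :: "(real ^ 'n) option topology"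
  assumes "smooth_submanifold M" and "closed M"
    and "pdmp_characteristics M l \<phi> rate Q"
    and "\<forall>i\<in>{1..l}. kernel_representation M (Q i) (G i)"
    and "prob_space \<mu>\<^sub>0" and "sets \<mu>\<^sub>0 = sets (manifold_borel M)"
    and "driving_A P M \<mu>\<^sub>0 l W E U"
    and "driving_B P' M \<mu>\<^sub>0 l W' E' U'"
    and "\<And>\<omega>. chainX \<omega> = chain_A l \<phi> rate G (W \<omega>) (\<lambda>j k. E j k \<omega>) (\<lambda>k. U k \<omega>)"
    and "\<And>\<omega>. chainY \<omega> = chain_B l \<phi> rate G (W' \<omega>) (\<lambda>j k. E' j k \<omega>) (\<lambda>j k. U' j k \<omega>)"
    and "\<And>\<omega>. X \<omega> = pdmp_path \<phi> (chainX \<omega>)"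
    and "\<And>\<omega>. Y \<omega> = pdmp_path \<phi> (chainY \<omega>)"
    and "cemetery_metric M d"
    and "\<tau> = Metric_space.mtopology (with_cemetery M) d"
  shows "(chainX \<in> P \<rightarrow>\<^sub>M chain_space \<tau> l \<and> chainY \<in> P' \<rightarrow>\<^sub>M chain_space \<tau> l \<and>
          distr P (chain_space \<tau> l) chainX = distr P' (chain_space \<tau> l) chainY) \<and>
         (\<forall>B\<in>sets (borel_of_topology (skorokhod_topology (with_cemetery M) d)).
            {\<omega> \<in> space P. X \<omega> \<in> B} \<in> sets P \<and> {\<omega> \<in> space P'. Y \<omega> \<in> B} \<in> sets P' \<and>
            measure P {\<omega> \<in> space P. X \<omega> \<in> B} = measure P' {\<omega> \<in> space P'. Y \<omega> \<in> B}) \<and>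
         (AE \<omega> in P. X \<omega> \<in> cadlag \<tau> \<or> explodes_without_limit \<tau> (chainX \<omega>) (X \<omega>)) \<and>
         (AE \<omega> in P'. Y \<omega> \<in> cadlag \<tau> \<or> explodes_without_limit \<tau> (chainY \<omega>) (Y \<omega>))"
proof -
  let ?G = "\<lambda>i t x u. G i t x (max 0 (min 1 u))"
  have P: "prob_space P" "prob_space P'"
    using assms(7,8) by (simp_all add: driving_A_def driving_B_def Let_def)
  have G: "(\<lambda>(t, x, u). ?G i t x u) \<in> time_space \<Otimes>\<^sub>M manifold_borel M \<Otimes>\<^sub>M borel \<rightarrow>\<^sub>M manifold_borel M"
    if "i \<in> {1..l}" for i
  proof -
    note [measurable] = measurable_clamp
    have "(\<lambda>(t, x, u). G i t x u) \<in> time_space \<Otimes>\<^sub>M manifold_borel M \<Otimes>\<^sub>M unif01 \<rightarrow>\<^sub>M manifold_borel M"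
      using assms(4) that by (auto simp: kernel_representation_def)
    from measurable_compose[OF _ this, of "\<lambda>(t, x, u). (t, x, max 0 (min 1 u))"]
    show ?thesis by (simp add: split_beta)
  qed
  have "space \<mu>\<^sub>0 = M" using sets_eq_imp_space_eq[OF assms(6)] by simp
  then have "M \<noteq> {}" using prob_space.not_empty[OF assms(5)] by simp
  then interpret pdmp_setting M l \<phi> rate ?G d
    using assms(2,3,13) G by unfold_locales (auto simp: pdmp_characteristics_def)
  have \<tau>: "\<tau> = Metric_space.mtopology (with_cemetery M) d" by (rule assms(14))
  have U: "U k \<omega> \<in> {0..1}" if "\<omega> \<in> space P" "1 \<le> k" for k \<omega>
  proof -
    have "U k \<in> P \<rightarrow>\<^sub>M unif01" using assms(7) that(2) unfolding driving_A_def Let_def by blast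
    from measurable_space[OF this that(1)] show ?thesis by (simp add: unif01_def space_restrict_space)
  qed
  have U': "U' j k \<omega> \<in> {0..1}" if "\<omega> \<in> space P'" "j \<in> {1..l}" "1 \<le> k" for j k \<omega>
  proof -
    have "U' j k \<in> P' \<rightarrow>\<^sub>M unif01" using assms(8) that(2,3) unfolding driving_B_def Let_def by blast
    from measurable_space[OF this that(1)] show ?thesis by (simp add: unif01_def space_restrict_space)
  qed
  define A where "A = (\<lambda>\<omega>. chainA (W \<omega>) (\<lambda>j k. E j k \<omega>) (\<lambda>k. U k \<omega>))"
  define B where "B = (\<lambda>\<omega>. chain_B l \<phi> rate ?G (W' \<omega>) (\<lambda>j k. E' j k \<omega>) (\<lambda>j k. U' j k \<omega>))"
  have XA: "chainX \<omega> = A \<omega>" if "\<omega> \<in> space P" for \<omega>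
    unfolding assms(9) A_def by (rule ext, rule chain_A_clamp) (rule U[OF that])
  have YB: "chainY \<omega> = B \<omega>" if "\<omega> \<in> space P'" for \<omega>
    unfolding assms(10) B_def by (rule ext, rule chain_B_clamp[OF l]) (rule U'[OF that])
  note law = chains_same_law[OF assms(7,8), folded A_def B_def \<tau>]
  have chX: "chainX \<in> P \<rightarrow>\<^sub>M chain_space \<tau> l"
    using law(1) by (simp cong: measurable_cong add: XA)
  have chY: "chainY \<in> P' \<rightarrow>\<^sub>M chain_space \<tau> l"
    using law(2) by (simp cong: measurable_cong add: YB)
  have "distr P (chain_space \<tau> l) chainX = distr P (chain_space \<tau> l) A"
    by (rule distr_cong) (simp_all add: XA)
  also have "\<dots> = distr P' (chain_space \<tau> l) B" by (rule law(3))
  also have "\<dots> = distr P' (chain_space \<tau> l) chainY"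
    by (rule distr_cong) (simp_all add: YB)
  finally have eq: "distr P (chain_space \<tau> l) chainX = distr P' (chain_space \<tau> l) chainY" .
  have goodX: "good (chainX \<omega>)" if "\<omega> \<in> space P" for \<omega>
    unfolding XA[OF that] A_def
    using measurable_space[OF measurable_driving_A(1)[OF assms(7)] that] by (intro good_chain_A) simp
  have goodY: "good (chainY \<omega>)" if "\<omega> \<in> space P'" for \<omega>
    unfolding YB[OF that] B_def
    using measurable_space[OF measurable_driving_B(1)[OF assms(8)] that] by (intro good_chain_B) simp
  have paths: "{\<omega> \<in> space P. X \<omega> \<in> S} \<in> sets P \<and> {\<omega> \<in> space P'. Y \<omega> \<in> S} \<in> sets P' \<and>
      measure P {\<omega> \<in> space P. X \<omega> \<in> S} = measure P' {\<omega> \<in> space P'. Y \<omega> \<in> S}"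
    if S: "S \<in> sets (borel_of_topology (skorokhod_topology (with_cemetery M) d))" for S
  proof -
    let ?T = "{c \<in> space CS. good c \<and> pdmp_path \<phi> c \<in> S}"
    have T: "?T \<in> sets (chain_space \<tau> l)"
      using measurable_path_skorokhod[OF S] chain_space_eq by (simp add: \<tau>)
    have sp: "chainX \<omega> \<in> space CS" if "\<omega> \<in> space P" for \<omega>
      using measurable_space[OF chX that] chain_space_eq by (simp add: \<tau>)
    have sp': "chainY \<omega> \<in> space CS" if "\<omega> \<in> space P'" for \<omega>
      using measurable_space[OF chY that] chain_space_eq by (simp add: \<tau>)
    have 1: "{\<omega> \<in> space P. X \<omega> \<in> S} = chainX -` ?T \<inter> space P"
      using goodX sp by (auto simp: assms(11))
    have 2: "{\<omega> \<in> space P'. Y \<omega> \<in> S} = chainY -` ?T \<inter> space P'"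
      using goodY sp' by (auto simp: assms(12))
    have "measure P (chainX -` ?T \<inter> space P) = measure P' (chainY -` ?T \<inter> space P')"
      using measure_distr[OF chX T] measure_distr[OF chY T] eq by simp
    then show ?thesis
      unfolding 1 2 using measurable_sets[OF chX T] measurable_sets[OF chY T] by simp
  qed
  have "X \<omega> \<in> cadlag \<tau> \<or> explodes_without_limit \<tau> (chainX \<omega>) (X \<omega>)" if "\<omega> \<in> space P" for \<omega>
    unfolding assms(11) \<tau> by (rule cadlag_or_explodes[OF goodX[OF that]])
  moreover have "Y \<omega> \<in> cadlag \<tau> \<or> explodes_without_limit \<tau> (chainY \<omega>) (Y \<omega>)" if "\<omega> \<in> space P'" for \<omega>
    unfolding assms(12) \<tau> by (rule cadlag_or_explodes[OF goodY[OF that]])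
  ultimately show ?thesis
    using chX chY eq paths by (intro conjI ballI AE_I2) auto
qed

end
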